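(* Let $0<\varepsilon<1$ and $B>0$, and let $\beta>0$ (possibly depending on $n$). Let $\xi$ be a real random variable with $\mathbb{E}\xi=0$, $\mathbb{E}\xi^2=1$ such that $\mathbb{P}(c_1\le|\xi-\xi'|\le c_2)\ge c_3$ for positive constants $c_1<c_2$, $c_3$, where $\xi'$ is an independent copy of $\xi$. Let $A=(a_{ij})_{i,j=1}^n$ be a real symmetric matrix ($a_{ij}=a_{ji}$) with $\sum_{i,j}a_{ij}^2=1$, let $f_1,\dots,f_n$ be fixed reals, and let $\mathbf{x}=(x_1,\dots,x_n)$ with $x_i$ iid copies of $\xi$. Suppose $$\rho:=\sup_a\mathbb{P}_{\mathbf{x}}\Big(\Big|\sum_{i,j\le n}a_{ij}(x_i+f_i)(x_j+f_j)-a\Big|\le\beta\Big)\ge n^{-B}.$$ Then there exist a set $I_0\subset[n]$ of size $O_{B,\varepsilon}(1)$, a set $I\subset[n]$ of size at least $n-2n^{\varepsilon}$, and integers $k\neq0$ and $k_{ii_0}$ ($i\in I$, $i_0\in I_0$), all bounded in absolute value by $n^{O_{B,\varepsilon}(1)}$, such that, letting $R$ be the $n\times n$ matrix whose $i$-th row for $i\in I$ is given by $(R)_{ij}=k_{ij}$ if $j\in I_0$, $(R)_{ii}=k$, $(R)_{ij}=0$ otherwise, and whose rows $i\notin I$ are the corresponding rows of the identity matrix, and letting $A'=RA$, we have for every $i\in I$ $$\mathbb{P}_{\mathbf{z}}\big(|\langle\mathbf{z},\mathrm{row}_i(A')\rangle|\le\beta n^{O_{B,\varepsilon}(1)}\big)\ge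 n^{-O_{B,\varepsilon}(1)},$$ where $\mathbf{z}=(z_1,\dots,z_n)$ and the $z_i$ are iid copies of $\eta^{(1/2)}(\xi-\xi')$, with $\eta^{(1/2)}$ independent of $\xi,\xi'$.
   Context: $\eta^{(1/2)}$ denotes a random variable taking values $\pm1$ each with probability $1/4$ and $0$ with probability $1/2$. $\mathrm{row}_i(M)$ is the $i$-th row of $M$. $O_{B,\varepsilon}(1)$ denotes a quantity bounded by a constant depending only on $B,\varepsilon$ (and $c_1,c_2,c_3$), as $n\to\infty$. *)

theory Defs
  imports "HOL-Probability.Probability" "Jordan_Normal_Form.Matrix"
begin

text \<open>
  The constants of the theorem must not depend on the random variable, so random variables enter
  through their laws, which are measures on the reals, and independent copies through
  product measures. Indices run over \<^term>\<open>{..<n}\<close>.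
\<close>

definition iid_law :: "nat \<Rightarrow> real measure \<Rightarrow> (nat \<Rightarrow> real) measure" where
  "iid_law n \<mu> = (\<Pi>\<^sub>M i\<in>{..<n}. \<mu>)"

definition admissible_law :: "real \<Rightarrow> real \<Rightarrow> real \<Rightarrow> real measure \<Rightarrow> bool" where
  "admissible_law c1 c2 c3 \<mu> \<longleftrightarrow>
     real_distribution \<mu> \<and>
     integrable \<mu> (\<lambda>x. x) \<and> (\<integral>x. x \<partial>\<mu>) = 0 \<and>
     integrable \<mu> (\<lambda>x. x\<^sup>2) \<and> (\<integral>x. x\<^sup>2 \<partial>\<mu>) = 1 \<and>
     measure (\<mu> \<Otimes>\<^sub>M \<mu>) {(x, x'). c1 \<le> \<bar>x - x'\<bar> \<and> \<bar>x - x'\<bar> \<le> c2} \<ge> c3"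

definition eta_half :: "real pmf" where
  "eta_half = pmf_of_list [(-1, 1/4), (0, 1/2), (1, 1/4)]"

lemma pmf_eta_half:
  "pmf eta_half x = (if x = 0 then 1/2 else if x = 1 \<or> x = -1 then 1/4 else 0)"
proof -
  have "pmf_of_list_wf [(-1::real, 1/4::real), (0, 1/2), (1, 1/4)]"
    by (simp add: pmf_of_list_wf_def)
  then show ?thesis
    by (simp add: eta_half_def pmf_pmf_of_list)
qed

definition lazy_diff_law :: "real measure \<Rightarrow> real measure" where
  "lazy_diff_law \<mu> =
     distr (measure_pmf eta_half \<Otimes>\<^sub>M (\<mu> \<Otimes>\<^sub>M \<mu>)) borel (\<lambda>(e, x, x'). e * (x - x'))"

lemma real_distribution_lazy_diff_law:
  assumes "real_distribution \<mu>"
  shows "real_distribution (lazy_diff_law \<mu>)"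
proof -
  interpret real_distribution \<mu> by fact
  interpret E: prob_space "measure_pmf eta_half" by (rule prob_space_measure_pmf)
  interpret P: pair_prob_space \<mu> \<mu> ..
  interpret Q: pair_prob_space "measure_pmf eta_half" "\<mu> \<Otimes>\<^sub>M \<mu>" ..
  have e: "(\<lambda>p. fst p) \<in> borel_measurable (measure_pmf eta_half \<Otimes>\<^sub>M (\<mu> \<Otimes>\<^sub>M \<mu>))"
    using measurable_compose[OF measurable_fst, of "\<lambda>x::real. x" "measure_pmf eta_half" borel]
    by simp
  have i: "(\<lambda>x. x) \<in> borel_measurable \<mu>"
    by simp
  have x: "(\<lambda>p. fst (snd p)) \<in> borel_measurable (measure_pmf eta_half \<Otimes>\<^sub>M (\<mu> \<Otimes>\<^sub>M \<mu>))"
    by (intro measurable_compose[OF measurable_snd measurable_compose[OF measurable_fst i]])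
  have y: "(\<lambda>p. snd (snd p)) \<in> borel_measurable (measure_pmf eta_half \<Otimes>\<^sub>M (\<mu> \<Otimes>\<^sub>M \<mu>))"
    by (intro measurable_compose[OF measurable_snd measurable_compose[OF measurable_snd i]])
  have "(\<lambda>(e, x, x'). e * (x - x')) \<in> borel_measurable (measure_pmf eta_half \<Otimes>\<^sub>M (\<mu> \<Otimes>\<^sub>M \<mu>))"
    unfolding case_prod_beta using e x y by measurable
  then show ?thesis
    unfolding lazy_diff_law_def by (rule Q.real_distribution_distr)
qed

definition quad_concentration ::
    "nat \<Rightarrow> real measure \<Rightarrow> real mat \<Rightarrow> (nat \<Rightarrow> real) \<Rightarrow> real \<Rightarrow> real" where
  "quad_concentration n \<mu> A f \<beta> =
     (SUP a::real. measure (iid_law n \<mu>)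
        {x \<in> space (iid_law n \<mu>).
           \<bar>(\<Sum>i<n. \<Sum>j<n. A $$ (i, j) * (x i + f i) * (x j + f j)) - a\<bar> \<le> \<beta>})"

text \<open>
  The sets \<open>I\<close> and \<open>I\<^sub>0\<close> are not assumed to be disjoint. For \<open>i\<close> in both sets the diagonal entry
  is \<open>k\<close>; that is, \<open>k\<^sub>i\<^sub>i\<close> is read as \<open>k\<close>, the only reading satisfying both clauses
  \<open>R\<^sub>i\<^sub>j = k\<^sub>i\<^sub>j\<close> for \<open>j \<in> I\<^sub>0\<close> and \<open>R\<^sub>i\<^sub>i = k\<close>. In particular \<open>R\<^sub>i\<^sub>i \<noteq> 0\<close> for all \<open>i \<in> I\<close>.
\<close>

definition combination_mat ::
    "nat \<Rightarrow> nat set \<Rightarrow> nat set \<Rightarrow> int \<Rightarrow> (nat \<Rightarrow> nat \<Rightarrow> int) \<Rightarrow> real mat" where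
  "combination_mat n I I\<^sub>0 k K = mat n n (\<lambda>(i, j).
     if i \<in> I then
       (if j = i then of_int k else if j \<in> I\<^sub>0 then of_int (K i j) else 0)
     else (if j = i then 1 else 0))"

end

theory Submission
  imports Defs "HOL-Real_Asymp.Real_Asymp"
begin

text \<open>
  Let \<open>w\<close> have iid coordinates distributed as \<open>\<xi> - \<xi>'\<close>. Decoupling along a subset \<open>U\<close> of the indices
  turns the hypothesis into: with polynomial probability over \<open>w\<close>, the linear form in further iid
  copies \<open>u\<^sub>i\<close> of \<open>\<xi> - \<xi>'\<close> (\<open>i \<in> U\<close>) with coefficients \<open>L\<^sub>i = \<langle>row\<^sub>i A, z\<rangle>\<close> has a small ball of
  polynomial probability, where \<open>z\<close> is \<open>w\<close> with the coordinates in \<open>U\<close> set to 0. For a uniformly random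
  \<open>U\<close> this \<open>z\<close> has exactly the lazy law of the theorem.

  For fixed coefficients \<open>L\<close>, the small ball probability is bounded by a Gaussian average of
  \<open>exp (- q * (\<Sum>i. sin\<^sup>2 (v\<^sub>i g)))\<close> with \<open>v\<close> a multiple of \<open>L\<close>. A greedy procedure replaces, via AM-GM, \<open>M\<close> of the
  \<open>v\<^sub>i\<close> by \<open>M\<close> copies of one of them, chosen so that the combinations \<open>\<Sum> y\<^sub>l v\<^sub>l\<close> with digits
  \<open>0 \<le> y\<^sub>l < m\<^sub>l\<close> stay 1-separated. Comparison with Fejer kernels shows that the average is then
  \<open>O((\<Prod> m\<^sub>l)\<^sup>-\<^sup>1\<^sup>/\<^sup>2)\<close>, so \<open>k = \<Prod> m\<^sub>l\<close> is polynomially bounded. All but few of the remaining \<open>v\<^sub>i\<close> are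
  close to such a combination, and \<open>k\<close> clears the denominators when the chosen \<open>v\<^sub>l\<close> of small order
  are expressed through the boundedly many ones of large order.

  Finally one averages over \<open>U\<close> and \<open>w\<close> and pigeonholes over \<open>I\<^sub>0\<close>, \<open>k\<close> and the other coefficients.
\<close>

section \<open>Gaussian averages of Fejer kernels\<close>

text \<open>The obstacle is that all rows must share one bounded set \<open>I\<^sub>0\<close> and
  one \<open>k\<close>, while the linear problem left after decoupling depends on \<open>U\<close>
  and \<open>w\<close> and speaks only about rows in \<open>U\<close>.

  Boundedness comes from capping the order of a chosen element at K of size about n^(\<epsilon>/8).
  An element that reaches the cap contributes a factor K to k, and k is at most a fixed power of n,
  so there are O(1/\<epsilon>) of them, with a constant depending on B; they are the candidates for
  \<open>I\<^sub>0\<close>. There may be about log k elements below the cap, which is why they have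
  to be eliminated. Each chosen element uses up M indices, and the Fejer comparison forces M to be
  of order K^3; the exceptional set is thus of order n^(3\<epsilon>/8) log n, well below
  n^\<epsilon>.

  Uniformity is asked only of (\<open>I\<^sub>0\<close>, k), for which there are polynomially many
  candidates; the other coefficients may depend on the row and are fixed row by row. A random
  \<open>U\<close> contains a quarter of any given large set of rows except with exponentially small
  probability, so only few rows can escape.\<close>

abbreviation gauss :: "real measure" where "gauss \<equiv> std_normal_distribution"

lemma prob_space_gauss: "prob_space gauss"
  using real_dist_normal_dist by (simp add: real_distribution_def)

lemma integrable_gauss_bounded:
  fixes f :: "real \<Rightarrow> real"
  assumes "f \<in> borel_measurable borel" "\<And>x. \<bar>f x\<bar> \<le> c"
  shows "integrable gauss f"
proof -
  interpret prob_space gauss by (rule prob_space_gauss)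
  show ?thesis
    by (rule integrable_const_bound[of _ c]) (use assms in auto)
qed

lemma gauss_cos: "(\<integral>g. cos (t * g) \<partial>gauss) = exp (- (t\<^sup>2) / 2)"
proof -
  interpret real_distribution gauss by (rule real_dist_normal_dist)
  have "Re (char gauss t) = (\<integral>g. Re (iexp (t * g)) \<partial>gauss)"
    unfolding char_def
    by (rule integral_Re[symmetric]) (rule integrable_const_bound[of _ 1], auto)
  then show ?thesis
    by (simp add: char_std_normal_distribution Re_exp)
qed

text \<open>Trades the Gaussian weight for a geometric one, which is easily summed over integers. In
  logarithms the claim is the positivity of a quadratic in \<open>t\<close>, seen by completing the
  square.\<close>

lemma exp_neg_square_le: "exp (- 2 * t\<^sup>2) \<le> 2 * (1/2) powr (t::real)"
proof -
  have "ln 2 < (1::real)" by (rule ln_2_less_1)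
  moreover have "ln 2 > (0::real)" by simp
  ultimately have "(ln 2)\<^sup>2 \<le> 8 * ln (2::real)"
    by (simp add: power2_eq_square)
  moreover have "8 * (2 * t\<^sup>2 - t * ln 2 + ln 2) = (4 * t - ln 2)\<^sup>2 + (8 * ln 2 - (ln 2)\<^sup>2)"
    by (simp add: power2_eq_square algebra_simps)
  moreover have "(4 * t - ln 2)\<^sup>2 \<ge> 0" by simp
  ultimately have "0 \<le> 8 * (2 * t\<^sup>2 - t * ln 2 + ln 2)" by linarith
  then have "- 2 * t\<^sup>2 \<le> ln 2 - t * ln 2" by simp
  then have "exp (- 2 * t\<^sup>2) \<le> exp (ln 2 - t * ln 2)" by simp
  also have "\<dots> = 2 * (1/2) powr t"
    by (simp add: powr_def exp_diff ln_div exp_minus field_simps)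
  finally show ?thesis .
qed

lemma sum_half_powr_le:
  fixes Z :: "int set"
  assumes "finite Z"
  shows "(\<Sum>z\<in>Z. (1/2) powr \<bar>real_of_int z\<bar>) \<le> 3"
proof -
  have geo: "(\<Sum>n\<in>N. (1/2::real) ^ n) \<le> 2" if "finite N" for N :: "nat set"
  proof -
    have "(\<Sum>n\<in>N. (1/2::real) ^ n) \<le> (\<Sum>n. (1/2) ^ n)"
      by (rule sum_le_suminf) (use that in auto)
    also have "\<dots> = 2" by (simp add: suminf_geometric)
    finally show ?thesis .
  qed
  have geo': "(\<Sum>n\<in>N. (1/2::real) ^ n) \<le> 1" if "finite N" "0 \<notin> N" for N :: "nat set"
    using geo[of "insert 0 N"] that by simp
  have p: "(1/2) powr \<bar>real_of_int z\<bar> = (1/2::real) ^ nat \<bar>z\<bar>" for z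
    by (subst powr_realpow[symmetric]) auto
  have "(\<Sum>z\<in>Z. (1/2) powr \<bar>real_of_int z\<bar>) =
      (\<Sum>z\<in>Z \<inter> {0..}. (1/2::real) ^ nat \<bar>z\<bar>) + (\<Sum>z\<in>Z - {0..}. (1/2) ^ nat \<bar>z\<bar>)"
    using assms unfolding p by (rule sum.Int_Diff)
  also have "(\<Sum>z\<in>Z \<inter> {0..}. (1/2::real) ^ nat \<bar>z\<bar>) = (\<Sum>n\<in>(nat \<circ> abs) ` (Z \<inter> {0..}). (1/2) ^ n)"
    by (subst sum.reindex) (auto simp: inj_on_def)
  also have "\<dots> \<le> 2" by (rule geo) (use assms in auto)
  also have "(\<Sum>z\<in>Z - {0..}. (1/2::real) ^ nat \<bar>z\<bar>) = (\<Sum>n\<in>(nat \<circ> abs) ` (Z - {0..}). (1/2) ^ n)"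
    by (subst sum.reindex) (auto simp: inj_on_def)
  also have "\<dots> \<le> 1" by (rule geo') (use assms in auto)
  finally show ?thesis by simp
qed

text \<open>Separated points have distinct integer parts, so a two-sided geometric series around
  \<open>a\<close> dominates the sum, whatever \<open>a\<close> is. Rounding both \<open>h x\<close>
  and \<open>a\<close> down costs a factor 2, whence 12 = 2 * 2 * 3.\<close>

lemma separated_gauss_sum:
  fixes h :: "'a \<Rightarrow> real"
  assumes fin: "finite X" and sep: "\<And>x y. x \<in> X \<Longrightarrow> y \<in> X \<Longrightarrow> \<bar>h x - h y\<bar> < 1 \<Longrightarrow> x = y"
  shows "(\<Sum>x\<in>X. exp (- 2 * (h x - a)\<^sup>2)) \<le> 12"
proof -
  define z where "z x = \<lfloor>h x\<rfloor> - \<lfloor>a\<rfloor>" for x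
  have inj: "inj_on z X"
  proof (rule inj_onI)
    fix x y assume xy: "x \<in> X" "y \<in> X" "z x = z y"
    have "\<bar>h x - h y\<bar> < 1" using xy(3) unfolding z_def by linarith
    then show "x = y" using sep xy by blast
  qed
  have le: "exp (- 2 * (h x - a)\<^sup>2) \<le> 4 * (1/2) powr \<bar>real_of_int (z x)\<bar>" for x
  proof -
    have "\<bar>h x - a\<bar> \<ge> \<bar>real_of_int (z x)\<bar> - 1" unfolding z_def by linarith
    then have "(1/2) powr \<bar>h x - a\<bar> \<le> (1/2::real) powr (\<bar>real_of_int (z x)\<bar> - 1)"
      by (intro powr_mono') auto
    also have "\<dots> = 2 * (1/2) powr \<bar>real_of_int (z x)\<bar>"
      by (simp add: powr_diff)
    finally show ?thesis using exp_neg_square_le[of "\<bar>h x - a\<bar>"] by simp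
  qed
  have "(\<Sum>x\<in>X. exp (- 2 * (h x - a)\<^sup>2)) \<le> (\<Sum>x\<in>X. 4 * (1/2) powr \<bar>real_of_int (z x)\<bar>)"
    by (intro sum_mono le)
  also have "\<dots> = 4 * (\<Sum>y\<in>z ` X. (1/2) powr \<bar>real_of_int y\<bar>)"
    by (subst sum.reindex[OF inj]) (simp add: sum_distrib_left)
  also have "\<dots> \<le> 4 * 3" by (intro mult_left_mono sum_half_powr_le) (use fin in auto)
  finally show ?thesis by simp
qed

lemma prod_cis: "(\<Prod>x\<in>X. cis (f x)) = cis (\<Sum>x\<in>X. f x)"
  by (induction X rule: infinite_finite_induct) (auto simp: cis_mult)

lemma cmod_sum_cis_square:
  "(cmod (\<Sum>x\<in>X. cis (f x)))\<^sup>2 = (\<Sum>x\<in>X. \<Sum>y\<in>X. cos (f x - f y))"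
proof -
  have "(cmod (\<Sum>x\<in>X. cis (f x)))\<^sup>2 = (\<Sum>x\<in>X. cos (f x))\<^sup>2 + (\<Sum>x\<in>X. sin (f x))\<^sup>2"
    by (simp add: cmod_power2)
  also have "\<dots> = (\<Sum>x\<in>X. \<Sum>y\<in>X. cos (f x) * cos (f y) + sin (f x) * sin (f y))"
    by (simp add: power2_eq_square sum_product sum.distrib)
  finally show ?thesis by (simp add: cos_diff)
qed

text \<open>The Fejer kernel (sin (m \<theta>) / (m sin \<theta>))^2, normalised to have maximum 1.
  The form as an exponential sum is what makes products of kernels expand over boxes of
  digits.\<close>

definition fejer :: "nat \<Rightarrow> real \<Rightarrow> real" where
  "fejer m \<theta> = (cmod (\<Sum>u<m. cis (2 * \<theta> * real u)) / real m)\<^sup>2"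

lemma abs_sin_nat_mult_le: "\<bar>sin (real n * x)\<bar> \<le> real n * \<bar>sin x\<bar>"
proof (induction n)
  case (Suc n)
  have "\<bar>sin (real (Suc n) * x)\<bar> = \<bar>sin (real n * x) * cos x + cos (real n * x) * sin x\<bar>"
    by (simp add: sin_add algebra_simps)
  also have "\<dots> \<le> \<bar>sin (real n * x)\<bar> * \<bar>cos x\<bar> + \<bar>cos (real n * x)\<bar> * \<bar>sin x\<bar>"
    by (metis abs_mult abs_triangle_ineq)
  also have "\<dots> \<le> \<bar>sin (real n * x)\<bar> * 1 + 1 * \<bar>sin x\<bar>"
    by (intro add_mono mult_mono) auto
  finally show ?case using Suc by (simp add: algebra_simps)
qed simp

text \<open>The kernel is the average over pairs u, w < m of cos (2 (u - w) \<theta>) = 1 - 2 sin^2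
  ((u - w) \<theta>), and |sin (d \<theta>)| is at most d |sin \<theta>|.\<close>

lemma fejer_ge:
  assumes "m > 0"
  shows "fejer m \<theta> \<ge> 1 - 2 * (real m)\<^sup>2 * (sin \<theta>)\<^sup>2"
proof -
  have *: "cos (2 * \<theta> * real u - 2 * \<theta> * real w) \<ge> 1 - 2 * (real m)\<^sup>2 * (sin \<theta>)\<^sup>2"
    if "u < m" "w < m" for u w
  proof -
    define d where "d = (if u \<le> w then w - u else u - w)"
    have "cos (2 * \<theta> * real u - 2 * \<theta> * real w) = cos (2 * (real d * \<theta>))"
    proof (cases "u \<le> w")
      case True
      then have "2 * \<theta> * real u - 2 * \<theta> * real w = - (2 * (real d * \<theta>))"
        by (simp add: d_def of_nat_diff algebra_simps)
      then show ?thesis by (simp only: cos_minus)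
    next
      case False
      then show ?thesis by (simp add: d_def of_nat_diff algebra_simps)
    qed
    also have "\<dots> = 1 - 2 * (sin (real d * \<theta>))\<^sup>2" by (rule cos_double_sin)
    finally have c: "cos (2 * \<theta> * real u - 2 * \<theta> * real w) = 1 - 2 * (sin (real d * \<theta>))\<^sup>2" .
    have "\<bar>sin (real d * \<theta>)\<bar> \<le> real m * \<bar>sin \<theta>\<bar>"
      by (rule order_trans[OF abs_sin_nat_mult_le]) (use that in \<open>auto simp: d_def intro!: mult_right_mono\<close>)
    then have "(sin (real d * \<theta>))\<^sup>2 \<le> (real m * \<bar>sin \<theta>\<bar>)\<^sup>2"
      by (metis abs_ge_zero power2_abs power_mono)
    then show ?thesis using c by (simp add: power_mult_distrib)
  qed
  have "(\<Sum>u<m. \<Sum>w<m. 1 - 2 * (real m)\<^sup>2 * (sin \<theta>)\<^sup>2)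
      \<le> (\<Sum>u<m. \<Sum>w<m. cos (2 * \<theta> * real u - 2 * \<theta> * real w))"
    by (intro sum_mono *) auto
  then have "(real m)\<^sup>2 * (1 - 2 * (real m)\<^sup>2 * (sin \<theta>)\<^sup>2) \<le> (real m)\<^sup>2 * fejer m \<theta>"
    using assms by (simp add: fejer_def power_divide cmod_sum_cis_square) (simp add: power2_eq_square mult.assoc)
  then show ?thesis using assms by simp
qed

text \<open>Start from exp (-a X) \<le> 1 / (1 + a X) with X = sin^2 \<theta> and split at X = 1 /
  (4 m^2). Below this point the quadratic lower bound of the kernel wins; above it, 1 / (1 + a X) is
  already smaller than the additive error.\<close>

lemma exp_le_fejer:
  assumes "m > 0" "a \<ge> 4 * (real m)\<^sup>2"
  shows "exp (- a * (sin \<theta>)\<^sup>2) \<le> fejer m \<theta> + 4 * (real m)\<^sup>2 / a"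
proof -
  define X where "X = (sin \<theta>)\<^sup>2"
  have X: "X \<ge> 0" by (simp add: X_def)
  have mm: "(real m)\<^sup>2 > 0" using assms by simp
  then have a: "a > 0" using assms by linarith
  have f0: "fejer m \<theta> \<ge> 0" by (simp add: fejer_def)
  have "1 + a * X \<le> exp (a * X)" by (rule exp_ge_add_one_self)
  moreover have pos: "1 + a * X > 0" using a X by (simp add: add_pos_nonneg)
  ultimately have e: "exp (- a * X) \<le> 1 / (1 + a * X)"
    by (simp add: exp_minus field_simps)
  show ?thesis
  proof (cases "X \<le> 1 / (4 * (real m)\<^sup>2)")
    case True
    then have "4 * (real m)\<^sup>2 * X \<le> 1" using mm by (simp add: field_simps)
    then have "a * (4 * (real m)\<^sup>2 * X) \<le> a * 1" using a by (intro mult_left_mono) auto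
    then have "2 * (real m)\<^sup>2 * (1 + a * X) \<le> a" using assms by (simp add: algebra_simps)
    then have "X * (2 * (real m)\<^sup>2 * (1 + a * X)) \<le> X * a" using X by (rule mult_left_mono)
    then have "1 \<le> (1 - 2 * (real m)\<^sup>2 * X) * (1 + a * X)" by (simp add: algebra_simps)
    then have "1 / (1 + a * X) \<le> 1 - 2 * (real m)\<^sup>2 * X" using pos by (simp add: field_simps)
    also have "\<dots> \<le> fejer m \<theta>" using fejer_ge[OF assms(1), of \<theta>] by (simp add: X_def)
    finally have "exp (- a * X) \<le> fejer m \<theta>" using e by linarith
    moreover have "4 * (real m)\<^sup>2 / a \<ge> 0" using a by simp
    ultimately show ?thesis by (simp add: X_def)
  next
    case False
    then have "1 \<le> 4 * (real m)\<^sup>2 * X" using mm by (simp add: field_simps)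
    then have "a \<le> 4 * (real m)\<^sup>2 * X * a" using a by simp
    then have "1 / (1 + a * X) \<le> 4 * (real m)\<^sup>2 / a"
      using a pos mm by (simp add: field_simps add_increasing)
    then show ?thesis using e f0 by (simp add: X_def)
  qed
qed

text \<open>The product of kernels is the squared modulus of one exponential sum over the box of
  digit vectors. Its Gaussian average is therefore a double sum of exp (-2 (h u - h w)^2), divided
  by the square of the box size. Separation bounds each inner sum by 12, and the outer sum cancels
  one factor of the box size.\<close>

lemma prod_fejer_gauss_le:
  fixes v :: "'a \<Rightarrow> real" and m :: "'a \<Rightarrow> nat"
  assumes fin: "finite S" and m: "\<And>j. j \<in> S \<Longrightarrow> m j > 0"
    and sep: "\<And>y::'a \<Rightarrow> int. (\<And>j. j \<in> S \<Longrightarrow> \<bar>y j\<bar> < int (m j)) \<Longrightarrow>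
        \<bar>\<Sum>j\<in>S. real_of_int (y j) * v j\<bar> < 1 \<Longrightarrow> (\<forall>j\<in>S. y j = 0)"
  shows "(\<integral>g. (\<Prod>j\<in>S. fejer (m j) (v j * g)) \<partial>gauss) \<le> 12 / (\<Prod>j\<in>S. real (m j))"
proof -
  define Bx where "Bx = PiE S (\<lambda>j. {..<m j})"
  define h where "h u = (\<Sum>j\<in>S. real (u j) * v j)" for u :: "'a \<Rightarrow> nat"
  define P where "P = (\<Prod>j\<in>S. real (m j))"
  have P: "P > 0" unfolding P_def using m by (intro prod_pos) auto
  have finB: "finite Bx" unfolding Bx_def using fin by (intro finite_PiE) auto
  have cardB: "real (card Bx) = P" unfolding Bx_def P_def by (subst card_PiE[OF fin]) simp
  have hsep: "u = w" if "u \<in> Bx" "w \<in> Bx" "\<bar>h u - h w\<bar> < 1" for u w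
  proof -
    define y where "y j = int (u j) - int (w j)" for j
    have lt: "u j < m j" "w j < m j" if "j \<in> S" for j
      using \<open>u \<in> Bx\<close> \<open>w \<in> Bx\<close> that unfolding Bx_def by (auto simp: PiE_iff)
    have "\<bar>y j\<bar> < int (m j)" if "j \<in> S" for j
      using lt[OF that] unfolding y_def by linarith
    moreover have "(\<Sum>j\<in>S. real_of_int (y j) * v j) = h u - h w"
      by (simp add: h_def y_def sum_subtractf algebra_simps)
    ultimately have "\<forall>j\<in>S. y j = 0" using that by (intro sep) auto
    then have "\<And>j. j \<in> S \<Longrightarrow> u j = w j" by (simp add: y_def)
    then show ?thesis using that unfolding Bx_def by (intro PiE_ext) auto
  qed
  have prod_eq: "(\<Prod>j\<in>S. fejer (m j) (v j * g)) =
      (\<Sum>u\<in>Bx. \<Sum>w\<in>Bx. cos (2 * (h u - h w) * g)) / P\<^sup>2" for g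
  proof -
    have "(\<Prod>j\<in>S. \<Sum>u<m j. cis (2 * (v j * g) * real u)) =
        (\<Sum>u\<in>Bx. \<Prod>j\<in>S. cis (2 * (v j * g) * real (u j)))"
      unfolding Bx_def using fin by (subst prod_sum_PiE) auto
    also have "\<dots> = (\<Sum>u\<in>Bx. cis (2 * h u * g))"
      by (intro sum.cong refl) (simp add: prod_cis h_def sum_distrib_left sum_distrib_right mult_ac)
    finally have e: "(\<Prod>j\<in>S. \<Sum>u<m j. cis (2 * (v j * g) * real u)) = (\<Sum>u\<in>Bx. cis (2 * h u * g))" .
    have "(\<Prod>j\<in>S. fejer (m j) (v j * g)) =
        (cmod (\<Prod>j\<in>S. \<Sum>u<m j. cis (2 * (v j * g) * real u)) / P)\<^sup>2"
      unfolding fejer_def P_def prod_norm[symmetric] prod_dividef[symmetric] prod_power_distrib by (rule refl)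
    also have "\<dots> = (cmod (\<Sum>u\<in>Bx. cis (2 * h u * g)))\<^sup>2 / P\<^sup>2"
      by (simp add: e power_divide)
    also have "\<dots> = (\<Sum>u\<in>Bx. \<Sum>w\<in>Bx. cos (2 * (h u - h w) * g)) / P\<^sup>2"
      unfolding cmod_sum_cis_square by (simp add: left_diff_distrib right_diff_distrib)
    finally show ?thesis .
  qed
  have "(\<integral>g. (\<Prod>j\<in>S. fejer (m j) (v j * g)) \<partial>gauss) =
      (\<Sum>u\<in>Bx. \<Sum>w\<in>Bx. (\<integral>g. cos (2 * (h u - h w) * g) \<partial>gauss)) / P\<^sup>2"
    unfolding prod_eq
    by (simp add: Bochner_Integration.integral_sum integrable_gauss_bounded[of _ 1])
  also have "\<dots> = (\<Sum>u\<in>Bx. \<Sum>w\<in>Bx. exp (- 2 * (h w - h u)\<^sup>2)) / P\<^sup>2"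
    unfolding gauss_cos
    by (simp add: power_mult_distrib power2_commute[of "h _" "h _"] del: right_diff_distrib_numeral)
  also have "\<dots> \<le> (\<Sum>u\<in>Bx. 12) / P\<^sup>2"
    by (intro divide_right_mono sum_mono separated_gauss_sum finB hsep) auto
  also have "\<dots> = 12 / P" using P by (simp add: cardB power2_eq_square)
  finally show ?thesis by (simp add: P_def)
qed

lemma fejer_measurable [measurable]: "fejer m \<in> borel_measurable borel"
proof -
  have "continuous_on UNIV (fejer m)"
    unfolding fejer_def cis_conv_exp by (cases "m = 0") (auto intro!: continuous_intros)
  then show ?thesis by (rule borel_measurable_continuous_onI)
qed

lemma fejer_bounds: "0 \<le> fejer m \<theta>" "fejer m \<theta> \<le> 1"
proof -
  have "cmod (\<Sum>u<m. cis (2 * \<theta> * real u)) \<le> (\<Sum>u<m. cmod (cis (2 * \<theta> * real u)))"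
    by (rule norm_sum)
  then have "cmod (\<Sum>u<m. cis (2 * \<theta> * real u)) \<le> real m" by simp
  then have "cmod (\<Sum>u<m. cis (2 * \<theta> * real u)) / real m \<le> 1"
    by (cases "m = 0") simp_all
  then show "fejer m \<theta> \<le> 1" unfolding fejer_def by (simp add: power_le_one)
qed (simp add: fejer_def)

section \<open>Dissociated boxes\<close>

text \<open>The signed digits with |y l| < m l are exactly the differences of digit vectors with 0
  \<le> u l < m l, so this expresses that the combinations over the box are pairwise
  1-separated.\<close>

definition dissoc :: "('a \<Rightarrow> real) \<Rightarrow> 'a set \<Rightarrow> ('a \<Rightarrow> nat) \<Rightarrow> bool" where
  "dissoc v S m \<longleftrightarrow> (\<forall>y::'a \<Rightarrow> int. (\<forall>l\<in>S. \<bar>y l\<bar> < int (m l)) \<longrightarrow>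
     \<bar>\<Sum>l\<in>S. real_of_int (y l) * v l\<bar> < 1 \<longrightarrow> (\<forall>l\<in>S. y l = 0))"

lemma dissoc_subset:
  assumes "dissoc v S m" "X \<subseteq> S" "finite S" "\<And>j. j \<in> S \<Longrightarrow> m j > 0"
  shows "dissoc v X m"
  unfolding dissoc_def
proof (intro allI impI)
  fix y :: "'a \<Rightarrow> int"
  assume y: "\<forall>l\<in>X. \<bar>y l\<bar> < int (m l)" "\<bar>\<Sum>l\<in>X. real_of_int (y l) * v l\<bar> < 1"
  define z where "z l = (if l \<in> X then y l else 0)" for l
  have "(\<Sum>l\<in>S. real_of_int (z l) * v l) = (\<Sum>l\<in>X. real_of_int (y l) * v l)"
    by (rule sum.mono_neutral_cong_right) (use assms in \<open>auto simp: z_def\<close>)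
  moreover have "\<forall>l\<in>S. \<bar>z l\<bar> < int (m l)" using y assms by (auto simp: z_def)
  ultimately have "\<forall>l\<in>S. z l = 0" using assms(1) y(2) unfolding dissoc_def by auto
  then show "\<forall>l\<in>X. y l = 0" using assms(2) by (fastforce simp: z_def)
qed

lemma sqrt_prod: "sqrt (\<Prod>x\<in>X. f x) = (\<Prod>x\<in>X. sqrt (f x))"
  by (induction X rule: infinite_finite_induct) (auto simp: real_sqrt_mult)

text \<open>Each factor exp (-a sin^2) is at most a Fejer kernel plus a constant
  \<open>\<delta> j\<close>. Expanding the product gives one term per subset of \<open>S\<close>;
  subsets stay dissociated, so every term can be averaged, and the result folds back into the
  product of 1 / m + \<open>\<delta>\<close>. Settling for the square root of the box size leaves
  room to absorb \<open>\<delta>\<close> in each factor, so that no constant to the power |S|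
  appears.\<close>

lemma gauss_box_bound:
  fixes v :: "'a \<Rightarrow> real" and m :: "'a \<Rightarrow> nat"
  assumes fin: "finite S" and m: "\<And>j. j \<in> S \<Longrightarrow> 2 \<le> m j"
    and a: "\<And>j. j \<in> S \<Longrightarrow> 16 * real (m j) ^ 3 \<le> a"
    and dis: "dissoc v S m"
  shows "(\<integral>g. exp (- a * (\<Sum>j\<in>S. (sin (v j * g))\<^sup>2)) \<partial>gauss) \<le> 12 / sqrt (\<Prod>j\<in>S. real (m j))"
proof -
  define \<delta> where "\<delta> j = 4 * (real (m j))\<^sup>2 / a" for j
  have j: "m j > 0" "a > 0" "4 * (real (m j))\<^sup>2 \<le> a" "0 \<le> \<delta> j"
    "1 / real (m j) + \<delta> j \<le> 1 / sqrt (real (m j))" if "j \<in> S" for j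
  proof -
    have m2: "real (m j) \<ge> 2" using m[OF that] by simp
    then show "m j > 0" by simp
    have c: "16 * real (m j) ^ 3 \<le> a" using a[OF that] .
    show apos: "a > 0" by (rule less_le_trans[OF _ c]) (use m2 in simp)
    have "4 * (real (m j))\<^sup>2 * 1 \<le> 4 * (real (m j))\<^sup>2 * (4 * real (m j))"
      by (rule mult_left_mono) (use m2 in auto)
    then show "4 * (real (m j))\<^sup>2 \<le> a"
      using c by (simp add: power2_eq_square power3_eq_cube)
    show "0 \<le> \<delta> j" using apos by (simp add: \<delta>_def)
    have "\<delta> j * real (m j) = 4 * real (m j) ^ 3 / a"
      by (simp add: \<delta>_def power2_eq_square power3_eq_cube)
    also have "\<dots> \<le> 1 / 4" using c apos by (simp add: field_simps)
    finally have d: "\<delta> j * real (m j) \<le> 1 / 4" .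
    define t where "t = sqrt (real (m j))"
    have t: "t\<^sup>2 = real (m j)" "t > 0" using m2 by (auto simp: t_def)
    \<comment> \<open>The cubic lower bound on \<open>a\<close> gives 1 + \<open>\<delta> j\<close>
      m \<le> 5/4, and m \<ge> 2 gives sqrt m \<ge> 5/4.\<close>
    have "t \<ge> 5 / 4" unfolding t_def by (rule real_le_rsqrt) (use m2 in \<open>simp add: power2_eq_square\<close>)
    then have "1 + \<delta> j * t\<^sup>2 \<le> t" using d unfolding t(1) by linarith
    then have "(1 + \<delta> j * t\<^sup>2) / t\<^sup>2 \<le> t / t\<^sup>2" by (rule divide_right_mono) simp
    then have "1 / t\<^sup>2 + \<delta> j \<le> 1 / t" using t(2) by (simp add: field_simps power2_eq_square)
    then show "1 / real (m j) + \<delta> j \<le> 1 / sqrt (real (m j))" by (simp add: t_def)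
  qed
  have le: "exp (- a * (\<Sum>j\<in>S. (sin (v j * g))\<^sup>2)) \<le>
      (\<Sum>X\<in>Pow S. (\<Prod>j\<in>X. fejer (m j) (v j * g)) * (\<Prod>j\<in>S-X. \<delta> j))" for g
  proof -
    have "exp (- a * (\<Sum>j\<in>S. (sin (v j * g))\<^sup>2)) = (\<Prod>j\<in>S. exp (- a * (sin (v j * g))\<^sup>2))"
      using fin by (simp add: sum_distrib_left exp_sum)
    also have "\<dots> \<le> (\<Prod>j\<in>S. fejer (m j) (v j * g) + \<delta> j)"
      unfolding \<delta>_def by (intro prod_mono conjI exp_le_fejer j) auto
    also have "\<dots> = (\<Sum>X\<in>Pow S. (\<Prod>j\<in>X. fejer (m j) (v j * g)) * (\<Prod>j\<in>S-X. \<delta> j))"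
      using fin by (rule prod_add)
    finally show ?thesis .
  qed
  have int: "integrable gauss (\<lambda>g. \<Prod>j\<in>X. fejer (m j) (v j * g))" for X
    by (rule integrable_gauss_bounded[of _ 1])
      (auto simp: abs_prod fejer_bounds intro!: prod_le_1)
  have "(\<integral>g. exp (- a * (\<Sum>j\<in>S. (sin (v j * g))\<^sup>2)) \<partial>gauss) \<le>
      (\<integral>g. (\<Sum>X\<in>Pow S. (\<Prod>j\<in>X. fejer (m j) (v j * g)) * (\<Prod>j\<in>S-X. \<delta> j)) \<partial>gauss)"
  proof (rule integral_mono_AE')
    show "integrable gauss (\<lambda>g. \<Sum>X\<in>Pow S. (\<Prod>j\<in>X. fejer (m j) (v j * g)) * (\<Prod>j\<in>S-X. \<delta> j))"
      using int by auto
  qed (use le in simp, intro AE_I2 order_trans[OF exp_ge_zero le])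
  also have "\<dots> = (\<Sum>X\<in>Pow S. (\<integral>g. (\<Prod>j\<in>X. fejer (m j) (v j * g)) \<partial>gauss) * (\<Prod>j\<in>S-X. \<delta> j))"
    using int by (subst Bochner_Integration.integral_sum) auto
  also have "\<dots> \<le> (\<Sum>X\<in>Pow S. 12 / (\<Prod>j\<in>X. real (m j)) * (\<Prod>j\<in>S-X. \<delta> j))"
  proof (intro sum_mono mult_right_mono prod_nonneg)
    fix X assume X: "X \<in> Pow S"
    have "dissoc v X m" by (rule dissoc_subset[OF dis]) (use X fin j in auto)
    then show "(\<integral>g. (\<Prod>j\<in>X. fejer (m j) (v j * g)) \<partial>gauss) \<le> 12 / (\<Prod>j\<in>X. real (m j))"
      using X fin j(1) unfolding dissoc_def
      by (intro prod_fejer_gauss_le) (auto intro: finite_subset)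
  qed (use j in auto)
  also have "\<dots> = 12 * (\<Prod>j\<in>S. 1 / real (m j) + \<delta> j)"
    unfolding prod_add[OF fin] by (simp add: sum_distrib_left prod_dividef)
  also have "\<dots> \<le> 12 * (\<Prod>j\<in>S. 1 / sqrt (real (m j)))"
    by (intro mult_left_mono prod_mono conjI j add_nonneg_nonneg) auto
  also have "\<dots> = 12 / sqrt (\<Prod>j\<in>S. real (m j))"
    by (simp add: prod_dividef sqrt_prod)
  finally show ?thesis .
qed

definition near :: "('a \<Rightarrow> real) \<Rightarrow> 'a set \<Rightarrow> ('a \<Rightarrow> nat) \<Rightarrow> real \<Rightarrow> bool" where
  "near v S m x \<longleftrightarrow> (\<exists>y::'a \<Rightarrow> int. (\<forall>l\<in>S. \<bar>y l\<bar> < int (m l)) \<and>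
     \<bar>x - (\<Sum>l\<in>S. real_of_int (y l) * v l)\<bar> < 1)"

lemma near_uminus: "near v S m (- x) \<longleftrightarrow> near v S m x"
proof -
  have "near v S m (- x)" if "near v S m x" for x
  proof -
    from that obtain y :: "'a \<Rightarrow> int" where y: "\<forall>l\<in>S. \<bar>y l\<bar> < int (m l)"
      "\<bar>x - (\<Sum>l\<in>S. real_of_int (y l) * v l)\<bar> < 1" unfolding near_def by blast
    have "\<bar>- x - (\<Sum>l\<in>S. real_of_int (- y l) * v l)\<bar> < 1"
      using y(2) by (simp add: sum_negf abs_minus_commute)
    with y(1) show ?thesis unfolding near_def by (intro exI[of _ "\<lambda>l. - y l"]) auto
  qed
  from this[of x] this[of "- x"] show ?thesis by auto
qed

text \<open>Here \<open>d'\<close> is the order of \<open>v i\<close> modulo the box of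
  \<open>S\<close>, or a cap below it. A short combination with \<open>y i\<close> nonzero would put
  the multiple of \<open>v i\<close> by |y i| < \<open>d'\<close> near the box; without
  \<open>v i\<close> the combination is one of \<open>S\<close>.\<close>

lemma dissoc_insert:
  assumes "dissoc v S m" "finite S" "i \<notin> S"
    and "\<And>d. 0 < d \<Longrightarrow> d < d' \<Longrightarrow> \<not> near v S m (real d * v i)"
  shows "dissoc v (insert i S) (m(i := d'))"
  unfolding dissoc_def
proof (intro allI impI)
  fix y :: "'a \<Rightarrow> int"
  assume y: "\<forall>l\<in>insert i S. \<bar>y l\<bar> < int ((m(i := d')) l)"
    and s: "\<bar>\<Sum>l\<in>insert i S. real_of_int (y l) * v l\<bar> < 1"
  have yS: "\<forall>l\<in>S. \<bar>y l\<bar> < int (m l)" using y assms(3) by (metis fun_upd_other insert_iff)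
  have s': "\<bar>real_of_int (y i) * v i + (\<Sum>l\<in>S. real_of_int (y l) * v l)\<bar> < 1"
    using s assms by simp
  have y0: "y i = 0"
  proof (rule ccontr)
    assume ne: "y i \<noteq> 0"
    have "near v S m (- (real_of_int (y i) * v i))"
      unfolding near_def by (intro exI[of _ y] conjI yS) (use s' in linarith)
    then have "near v S m (real_of_int (y i) * v i)" by (simp add: near_uminus)
    then have "near v S m (real (nat \<bar>y i\<bar>) * v i)"
      by (cases "y i \<ge> 0") (use near_uminus[of v S m "real_of_int (y i) * v i"] in auto)
    moreover have "0 < nat \<bar>y i\<bar>" "nat \<bar>y i\<bar> < d'" using ne y by auto
    ultimately show False using assms(4) by blast
  qed
  then have "\<forall>l\<in>S. y l = 0" using assms(1) yS s' unfolding dissoc_def by auto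
  with y0 show "\<forall>l\<in>insert i S. y l = 0" by auto
qed

section \<open>Greedy construction of a dissociated set\<close>

text \<open>With \<open>k = \<Prod> m\<^sub>l\<close>, the multiples by \<open>k\<close> of the box combinations of \<open>S\<close> are integer combinations of \<open>G\<close>,
  with coefficients at most \<open>k s\<close>, up to an error \<open>k e\<close>. Bounding all combinations rather than
  the single \<open>v\<^sub>l\<close> makes \<open>e\<close> and \<open>s\<close> only double with each new element.\<close>

definition spanned :: "('a \<Rightarrow> real) \<Rightarrow> 'a set \<Rightarrow> ('a \<Rightarrow> nat) \<Rightarrow> 'a set \<Rightarrow> real \<Rightarrow> real \<Rightarrow> bool" where
  "spanned v S m G e s \<longleftrightarrow> (\<forall>y::'a \<Rightarrow> int. (\<forall>l\<in>S. \<bar>y l\<bar> < int (m l)) \<longrightarrow>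
     (\<exists>b::'a \<Rightarrow> int. (\<forall>h\<in>G. \<bar>real_of_int (b h)\<bar> \<le> (\<Prod>l\<in>S. real (m l)) * s) \<and>
       \<bar>(\<Prod>l\<in>S. real (m l)) * (\<Sum>l\<in>S. real_of_int (y l) * v l) - (\<Sum>h\<in>G. real_of_int (b h) * v h)\<bar>
         \<le> (\<Prod>l\<in>S. real (m l)) * e))"

text \<open>The new element joins the generators. Old coefficients are multiplied by
  \<open>d\<close>, in step with k, so the relative error does not grow; the new coefficient is d k
  \<open>y i\<close> with |y i| < d, which explains the condition
  \<open>real d \<le> s'\<close>.\<close>

lemma spanned_insert_new:
  fixes v :: "'a \<Rightarrow> real"
  assumes sp: "spanned v S m G e s" and fin: "finite S" "finite G" and i: "i \<notin> S" "G \<subseteq> S"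
    and s': "s \<le> s'" "real d \<le> s'" and e': "e \<le> e'"
  shows "spanned v (insert i S) (m(i := d)) (insert i G) e' s'"
  unfolding spanned_def
proof (intro allI impI)
  fix y :: "'a \<Rightarrow> int"
  assume y: "\<forall>l\<in>insert i S. \<bar>y l\<bar> < int ((m(i := d)) l)"
  define k where "k = (\<Prod>l\<in>S. real (m l))"
  have k: "k \<ge> 0" unfolding k_def by (intro prod_nonneg) auto
  have k': "(\<Prod>l\<in>insert i S. real ((m(i := d)) l)) = real d * k"
    using fin i by (auto simp: k_def intro!: prod.cong)
  have sumi: "(\<Sum>l\<in>insert i S. real_of_int (y l) * v l) = real_of_int (y i) * v i + (\<Sum>l\<in>S. real_of_int (y l) * v l)"
    using fin i by simp
  have yS: "\<forall>l\<in>S. \<bar>y l\<bar> < int (m l)" using y i by (metis fun_upd_other insert_iff)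
  have yi: "\<bar>real_of_int (y i)\<bar> \<le> real d" using y by (simp flip: of_int_abs)
  obtain b :: "'a \<Rightarrow> int" where b: "\<forall>h\<in>G. \<bar>real_of_int (b h)\<bar> \<le> k * s"
    "\<bar>k * (\<Sum>l\<in>S. real_of_int (y l) * v l) - (\<Sum>h\<in>G. real_of_int (b h) * v h)\<bar> \<le> k * e"
    using sp yS unfolding spanned_def k_def by blast
  have kI: "k = real_of_int (\<Prod>l\<in>S. int (m l))" by (simp add: k_def)
  define b' where "b' h = (if h = i then int d * (\<Prod>l\<in>S. int (m l)) * y i else int d * b h)" for h
  have b'i: "real_of_int (b' i) = real d * k * real_of_int (y i)" by (simp add: b'_def kI)
  have b'G: "real_of_int (b' h) = real d * real_of_int (b h)" if "h \<in> G" for h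
    using that i by (auto simp: b'_def)
  have iG: "i \<notin> G" using i by auto
  show "\<exists>b::'a \<Rightarrow> int. (\<forall>h\<in>insert i G. \<bar>real_of_int (b h)\<bar> \<le> (\<Prod>l\<in>insert i S. real ((m(i := d)) l)) * s') \<and>
       \<bar>(\<Prod>l\<in>insert i S. real ((m(i := d)) l)) * (\<Sum>l\<in>insert i S. real_of_int (y l) * v l) - (\<Sum>h\<in>insert i G. real_of_int (b h) * v h)\<bar>
         \<le> (\<Prod>l\<in>insert i S. real ((m(i := d)) l)) * e'"
    unfolding k' sumi
  proof (intro exI[of _ b'] conjI ballI)
    fix h assume "h \<in> insert i G"
    then consider "h = i" | "h \<in> G" by blast
    then show "\<bar>real_of_int (b' h)\<bar> \<le> real d * k * s'"
    proof cases
      case 1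
      have "\<bar>real_of_int (b' h)\<bar> = real d * k * \<bar>real_of_int (y i)\<bar>"
        unfolding 1 b'i using k by (simp add: abs_mult)
      also have "\<dots> \<le> real d * k * s'" using yi s' k by (intro mult_left_mono) auto
      finally show ?thesis .
    next
      case 2
      have "\<bar>real_of_int (b' h)\<bar> = real d * \<bar>real_of_int (b h)\<bar>"
        unfolding b'G[OF 2] by (simp add: abs_mult)
      also have "\<dots> \<le> real d * (k * s)" using b(1) 2 by (intro mult_left_mono) auto
      also have "\<dots> \<le> real d * (k * s')" using s' k by (intro mult_left_mono) auto
      finally show ?thesis by (simp add: mult.assoc)
    qed
  next
    have "(\<Sum>h\<in>insert i G. real_of_int (b' h) * v h) =
        real d * k * real_of_int (y i) * v i + real d * (\<Sum>h\<in>G. real_of_int (b h) * v h)"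
      using fin iG b'G by (simp add: b'i sum_distrib_left mult.assoc cong: sum.cong)
    then have "\<bar>real d * k * (real_of_int (y i) * v i + (\<Sum>l\<in>S. real_of_int (y l) * v l)) - (\<Sum>h\<in>insert i G. real_of_int (b' h) * v h)\<bar>
      = \<bar>real d * (k * (\<Sum>l\<in>S. real_of_int (y l) * v l) - (\<Sum>h\<in>G. real_of_int (b h) * v h))\<bar>"
      by (simp add: algebra_simps)
    also have "\<dots> = real d * \<bar>k * (\<Sum>l\<in>S. real_of_int (y l) * v l) - (\<Sum>h\<in>G. real_of_int (b h) * v h)\<bar>"
      by (simp add: abs_mult)
    also have "\<dots> \<le> real d * (k * e)" using b(2) by (intro mult_left_mono) auto
    also have "\<dots> \<le> real d * (k * e')" using e' k by (intro mult_left_mono) auto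
    finally show "\<bar>real d * k * (real_of_int (y i) * v i + (\<Sum>l\<in>S. real_of_int (y l) * v l)) - (\<Sum>h\<in>insert i G. real_of_int (b' h) * v h)\<bar>
      \<le> real d * k * e'" by (simp add: mult.assoc)
  qed
qed

text \<open>The new element is eliminated: d \<open>v i\<close> lies within 1 of a box combination
  X, so d k \<open>y i\<close> \<open>v i\<close> is replaced by the expression of k X, taken
  \<open>y i\<close> times. With the expression of the old part this doubles \<open>e\<close> and
  \<open>s\<close>, and the distance to X adds the 1. Iterating e -> 2 e + 1 from 0 gives the 2^r -
  1 of \<open>greedy_state\<close>.\<close>

lemma spanned_insert_near:
  fixes v :: "'a \<Rightarrow> real"
  assumes sp: "spanned v S m G e s" and fin: "finite S" "finite G" and i: "i \<notin> S" "G \<subseteq> S"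
    and near: "near v S m (real d * v i)"
  shows "spanned v (insert i S) (m(i := d)) G (2 * e + 1) (2 * s)"
  unfolding spanned_def
proof (intro allI impI)
  fix y :: "'a \<Rightarrow> int"
  assume y: "\<forall>l\<in>insert i S. \<bar>y l\<bar> < int ((m(i := d)) l)"
  define k where "k = (\<Prod>l\<in>S. real (m l))"
  have k: "k \<ge> 0" unfolding k_def by (intro prod_nonneg) auto
  have k': "(\<Prod>l\<in>insert i S. real ((m(i := d)) l)) = real d * k"
    using fin i by (auto simp: k_def intro!: prod.cong)
  have sumi: "(\<Sum>l\<in>insert i S. real_of_int (y l) * v l) = real_of_int (y i) * v i + (\<Sum>l\<in>S. real_of_int (y l) * v l)"
    using fin i by simp
  have yS: "\<forall>l\<in>S. \<bar>y l\<bar> < int (m l)" using y i by (metis fun_upd_other insert_iff)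
  have yi: "\<bar>real_of_int (y i)\<bar> \<le> real d" using y by (simp flip: of_int_abs)
  define Y where "Y = (\<Sum>l\<in>S. real_of_int (y l) * v l)"
  obtain b :: "'a \<Rightarrow> int" where b: "\<forall>h\<in>G. \<bar>real_of_int (b h)\<bar> \<le> k * s"
    "\<bar>k * Y - (\<Sum>h\<in>G. real_of_int (b h) * v h)\<bar> \<le> k * e"
    using sp yS unfolding spanned_def k_def Y_def by blast
  obtain x :: "'a \<Rightarrow> int" where x: "\<forall>l\<in>S. \<bar>x l\<bar> < int (m l)"
    "\<bar>real d * v i - (\<Sum>l\<in>S. real_of_int (x l) * v l)\<bar> < 1"
    using near unfolding near_def by blast
  define X where "X = (\<Sum>l\<in>S. real_of_int (x l) * v l)"
  obtain c :: "'a \<Rightarrow> int" where c: "\<forall>h\<in>G. \<bar>real_of_int (c h)\<bar> \<le> k * s"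
    "\<bar>k * X - (\<Sum>h\<in>G. real_of_int (c h) * v h)\<bar> \<le> k * e"
    using sp x(1) unfolding spanned_def k_def X_def by blast
  define b' where "b' h = int d * b h + y i * c h" for h
  show "\<exists>b::'a \<Rightarrow> int. (\<forall>h\<in>G. \<bar>real_of_int (b h)\<bar> \<le> (\<Prod>l\<in>insert i S. real ((m(i := d)) l)) * (2 * s)) \<and>
       \<bar>(\<Prod>l\<in>insert i S. real ((m(i := d)) l)) * (\<Sum>l\<in>insert i S. real_of_int (y l) * v l) - (\<Sum>h\<in>G. real_of_int (b h) * v h)\<bar>
         \<le> (\<Prod>l\<in>insert i S. real ((m(i := d)) l)) * (2 * e + 1)"
    unfolding k' sumi Y_def[symmetric]
  proof (intro exI[of _ b'] conjI ballI)
    fix h assume h: "h \<in> G"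
    have "\<bar>real_of_int (b' h)\<bar> \<le> real d * \<bar>real_of_int (b h)\<bar> + \<bar>real_of_int (y i)\<bar> * \<bar>real_of_int (c h)\<bar>"
      unfolding b'_def of_int_add of_int_mult by (rule order_trans[OF abs_triangle_ineq]) (simp add: abs_mult)
    also have "\<dots> \<le> real d * (k * s) + real d * (k * s)"
      using b(1) c(1) h yi by (intro add_mono mult_mono) auto
    finally show "\<bar>real_of_int (b' h)\<bar> \<le> real d * k * (2 * s)" by (simp add: algebra_simps)
  next
    define E1 where "E1 = k * Y - (\<Sum>h\<in>G. real_of_int (b h) * v h)"
    define E2 where "E2 = k * X - (\<Sum>h\<in>G. real_of_int (c h) * v h)"
    define E3 where "E3 = real d * v i - X"
    have sb: "(\<Sum>h\<in>G. real_of_int (b' h) * v h) = real d * (\<Sum>h\<in>G. real_of_int (b h) * v h) + real_of_int (y i) * (\<Sum>h\<in>G. real_of_int (c h) * v h)"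
      by (simp add: b'_def sum_distrib_left sum.distrib algebra_simps)
    have "real d * k * (real_of_int (y i) * v i + Y) - (\<Sum>h\<in>G. real_of_int (b' h) * v h)
        = real d * E1 + real_of_int (y i) * E2 + real_of_int (y i) * (k * E3)"
      unfolding sb E1_def E2_def E3_def by (simp add: algebra_simps)
    also have "\<bar>\<dots>\<bar> \<le> real d * \<bar>E1\<bar> + \<bar>real_of_int (y i)\<bar> * \<bar>E2\<bar> + \<bar>real_of_int (y i)\<bar> * (k * \<bar>E3\<bar>)"
      by (rule order_trans[OF abs_triangle_ineq] add_mono order_trans[OF abs_triangle_ineq])+
        (use k in \<open>simp_all add: abs_mult\<close>)
    also have "\<dots> \<le> real d * (k * e) + real d * (k * e) + real d * (k * 1)"
    proof (intro add_mono)
      have E: "\<bar>E1\<bar> \<le> k * e" "\<bar>E2\<bar> \<le> k * e" "\<bar>E3\<bar> \<le> 1"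
        using b(2) c(2) x(2) by (simp_all add: E1_def E2_def E3_def X_def)
      show "real d * \<bar>E1\<bar> \<le> real d * (k * e)" by (rule mult_left_mono[OF E(1)]) simp
      show "\<bar>real_of_int (y i)\<bar> * \<bar>E2\<bar> \<le> real d * (k * e)" by (rule mult_mono[OF yi E(2)]) simp_all
      show "\<bar>real_of_int (y i)\<bar> * (k * \<bar>E3\<bar>) \<le> real d * (k * 1)"
        by (rule mult_mono[OF yi mult_left_mono[OF E(3) k]]) (use k in simp_all)
    qed
    finally show "\<bar>real d * k * (real_of_int (y i) * v i + Y) - (\<Sum>h\<in>G. real_of_int (b' h) * v h)\<bar>
        \<le> real d * k * (2 * e + 1)" by (simp add: algebra_simps)
  qed
qed

lemma spanned_mono:
  assumes "spanned v S m G e s" "e \<le> e'" "s \<le> s'"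
  shows "spanned v S m G e' s'"
  unfolding spanned_def
proof (intro allI impI)
  fix y :: "'a \<Rightarrow> int" assume y: "\<forall>l\<in>S. \<bar>y l\<bar> < int (m l)"
  define k where "k = (\<Prod>l\<in>S. real (m l))"
  have k: "k \<ge> 0" unfolding k_def by (intro prod_nonneg) auto
  have "k * e \<le> k * e'" "k * s \<le> k * s'" using assms k by (auto intro: mult_left_mono)
  with assms(1) y show "\<exists>b::'a \<Rightarrow> int. (\<forall>h\<in>G. \<bar>real_of_int (b h)\<bar> \<le> (\<Prod>l\<in>S. real (m l)) * s') \<and>
       \<bar>(\<Prod>l\<in>S. real (m l)) * (\<Sum>l\<in>S. real_of_int (y l) * v l) - (\<Sum>h\<in>G. real_of_int (b h) * v h)\<bar>
         \<le> (\<Prod>l\<in>S. real (m l)) * e'"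
    unfolding spanned_def k_def[symmetric] by (meson order_trans)
qed

text \<open>\<open>S\<close> are the chosen elements, \<open>G\<close> those whose order modulo the previous ones is at least the
  cap \<open>K\<close>, and \<open>R\<close> the elements not yet used up.\<close>

definition greedy_state ::
  "('a \<Rightarrow> real) \<Rightarrow> 'a set \<Rightarrow> real \<Rightarrow> real \<Rightarrow> nat \<Rightarrow> nat \<Rightarrow> 'a set \<Rightarrow> ('a \<Rightarrow> nat) \<Rightarrow> 'a set \<Rightarrow> 'a set \<Rightarrow> bool" where
  "greedy_state v U q P K M S m G R \<longleftrightarrow> S \<subseteq> U \<and> R \<subseteq> U \<and> S \<inter> R = {} \<and> G \<subseteq> S \<and>
     card (U - R) \<le> card S * M \<and> (\<forall>l\<in>S. 2 \<le> m l \<and> m l \<le> K) \<and> (\<forall>l\<in>G. m l = K) \<and>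
     dissoc v S m \<and> spanned v S m G (2 ^ card S - 1) (2 ^ card S * real K) \<and>
     P \<le> (\<integral>g. exp (- (q * real M) * (\<Sum>l\<in>S. (sin (v l * g))\<^sup>2) - q * (\<Sum>l\<in>R. (sin (v l * g))\<^sup>2)) \<partial>gauss)"

lemma integrable_gauss_exp_sin:
  assumes "a \<ge> 0" "q \<ge> 0"
  shows "integrable gauss (\<lambda>g. exp (- a * (\<Sum>l\<in>S. (sin (v l * g))\<^sup>2) - q * (\<Sum>l\<in>R. (sin (v l * g))\<^sup>2)))"
proof (rule integrable_gauss_bounded[of _ 1])
  fix g :: real
  have "0 \<le> a * (\<Sum>l\<in>S. (sin (v l * g))\<^sup>2)" "0 \<le> q * (\<Sum>l\<in>R. (sin (v l * g))\<^sup>2)"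
    using assms by (auto intro!: mult_nonneg_nonneg sum_nonneg)
  then show "\<bar>exp (- a * (\<Sum>l\<in>S. (sin (v l * g))\<^sup>2) - q * (\<Sum>l\<in>R. (sin (v l * g))\<^sup>2))\<bar> \<le> 1"
    by simp
qed auto

text \<open>By the inequality of arithmetic and geometric means, \<open>M\<close> distinct factors of the
  characteristic function may be replaced by \<open>M\<close> copies of a single one of them.\<close>

lemma concentrate_factor:
  fixes v :: "'a \<Rightarrow> real"
  assumes "finite T" "card T = M" "M > 0" "T \<subseteq> R" "finite R" "a \<ge> 0" "q > 0" "finite S"
    and P: "P \<le> (\<integral>g. exp (- a * (\<Sum>l\<in>S. (sin (v l * g))\<^sup>2) - q * (\<Sum>l\<in>R. (sin (v l * g))\<^sup>2)) \<partial>gauss)"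
  shows "\<exists>i\<in>T. P \<le> (\<integral>g. exp (- a * (\<Sum>l\<in>S. (sin (v l * g))\<^sup>2) - q * real M * (sin (v i * g))\<^sup>2
            - q * (\<Sum>l\<in>R-T. (sin (v l * g))\<^sup>2)) \<partial>gauss)"
proof (rule ccontr)
  define F where "F i g = exp (- a * (\<Sum>l\<in>S. (sin (v l * g))\<^sup>2) - q * real M * (sin (v i * g))\<^sup>2
            - q * (\<Sum>l\<in>R-T. (sin (v l * g))\<^sup>2))" for i g
  assume "\<not> ?thesis"
  then have lt: "(\<integral>g. F i g \<partial>gauss) < P" if "i \<in> T" for i using that unfolding F_def by (meson not_le)
  have ne: "T \<noteq> {}" using assms by auto
  have intF: "integrable gauss (F i)" for i
  proof (rule integrable_gauss_bounded[of _ 1])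
    fix g :: real
    have "0 \<le> a * (\<Sum>l\<in>S. (sin (v l * g))\<^sup>2)" "0 \<le> q * (\<Sum>l\<in>R-T. (sin (v l * g))\<^sup>2)" "0 \<le> q * real M * (sin (v i * g))\<^sup>2"
      using assms by (auto intro!: mult_nonneg_nonneg sum_nonneg)
    then show "\<bar>F i g\<bar> \<le> 1" unfolding F_def by simp
  qed (simp add: F_def[abs_def])
  have le: "exp (- a * (\<Sum>l\<in>S. (sin (v l * g))\<^sup>2) - q * (\<Sum>l\<in>R. (sin (v l * g))\<^sup>2)) \<le> (\<Sum>i\<in>T. (1 / real M) * F i g)" for g
  proof -
    define z where "z i = - a * (\<Sum>l\<in>S. (sin (v l * g))\<^sup>2) - q * real M * (sin (v i * g))\<^sup>2
            - q * (\<Sum>l\<in>R-T. (sin (v l * g))\<^sup>2)" for i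
    have "(\<Sum>l\<in>R. (sin (v l * g))\<^sup>2) = (\<Sum>l\<in>R-T. (sin (v l * g))\<^sup>2) + (\<Sum>l\<in>T. (sin (v l * g))\<^sup>2)"
      using assms by (intro sum.subset_diff) auto
    moreover have "(\<Sum>i\<in>T. (1 / real M) *\<^sub>R z i) = - a * (\<Sum>l\<in>S. (sin (v l * g))\<^sup>2) - q * (\<Sum>l\<in>T. (sin (v l * g))\<^sup>2)
            - q * (\<Sum>l\<in>R-T. (sin (v l * g))\<^sup>2)"
    proof -
      have "(\<Sum>i\<in>T. (1 / real M) *\<^sub>R (x - q * real M * s i - y)) = x - q * (\<Sum>i\<in>T. s i) - y"
        for x y :: real and s :: "'a \<Rightarrow> real"
        using assms(2,3) by (simp add: diff_divide_distrib sum_subtractf sum_distrib_left)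
      then show ?thesis unfolding z_def .
    qed
    ultimately have "- a * (\<Sum>l\<in>S. (sin (v l * g))\<^sup>2) - q * (\<Sum>l\<in>R. (sin (v l * g))\<^sup>2) = (\<Sum>i\<in>T. (1 / real M) *\<^sub>R z i)"
      by (simp add: algebra_simps)
    then have "exp (- a * (\<Sum>l\<in>S. (sin (v l * g))\<^sup>2) - q * (\<Sum>l\<in>R. (sin (v l * g))\<^sup>2)) = exp (\<Sum>i\<in>T. (1 / real M) *\<^sub>R z i)"
      by simp
    also have "\<dots> \<le> (\<Sum>i\<in>T. (1 / real M) * exp (z i))"
      by (rule convex_on_sum[OF assms(1) ne exp_convex]) (use assms in auto)
    finally show ?thesis by (simp add: F_def z_def)
  qed
  have "P \<le> (\<integral>g. exp (- a * (\<Sum>l\<in>S. (sin (v l * g))\<^sup>2) - q * (\<Sum>l\<in>R. (sin (v l * g))\<^sup>2)) \<partial>gauss)"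
    by (rule P)
  also have "\<dots> \<le> (\<integral>g. (\<Sum>i\<in>T. (1 / real M) * F i g) \<partial>gauss)"
  proof (rule integral_mono)
    show "integrable gauss (\<lambda>g. exp (- a * (\<Sum>l\<in>S. (sin (v l * g))\<^sup>2) - q * (\<Sum>l\<in>R. (sin (v l * g))\<^sup>2)))"
      using assms by (intro integrable_gauss_exp_sin) auto
  qed (use le intF in auto)
  also have "\<dots> = (\<Sum>i\<in>T. (1 / real M) * (\<integral>g. F i g \<partial>gauss))"
    using intF by (subst Bochner_Integration.integral_sum) auto
  also have "\<dots> < (\<Sum>i\<in>T. (1 / real M) * P)"
    by (intro sum_strict_mono mult_strict_left_mono lt) (use assms ne in auto)
  also have "\<dots> = P" using assms by simp
  finally show False by simp
qed

text \<open>\<open>M\<close> elements far from the box are available, and their factors are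
  concentrated on one of them, \<open>i\<close>. Its order \<open>d\<close> becomes the new box
  side; \<open>i\<close> is made a generator if \<open>d\<close> equals the cap and is eliminated
  otherwise.\<close>

lemma greedy_step:
  fixes v :: "'a \<Rightarrow> real"
  assumes st: "greedy_state v U q P K M S m G R" and fin: "finite U" and M: "M > 0" and q: "q > 0" and K: "K \<ge> 2"
    and many: "card {i\<in>R. \<not> near v S m (v i)} \<ge> M"
  shows "\<exists>S' m' G' R'. greedy_state v U q P K M S' m' G' R' \<and> card S' = Suc (card S)"
proof -
  from st have SU: "S \<subseteq> U" "R \<subseteq> U" "S \<inter> R = {}" "G \<subseteq> S"
    and cR: "card (U - R) \<le> card S * M" and mS: "\<forall>l\<in>S. 2 \<le> m l \<and> m l \<le> K" and mG: "\<forall>l\<in>G. m l = K"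
    and dis: "dissoc v S m" and sp: "spanned v S m G (2 ^ card S - 1) (2 ^ card S * real K)"
    and P: "P \<le> (\<integral>g. exp (- (q * real M) * (\<Sum>l\<in>S. (sin (v l * g))\<^sup>2) - q * (\<Sum>l\<in>R. (sin (v l * g))\<^sup>2)) \<partial>gauss)"
    unfolding greedy_state_def by auto
  have finS: "finite S" "finite R" using SU(1,2) fin by (auto intro: finite_subset)
  have finG: "finite G" using SU(4) finS(1) by (rule finite_subset)
  obtain T where T: "T \<subseteq> {i\<in>R. \<not> near v S m (v i)}" "card T = M" "finite T"
    by (rule obtain_subset_with_card_n[OF many])
  have TR: "T \<subseteq> R" using T by auto
  have a0: "0 \<le> q * real M" using q by simp
  obtain i where i: "i \<in> T" and Pi: "P \<le> (\<integral>g. exp (- (q * real M) * (\<Sum>l\<in>S. (sin (v l * g))\<^sup>2) - q * real M * (sin (v i * g))\<^sup>2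
            - q * (\<Sum>l\<in>R-T. (sin (v l * g))\<^sup>2)) \<partial>gauss)"
    using concentrate_factor[OF T(3,2) M TR finS(2) a0 q finS(1) P] by blast
  have iR: "i \<in> R" "\<not> near v S m (v i)" using i T by auto
  then have iS: "i \<notin> S" using SU by auto
  \<comment> \<open>The least such \<open>d\<close> is the order of \<open>v i\<close> modulo the
    box, cut off at \<open>K\<close>; the alternative d = K guarantees existence.\<close>
  define Q where "Q d \<longleftrightarrow> d \<ge> 1 \<and> (d = K \<or> near v S m (real d * v i))" for d
  define d where "d = (LEAST d. Q d)"
  have "Q K" using K by (simp add: Q_def)
  then have Qd: "Q d" and dK: "d \<le> K" unfolding d_def by (auto intro: LeastI Least_le)
  have d_min: "\<not> near v S m (real d' * v i)" if "0 < d'" "d' < d" for d'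
    using not_less_Least[of d' Q] that unfolding d_def[symmetric] by (auto simp: Q_def)
  \<comment> \<open>This is where being far from the box is used; it makes the box size at least
    double in every step.\<close>
  have d2: "d \<ge> 2"
  proof (rule ccontr)
    assume "\<not> d \<ge> 2"
    then have "d = 1" using Qd by (auto simp: Q_def)
    then show False using Qd K iR by (auto simp: Q_def)
  qed
  define S' where "S' = insert i S"
  define m' where "m' = m(i := d)"
  have cS': "card S' = Suc (card S)" using finS iS by (simp add: S'_def)
  have m'S: "m' l = m l" if "l \<in> S" for l using that iS by (auto simp: m'_def)
  have dis': "dissoc v S' m'"
    unfolding S'_def m'_def by (rule dissoc_insert[OF dis finS(1) iS]) (use d_min in auto)
  have c1: "S' \<subseteq> U" "R - T \<subseteq> U" "S' \<inter> (R - T) = {}"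
    using SU iR i by (auto simp: S'_def)
  have "card (U - (R - T)) \<le> card (U - R) + card T"
    using card_Un_le[of "U - R" T] by (rule order_trans[rotated]) (use fin T(3) in \<open>auto intro!: card_mono\<close>)
  then have c2: "card (U - (R - T)) \<le> card S' * M" using cR cS' T(2) by simp
  have c3: "\<forall>l\<in>S'. 2 \<le> m' l \<and> m' l \<le> K"
    using mS m'S d2 dK by (auto simp: S'_def m'_def)
  have "- (q * real M) * (\<Sum>l\<in>S'. (sin (v l * g))\<^sup>2) =
      - (q * real M) * (\<Sum>l\<in>S. (sin (v l * g))\<^sup>2) - q * real M * (sin (v i * g))\<^sup>2" for g
    using finS iS by (simp add: S'_def algebra_simps)
  then have c4: "P \<le> (\<integral>g. exp (- (q * real M) * (\<Sum>l\<in>S'. (sin (v l * g))\<^sup>2) - q * (\<Sum>l\<in>R-T. (sin (v l * g))\<^sup>2)) \<partial>gauss)"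
    using Pi by simp
  have "\<exists>G'. G' \<subseteq> S' \<and> (\<forall>l\<in>G'. m' l = K) \<and> spanned v S' m' G' (2 ^ card S' - 1) (2 ^ card S' * real K)"
  proof (cases "d = K")
    case True
    have "spanned v S' m' (insert i G) (2 ^ card S' - 1) (2 ^ card S' * real K)"
      unfolding S'_def m'_def
    proof (rule spanned_insert_new[OF sp finS(1) finG iS SU(4)])
      have p: "1 \<le> (2::real) ^ card (insert i S)" by simp
      then have "1 * real K \<le> 2 ^ card (insert i S) * real K" by (rule mult_right_mono) simp
      then show "real d \<le> 2 ^ card (insert i S) * real K" using True by simp
      have "(2::real) ^ card S \<le> 2 ^ card (insert i S)" using cS' by (simp add: S'_def)
      then show "2 ^ card S * real K \<le> 2 ^ card (insert i S) * real K" "(2::real) ^ card S - 1 \<le> 2 ^ card (insert i S) - 1"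
        by (auto intro: mult_right_mono)
    qed
    moreover have "\<forall>l\<in>insert i G. m' l = K" using True mG SU(4) m'S by (auto simp: m'_def)
    ultimately show ?thesis using SU(4) by (intro exI[of _ "insert i G"]) (auto simp: S'_def)
  next
    case False
    then have "near v S m (real d * v i)" using Qd by (simp add: Q_def)
    then have "spanned v S' m' G (2 * (2 ^ card S - 1) + 1) (2 * (2 ^ card S * real K))"
      unfolding S'_def m'_def by (rule spanned_insert_near[OF sp finS(1) finG iS SU(4)])
    then have "spanned v S' m' G (2 ^ card S' - 1) (2 ^ card S' * real K)"
      by (rule spanned_mono) (simp_all add: cS')
    moreover have "\<forall>l\<in>G. m' l = K" using mG SU(4) m'S by auto
    ultimately show ?thesis using SU(4) by (intro exI[of _ G]) (auto simp: S'_def)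
  qed
  then obtain G' where "G' \<subseteq> S'" "\<forall>l\<in>G'. m' l = K" "spanned v S' m' G' (2 ^ card S' - 1) (2 ^ card S' * real K)" by blast
  then have "greedy_state v U q P K M S' m' G' (R - T)"
    unfolding greedy_state_def using c1 c2 c3 c4 dis' by blast
  with cS' show ?thesis by blast
qed

text \<open>Run the greedy procedure as long as possible, with k the final box size. The box bound P
  \<le> 12 / sqrt k gives k \<le> 144 / P^2. Every side is at least 2 and the sides of
  \<open>G\<close> equal \<open>K\<close>, so k also controls the number r of steps and the size of
  \<open>G\<close>.\<close>

theorem inverse_gauss_sin:
  fixes v :: "'a \<Rightarrow> real"
  assumes fin: "finite U" and M: "M > 0" and q: "q > 0" and K: "K \<ge> 2" and MK: "16 * real K ^ 3 \<le> q * real M"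
    and P0: "P > 0" and P: "P \<le> (\<integral>g. exp (- q * (\<Sum>l\<in>U. (sin (v l * g))\<^sup>2)) \<partial>gauss)"
  shows "\<exists>(k::nat) G bad r. 0 < k \<and> real k \<le> 144 / P\<^sup>2 \<and> 2 ^ r \<le> k \<and> K ^ card G \<le> k \<and>
     G \<subseteq> bad \<and> bad \<subseteq> U \<and> card bad \<le> Suc r * M \<and>
     (\<forall>i\<in>U - bad. \<exists>b::'a \<Rightarrow> int. (\<forall>h\<in>G. \<bar>real_of_int (b h)\<bar> \<le> real k * real k * real K) \<and>
        \<bar>real k * v i - (\<Sum>h\<in>G. real_of_int (b h) * v h)\<bar> \<le> real k * real k)"
proof -
  have size: "(\<Prod>l\<in>S. real (m l)) \<le> 144 / P\<^sup>2" "2 ^ card S \<le> (\<Prod>l\<in>S. m l)" "K ^ card G \<le> (\<Prod>l\<in>S. m l)"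
    if st: "greedy_state v U q P K M S m G R" for S m G R
  proof -
    from st have SU: "S \<subseteq> U" "R \<subseteq> U" "G \<subseteq> S" and mS: "\<And>l. l \<in> S \<Longrightarrow> 2 \<le> m l" "\<And>l. l \<in> S \<Longrightarrow> m l \<le> K" and mG: "\<forall>l\<in>G. m l = K"
      and dis: "dissoc v S m"
      and P: "P \<le> (\<integral>g. exp (- (q * real M) * (\<Sum>l\<in>S. (sin (v l * g))\<^sup>2) - q * (\<Sum>l\<in>R. (sin (v l * g))\<^sup>2)) \<partial>gauss)"
      unfolding greedy_state_def by auto
    have finS: "finite S" using SU fin by (auto intro: finite_subset)
    define p where "p = (\<Prod>l\<in>S. real (m l))"
    have p: "p > 0" unfolding p_def using mS by (intro prod_pos) (metis gr0I of_nat_0_less_iff not_numeral_le_zero)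
    have "P \<le> (\<integral>g. exp (- (q * real M) * (\<Sum>l\<in>S. (sin (v l * g))\<^sup>2)) \<partial>gauss)"
    proof (rule order_trans[OF P], rule integral_mono)
      show "integrable gauss (\<lambda>g. exp (- (q * real M) * (\<Sum>l\<in>S. (sin (v l * g))\<^sup>2)))"
        using integrable_gauss_exp_sin[of "q * real M" 0 v S "{}"] q by simp
      show "integrable gauss (\<lambda>g. exp (- (q * real M) * (\<Sum>l\<in>S. (sin (v l * g))\<^sup>2) - q * (\<Sum>l\<in>R. (sin (v l * g))\<^sup>2)))"
        using q by (intro integrable_gauss_exp_sin) auto
    qed (use q in \<open>auto intro!: mult_nonneg_nonneg sum_nonneg\<close>)
    also have "\<dots> \<le> 12 / sqrt p" unfolding p_def
    proof (rule gauss_box_bound[OF finS _ _ dis])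
      fix j assume j: "j \<in> S"
      have "16 * real (m j) ^ 3 \<le> 16 * real K ^ 3" using mS(2)[OF j] by (intro mult_left_mono power_mono) auto
      then show "16 * real (m j) ^ 3 \<le> q * real M" using MK by linarith
    qed (use mS in auto)
    finally have "P * sqrt p \<le> 12" using p by (simp add: field_simps)
    then have "(P * sqrt p)\<^sup>2 \<le> 12\<^sup>2" using P0 p by (intro power_mono) auto
    then show "(\<Prod>l\<in>S. real (m l)) \<le> 144 / P\<^sup>2"
      using P0 p by (simp add: power_mult_distrib field_simps flip: p_def)
    have "(\<Prod>l\<in>S. 2) \<le> (\<Prod>l\<in>S. m l)" by (intro prod_mono) (use mS in auto)
    then show "2 ^ card S \<le> (\<Prod>l\<in>S. m l)" by simp
    have "K ^ card G = (\<Prod>l\<in>G. m l)" using mG by simp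
    also have "\<dots> \<le> (\<Prod>l\<in>S - G. m l) * (\<Prod>l\<in>G. m l)"
    proof -
      have "0 < (\<Prod>l\<in>S - G. m l)" using mS(1) by (intro prod_pos) (force dest: mS(1))
      then show ?thesis by simp
    qed
    also have "\<dots> = (\<Prod>l\<in>S. m l)" by (rule prod.subset_diff[OF SU(3) finS, symmetric])
    finally show "K ^ card G \<le> (\<Prod>l\<in>S. m l)" .
  qed
  define Q where "Q r \<longleftrightarrow> (\<exists>S m G R. greedy_state v U q P K M S m G R \<and> card S = r)" for r
  have "greedy_state v U q P K M {} (\<lambda>_. 0) {} U"
    using P unfolding greedy_state_def dissoc_def spanned_def by simp
  then have Q0: "Q 0" unfolding Q_def by (intro exI) auto
  \<comment> \<open>The inequality 2^r \<le> k bounds the length of every run, so a longest one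
    exists.\<close>
  have Qb: "\<forall>r. Q r \<longrightarrow> r \<le> nat \<lceil>144 / P\<^sup>2\<rceil>"
  proof (intro allI impI)
    fix r assume "Q r"
    then obtain S m G R where st: "greedy_state v U q P K M S m G R" and r: "card S = r" unfolding Q_def by blast
    have "real r \<le> real (2 ^ r)" by (simp only: of_nat_le_iff) (rule less_imp_le[OF less_exp])
    also have "\<dots> \<le> real (\<Prod>l\<in>S. m l)" using size(2)[OF st] r by (simp only: of_nat_le_iff)
    also have "\<dots> \<le> 144 / P\<^sup>2" using size(1)[OF st] by simp
    finally show "r \<le> nat \<lceil>144 / P\<^sup>2\<rceil>" by linarith
  qed
  obtain r where "Q r" and rmax: "\<And>r'. Q r' \<Longrightarrow> r' \<le> r"
    using Nat.ex_has_greatest_nat[of Q, OF Q0 Qb] by blast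
  then obtain S m G R where st: "greedy_state v U q P K M S m G R" and r: "card S = r" unfolding Q_def by blast
  define N where "N = {i\<in>R. \<not> near v S m (v i)}"
  have few: "card N < M"
  proof (rule ccontr)
    assume "\<not> card N < M"
    then obtain S' m' G' R' where "greedy_state v U q P K M S' m' G' R'" "card S' = Suc (card S)"
      using greedy_step[OF st fin M q K] unfolding N_def by (meson not_le)
    then have "Q (Suc r)" unfolding Q_def r[symmetric] by blast
    then show False using rmax[of "Suc r"] by simp
  qed
  from st have SU: "S \<subseteq> U" "R \<subseteq> U" "S \<inter> R = {}" "G \<subseteq> S" and cR: "card (U - R) \<le> card S * M"
    and sp: "spanned v S m G (2 ^ card S - 1) (2 ^ card S * real K)"
    and m2: "\<forall>l\<in>S. 2 \<le> m l"
    unfolding greedy_state_def by auto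
  define k where "k = (\<Prod>l\<in>S. m l)"
  have kr: "real k = (\<Prod>l\<in>S. real (m l))" by (simp add: k_def)
  have "2 ^ r \<le> k" using size(2)[OF st] by (simp add: k_def r)
  then have k2: "2 ^ r \<le> real k" using of_nat_mono[of "2 ^ r" k, where 'a=real] by simp
  \<comment> \<open>At most r M indices were used up, and fewer than M remaining ones are far from
    the box since no further step is possible.\<close>
  define bad where "bad = (U - R) \<union> N"
  have "card bad \<le> Suc r * M"
    unfolding bad_def using card_Un_le[of "U - R" N] cR few r by simp
  moreover have "G \<subseteq> bad" "bad \<subseteq> U" using SU by (auto simp: bad_def N_def)
  moreover have "0 < k" unfolding k_def using m2 by (intro prod_pos) auto
  moreover have "real k \<le> 144 / P\<^sup>2" using size(1)[OF st] by (simp add: k_def)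
  moreover have "K ^ card G \<le> k" using size(3)[OF st] by (simp add: k_def)
  moreover have "\<exists>b::'a \<Rightarrow> int. (\<forall>h\<in>G. \<bar>real_of_int (b h)\<bar> \<le> real k * real k * real K) \<and>
        \<bar>real k * v i - (\<Sum>h\<in>G. real_of_int (b h) * v h)\<bar> \<le> real k * real k" if i: "i \<in> U - bad" for i
  proof -
    have "near v S m (v i)" using i by (auto simp: bad_def N_def)
    then obtain y :: "'a \<Rightarrow> int" where y: "\<forall>l\<in>S. \<bar>y l\<bar> < int (m l)"
      "\<bar>v i - (\<Sum>l\<in>S. real_of_int (y l) * v l)\<bar> < 1" unfolding near_def by blast
    define Y where "Y = (\<Sum>l\<in>S. real_of_int (y l) * v l)"
    obtain b :: "'a \<Rightarrow> int" where b: "\<forall>h\<in>G. \<bar>real_of_int (b h)\<bar> \<le> real k * (2 ^ r * real K)"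
      "\<bar>real k * Y - (\<Sum>h\<in>G. real_of_int (b h) * v h)\<bar> \<le> real k * (2 ^ r - 1)"
      using sp y(1) unfolding spanned_def kr[symmetric] r Y_def by blast
    \<comment> \<open>Being within 1 of the box costs k, expressing the box combination by
      \<open>G\<close> costs k (2^r - 1); the total k 2^r is at most k^2.\<close>
    have "real k * \<bar>v i - Y\<bar> \<le> real k * 1" by (rule mult_left_mono) (use y in \<open>auto simp: Y_def\<close>)
    then have "\<bar>real k * v i - real k * Y\<bar> \<le> real k" by (simp add: abs_mult flip: right_diff_distrib)
    then have "\<bar>real k * v i - (\<Sum>h\<in>G. real_of_int (b h) * v h)\<bar> \<le> real k * 2 ^ r"
      using b(2) by (simp add: right_diff_distrib)
    also have "\<dots> \<le> real k * real k" using k2 by (rule mult_left_mono) simp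
    finally have e: "\<bar>real k * v i - (\<Sum>h\<in>G. real_of_int (b h) * v h)\<bar> \<le> real k * real k" .
    have "real k * (2 ^ r * real K) \<le> real k * (real k * real K)"
      using k2 by (intro mult_left_mono mult_right_mono) auto
    then have "\<forall>h\<in>G. \<bar>real_of_int (b h)\<bar> \<le> real k * real k * real K" using b(1) by (auto simp: mult.assoc)
    with e show ?thesis by blast
  qed
  ultimately show ?thesis using \<open>2 ^ r \<le> k\<close> by blast
qed

section \<open>Small ball probabilities of linear forms\<close>

definition diff_law :: "real measure \<Rightarrow> real measure" where
  "diff_law \<mu> = distr (\<mu> \<Otimes>\<^sub>M \<mu>) borel (\<lambda>(x, y). x - y)"

lemma diff_measurable:
  assumes "sets \<mu> = sets borel"
  shows "(\<lambda>(x, y). x - y) \<in> borel_measurable (\<mu> \<Otimes>\<^sub>M (\<mu> :: real measure))"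
proof -
  have [measurable_cong]: "sets \<mu> = sets borel" by fact
  show ?thesis by measurable
qed

lemma real_distribution_diff_law:
  assumes "real_distribution \<mu>"
  shows "real_distribution (diff_law \<mu>)"
proof -
  interpret real_distribution \<mu> by fact
  interpret P: pair_prob_space \<mu> \<mu> ..
  show ?thesis unfolding diff_law_def by (rule P.real_distribution_distr[OF diff_measurable]) simp
qed

text \<open>The right-hand side is the squared modulus of the characteristic function of
  \<open>\<mu>\<close>. Its being nonnegative is what later allows a product of such factors to be
  bounded factor by factor.\<close>

lemma diff_law_cos:
  assumes "real_distribution \<mu>"
  shows "(\<integral>u. cos (t * u) \<partial>diff_law \<mu>) = (\<integral>x. cos (t * x) \<partial>\<mu>)\<^sup>2 + (\<integral>x. sin (t * x) \<partial>\<mu>)\<^sup>2"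
proof -
  interpret real_distribution \<mu> by fact
  interpret P: pair_prob_space \<mu> \<mu> ..
  have mz: "(\<lambda>(x, y). x - y) \<in> borel_measurable (\<mu> \<Otimes>\<^sub>M \<mu>)" by (rule diff_measurable) simp
  have [simp]: "integrable \<mu> (\<lambda>x. cos (t * x))" "integrable \<mu> (\<lambda>x. sin (t * x))"
    by (auto intro!: integrable_const_bound[of _ 1])
  have "(\<integral>u. cos (t * u) \<partial>diff_law \<mu>) = (\<integral>p. cos (t * (fst p - snd p)) \<partial>(\<mu> \<Otimes>\<^sub>M \<mu>))"
    unfolding diff_law_def by (subst integral_distr[OF mz]) (auto simp: case_prod_beta)
  also have "\<dots> = (\<integral>x. \<integral>y. cos (t * (x - y)) \<partial>\<mu> \<partial>\<mu>)"
    by (subst P.integral_fst'[symmetric])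
      (auto intro!: P.P.integrable_const_bound[of _ 1] simp: case_prod_beta)
  also have "\<dots> = (\<integral>x. cos (t * x) * (\<integral>y. cos (t * y) \<partial>\<mu>) + sin (t * x) * (\<integral>y. sin (t * y) \<partial>\<mu>) \<partial>\<mu>)"
    by (simp add: right_diff_distrib cos_diff)
  also have "\<dots> = (\<integral>x. cos (t * x) \<partial>\<mu>)\<^sup>2 + (\<integral>x. sin (t * x) \<partial>\<mu>)\<^sup>2"
    by (simp add: power2_eq_square)
  finally show ?thesis .
qed

text \<open>The cosine of a sum does not factor over the coordinates but \<open>cis\<close> does; by
  \<open>odd\<close> each factor is real, so taking the real part commutes with the product.\<close>

lemma integral_PiM_cos_sum:
  assumes "real_distribution \<sigma>" "finite U" and odd: "\<And>t. (\<integral>u. sin (t * u) \<partial>\<sigma>) = 0"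
  shows "(\<integral>u. cos (\<Sum>i\<in>U. c i * u i) \<partial>(\<Pi>\<^sub>M i\<in>U. \<sigma>)) = (\<Prod>i\<in>U. (\<integral>x. cos (c i * x) \<partial>\<sigma>))"
proof -
  interpret S: real_distribution \<sigma> by fact
  interpret product_prob_space "\<lambda>_. \<sigma>" U ..
  have mes: "(\<lambda>u. \<Sum>i\<in>U. c i * u i) \<in> borel_measurable (\<Pi>\<^sub>M i\<in>U. \<sigma>)"
  proof (rule borel_measurable_sum)
    fix i assume "i \<in> U"
    then have "(\<lambda>u. u i) \<in> borel_measurable (\<Pi>\<^sub>M i\<in>U. \<sigma>)"
      using measurable_component_singleton[of i U "\<lambda>_. \<sigma>"] by (simp cong: measurable_cong_sets)
    then show "(\<lambda>u. c i * u i) \<in> borel_measurable (\<Pi>\<^sub>M i\<in>U. \<sigma>)" by simp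
  qed
  have int1: "integrable \<sigma> (\<lambda>x. cis (c i * x))" for i
    by (rule S.integrable_const_bound[of _ 1]) (auto simp: cis_conv_exp)
  have ic: "integrable \<sigma> (\<lambda>x. cos (t * x))" "integrable \<sigma> (\<lambda>x. sin (t * x))" for t
    by (auto intro!: S.integrable_const_bound[of _ 1])
  have intU: "integrable (\<Pi>\<^sub>M i\<in>U. \<sigma>) (\<lambda>u. cis (\<Sum>i\<in>U. c i * u i))"
    by (rule P.integrable_const_bound[of _ 1]) (use mes in \<open>auto simp: cis_conv_exp\<close>)
  have e: "(\<integral>x. cis (t * x) \<partial>\<sigma>) = complex_of_real (\<integral>x. cos (t * x) \<partial>\<sigma>)" for t
  proof -
    have i: "integrable \<sigma> (\<lambda>x. cis (t * x))"
      by (rule S.integrable_const_bound[of _ 1]) (auto simp: cis_conv_exp)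
    show ?thesis
      by (rule complex_eqI) (use integral_Re[OF i] integral_Im[OF i] odd[of t] in simp_all)
  qed
  have "(\<integral>u. cis (\<Sum>i\<in>U. c i * u i) \<partial>(\<Pi>\<^sub>M i\<in>U. \<sigma>)) = (\<integral>u. (\<Prod>i\<in>U. cis (c i * u i)) \<partial>(\<Pi>\<^sub>M i\<in>U. \<sigma>))"
    by (simp add: prod_cis)
  also have "\<dots> = (\<Prod>i\<in>U. (\<integral>x. cis (c i * x) \<partial>\<sigma>))"
    using assms(2) int1 by (rule product_integral_prod)
  also have "\<dots> = complex_of_real (\<Prod>i\<in>U. (\<integral>x. cos (c i * x) \<partial>\<sigma>))" by (simp add: e)
  finally have "Re (\<integral>u. cis (\<Sum>i\<in>U. c i * u i) \<partial>(\<Pi>\<^sub>M i\<in>U. \<sigma>)) = (\<Prod>i\<in>U. (\<integral>x. cos (c i * x) \<partial>\<sigma>))"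
    by (simp only: Re_complex_of_real)
  then show ?thesis using integral_Re[OF intU] by simp
qed

lemma diff_law_sin:
  assumes "real_distribution \<mu>"
  shows "(\<integral>u. sin (t * u) \<partial>diff_law \<mu>) = 0"
proof -
  interpret real_distribution \<mu> by fact
  interpret P: pair_prob_space \<mu> \<mu> ..
  have mz: "(\<lambda>(x, y). x - y) \<in> borel_measurable (\<mu> \<Otimes>\<^sub>M \<mu>)" by (rule diff_measurable) simp
  have [simp]: "integrable \<mu> (\<lambda>x. cos (t * x))" "integrable \<mu> (\<lambda>x. sin (t * x))"
    by (auto intro!: integrable_const_bound[of _ 1])
  have "(\<integral>u. sin (t * u) \<partial>diff_law \<mu>) = (\<integral>p. sin (t * (fst p - snd p)) \<partial>(\<mu> \<Otimes>\<^sub>M \<mu>))"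
    unfolding diff_law_def by (subst integral_distr[OF mz]) (auto simp: case_prod_beta)
  also have "\<dots> = (\<integral>x. \<integral>y. sin (t * (x - y)) \<partial>\<mu> \<partial>\<mu>)"
    by (subst P.integral_fst'[symmetric])
      (auto intro!: P.P.integrable_const_bound[of _ 1] simp: case_prod_beta)
  also have "\<dots> = (\<integral>x. sin (t * x) * (\<integral>y. cos (t * y) \<partial>\<mu>) - cos (t * x) * (\<integral>y. sin (t * y) \<partial>\<mu>) \<partial>\<mu>)"
    by (simp add: right_diff_distrib sin_diff)
  also have "\<dots> = 0"
    by simp
  finally show ?thesis .
qed

text \<open>The function exp (-s^2 / 2) exceeds exp (-1/2) for |s| \<le> 1 and is itself the
  Gaussian average of cos (s g). With s the linear form divided by \<open>\<beta>\<close>,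
  exchanging the two averages produces the product of characteristic functions.\<close>

lemma small_ball_le_gauss:
  assumes \<sigma>: "real_distribution \<sigma>" and U: "finite U" and odd: "\<And>t. (\<integral>u. sin (t * u) \<partial>\<sigma>) = 0"
    and \<beta>: "\<beta> > 0"
  shows "exp (- 1 / 2) * measure (\<Pi>\<^sub>M i\<in>U. \<sigma>) {u \<in> space (\<Pi>\<^sub>M i\<in>U. \<sigma>). \<bar>\<Sum>i\<in>U. L i * u i\<bar> \<le> \<beta>}
    \<le> (\<integral>g. (\<Prod>i\<in>U. (\<integral>x. cos (L i / \<beta> * g * x) \<partial>\<sigma>)) \<partial>gauss)"
proof -
  interpret S: real_distribution \<sigma> by fact
  interpret product_prob_space "\<lambda>_. \<sigma>" U ..
  interpret G: prob_space gauss by (rule prob_space_gauss)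
  interpret PG: pair_prob_space "\<Pi>\<^sub>M i\<in>U. \<sigma>" gauss ..
  let ?P = "\<Pi>\<^sub>M i\<in>U. \<sigma>"
  have mes [measurable]: "(\<lambda>u. \<Sum>i\<in>U. c i * u i) \<in> borel_measurable ?P" for c
  proof (rule borel_measurable_sum)
    fix i assume "i \<in> U"
    then have "(\<lambda>u. u i) \<in> borel_measurable ?P"
      using measurable_component_singleton[of i U "\<lambda>_. \<sigma>"] by (simp cong: measurable_cong_sets)
    then show "(\<lambda>u. c i * u i) \<in> borel_measurable ?P" by simp
  qed
  define S where "S u = (\<Sum>i\<in>U. L i * u i)" for u :: "'a \<Rightarrow> real"
  have mS [measurable]: "S \<in> borel_measurable ?P" unfolding S_def by measurable
  have "exp (- 1 / 2) * measure ?P {u \<in> space ?P. \<bar>S u\<bar> \<le> \<beta>} =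
      (\<integral>u. exp (- 1 / 2) * indicator {u \<in> space ?P. \<bar>S u\<bar> \<le> \<beta>} u \<partial>?P)"
    by simp
  also have "\<dots> \<le> (\<integral>u. exp (- ((S u / \<beta>)\<^sup>2) / 2) \<partial>?P)"
  proof (rule integral_mono)
    show "integrable ?P (\<lambda>u. exp (- ((S u / \<beta>)\<^sup>2) / 2))"
      by (rule P.integrable_const_bound[of _ 1]) auto
    show "integrable ?P (\<lambda>u. exp (- 1 / 2) * indicator {u \<in> space ?P. \<bar>S u\<bar> \<le> \<beta>} u)"
      by (intro integrable_mult_right P.integrable_const_bound[of _ 1]) (auto simp: indicator_def)
    fix u
    have "(S u / \<beta>)\<^sup>2 \<le> 1" if "\<bar>S u\<bar> \<le> \<beta>"
    proof -
      have "\<bar>S u / \<beta>\<bar> \<le> 1" using that \<beta> by simp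
      then show ?thesis by (simp add: abs_square_le_1)
    qed
    then show "exp (- 1 / 2) * indicator {u \<in> space ?P. \<bar>S u\<bar> \<le> \<beta>} u \<le> exp (- ((S u / \<beta>)\<^sup>2) / 2)"
      by (auto simp: indicator_def)
  qed
  also have "\<dots> = (\<integral>u. (\<integral>g. cos (S u / \<beta> * g) \<partial>gauss) \<partial>?P)"
    unfolding gauss_cos by simp
  also have "\<dots> = (\<integral>g. (\<integral>u. cos (S u / \<beta> * g) \<partial>?P) \<partial>gauss)"
    by (rule PG.Fubini_integral[symmetric])
      (auto intro!: PG.P.integrable_const_bound[of _ 1] simp: case_prod_beta)
  also have "\<dots> = (\<integral>g. (\<integral>u. cos (\<Sum>i\<in>U. L i / \<beta> * g * u i) \<partial>?P) \<partial>gauss)"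
    by (simp add: S_def sum_distrib_left sum_distrib_right sum_divide_distrib mult_ac)
  also have "\<dots> = (\<integral>g. (\<Prod>i\<in>U. (\<integral>x. cos (L i / \<beta> * g * x) \<partial>\<sigma>)) \<partial>gauss)"
    unfolding integral_PiM_cos_sum[OF \<sigma> U odd] ..
  finally show ?thesis by (simp add: S_def)
qed

lemma integral_uniform_measure:
  fixes f :: "'a \<Rightarrow> real"
  assumes "prob_space M" and A: "A \<in> sets M" "measure M A > 0" and f: "f \<in> borel_measurable M"
  shows "(\<integral>x. f x \<partial>uniform_measure M A) = (\<integral>x. indicator A x * f x \<partial>M) / measure M A"
proof -
  interpret prob_space M by fact
  have "uniform_measure M A = density M (\<lambda>x. ennreal (indicator A x / measure M A))"
    unfolding uniform_measure_def
    by (rule density_cong)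
      (use A in \<open>auto simp: emeasure_eq_measure indicator_def divide_ennreal[of 1 "measure M A", symmetric]\<close>)
  then have "(\<integral>x. f x \<partial>uniform_measure M A) = (\<integral>x. (indicator A x / measure M A) *\<^sub>R f x \<partial>M)"
    using A f by (simp add: integral_density)
  then show ?thesis by simp
qed

text \<open>Write 1 - cos (t x) = 2 sin^2 (t x / 2), keep only x in \<open>G\<close>, and use 1 + s
  \<le> exp s. The product is then the exponential of an average over \<open>G\<close>, and Jensen's
  inequality moves this average outside.\<close>

lemma prod_char_le_average:
  assumes \<sigma>: "real_distribution \<sigma>" and U: "finite U" and nn: "\<And>t. (\<integral>x. cos (t * x) \<partial>\<sigma>) \<ge> 0"
    and G: "G \<in> sets borel" and p: "0 < c" "c \<le> measure \<sigma> G"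
  shows "(\<Prod>i\<in>U. (\<integral>x. cos (t i * x) \<partial>\<sigma>)) \<le>
    (\<integral>y. exp (- (2 * c) * (\<Sum>i\<in>U. (sin (t i * y / 2))\<^sup>2)) \<partial>uniform_measure \<sigma> G)"
proof -
  interpret real_distribution \<sigma> by fact
  define p where "p = measure \<sigma> G"
  have p0: "p > 0" "c \<le> p" using p by (auto simp: p_def)
  have Gm: "G \<in> sets \<sigma>" using G by simp
  interpret D: prob_space "uniform_measure \<sigma> G"
    using p0 by (intro prob_space_uniform_measure) (auto simp: emeasure_eq_measure p_def)
  define h where "h y = (\<Sum>i\<in>U. 2 * (sin (t i * y / 2))\<^sup>2)" for y
  have h0: "h y \<ge> 0" for y unfolding h_def by (intro sum_nonneg) auto
  have hb: "h y \<le> 2 * real (card U)" for y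
  proof -
    have "h y \<le> (\<Sum>i\<in>U. 2)" unfolding h_def by (intro sum_mono) (auto simp: abs_square_le_1)
    then show ?thesis by simp
  qed
  have mh [measurable]: "h \<in> borel_measurable borel" unfolding h_def by measurable
  have ih: "integrable \<sigma> (\<lambda>x. indicator G x * (2 * (sin (t i * x / 2))\<^sup>2))" for i
    by (rule integrable_const_bound[of _ 2]) (use Gm in \<open>auto simp: indicator_def abs_square_le_1\<close>)
  have cosle: "(\<integral>x. cos (t i * x) \<partial>\<sigma>) \<le> exp (- (\<integral>x. indicator G x * (2 * (sin (t i * x / 2))\<^sup>2) \<partial>\<sigma>))" for i
  proof -
    have ic: "integrable \<sigma> (\<lambda>x. cos (t i * x))"
      by (auto intro!: integrable_const_bound[of _ 1])
    have "(\<integral>x. indicator G x * (2 * (sin (t i * x / 2))\<^sup>2) \<partial>\<sigma>) \<le> (\<integral>x. 1 - cos (t i * x) \<partial>\<sigma>)"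
    proof (rule integral_mono[OF ih])
      fix x
      have "cos (t i * x) = 1 - 2 * (sin (t i * x / 2))\<^sup>2"
        using cos_double_sin[of "t i * x / 2"] by simp
      then show "indicator G x * (2 * (sin (t i * x / 2))\<^sup>2) \<le> 1 - cos (t i * x)"
        by (auto simp: indicator_def)
    qed (use ic in auto)
    also have "\<dots> = 1 - (\<integral>x. cos (t i * x) \<partial>\<sigma>)" using ic prob_space by simp
    finally have "(\<integral>x. cos (t i * x) \<partial>\<sigma>) \<le> 1 + - (\<integral>x. indicator G x * (2 * (sin (t i * x / 2))\<^sup>2) \<partial>\<sigma>)" by simp
    also have "\<dots> \<le> exp (- (\<integral>x. indicator G x * (2 * (sin (t i * x / 2))\<^sup>2) \<partial>\<sigma>))" by (rule exp_ge_add_one_self)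
    finally show ?thesis .
  qed
  have "(\<Prod>i\<in>U. (\<integral>x. cos (t i * x) \<partial>\<sigma>)) \<le>
      (\<Prod>i\<in>U. exp (- (\<integral>x. indicator G x * (2 * (sin (t i * x / 2))\<^sup>2) \<partial>\<sigma>)))"
    by (intro prod_mono conjI nn cosle)
  also have "\<dots> = exp (- (\<Sum>i\<in>U. (\<integral>x. indicator G x * (2 * (sin (t i * x / 2))\<^sup>2) \<partial>\<sigma>)))"
    using U by (simp add: exp_sum sum_negf[symmetric])
  also have "(\<Sum>i\<in>U. (\<integral>x. indicator G x * (2 * (sin (t i * x / 2))\<^sup>2) \<partial>\<sigma>)) = (\<integral>x. indicator G x * h x \<partial>\<sigma>)"
    unfolding h_def sum_distrib_left using ih by (subst Bochner_Integration.integral_sum) auto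
  also have "(\<integral>x. indicator G x * h x \<partial>\<sigma>) = p * (\<integral>x. h x \<partial>uniform_measure \<sigma> G)"
    using p0 by (subst integral_uniform_measure[OF prob_space_axioms Gm]) (auto simp: p_def)
  also have "exp (- (p * (\<integral>x. h x \<partial>uniform_measure \<sigma> G))) = exp (\<integral>x. - p * h x \<partial>uniform_measure \<sigma> G)"
    by simp
  also have "\<dots> \<le> (\<integral>x. exp (- p * h x) \<partial>uniform_measure \<sigma> G)"
  proof (rule D.jensens_inequality[where I = UNIV])
    show "integrable (uniform_measure \<sigma> G) (\<lambda>x. - p * h x)"
      by (rule D.integrable_const_bound[of _ "p * (2 * real (card U))"])
        (use p0 h0 hb in \<open>auto simp: abs_mult\<close>)
    show "integrable (uniform_measure \<sigma> G) (\<lambda>x. exp (- p * h x))"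
      by (rule D.integrable_const_bound[of _ 1]) (use p0 h0 in auto)
  qed (auto simp: exp_convex)
  also have "\<dots> \<le> (\<integral>x. exp (- c * h x) \<partial>uniform_measure \<sigma> G)"
  proof (rule integral_mono)
    show "integrable (uniform_measure \<sigma> G) (\<lambda>x. exp (- p * h x))"
      by (rule D.integrable_const_bound[of _ 1]) (use p0 h0 in auto)
    show "integrable (uniform_measure \<sigma> G) (\<lambda>x. exp (- c * h x))"
      by (rule D.integrable_const_bound[of _ 1]) (use p h0 in auto)
    fix x
    have "c * h x \<le> p * h x" using p0 h0 by (intro mult_right_mono) auto
    then show "exp (- p * h x) \<le> exp (- c * h x)" by simp
  qed
  also have "(\<lambda>x. exp (- c * h x)) = (\<lambda>y. exp (- (2 * c) * (\<Sum>i\<in>U. (sin (t i * y / 2))\<^sup>2)))"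
    by (simp add: h_def sum_distrib_left[symmetric] mult.assoc mult.left_commute)
  finally show ?thesis .
qed

text \<open>After exchanging integrals the bound is an average over y in \<open>G\<close>, so some
  single y attains it. That y is common to all coefficients, so relations among the numbers
  \<open>L i * y\<close> are relations among the \<open>L i\<close>.\<close>

lemma small_ball_le_gauss_sin:
  assumes \<sigma>: "real_distribution \<sigma>" and U: "finite U"
    and odd: "\<And>t. (\<integral>u. sin (t * u) \<partial>\<sigma>) = 0" and nn: "\<And>t. (\<integral>x. cos (t * x) \<partial>\<sigma>) \<ge> 0"
    and G: "G \<in> sets borel" and c: "0 < c" "c \<le> measure \<sigma> G" and \<beta>: "\<beta> > 0"
  shows "\<exists>y\<in>G. exp (- 1 / 2) * measure (\<Pi>\<^sub>M i\<in>U. \<sigma>) {u \<in> space (\<Pi>\<^sub>M i\<in>U. \<sigma>). \<bar>\<Sum>i\<in>U. L i * u i\<bar> \<le> \<beta>}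
    \<le> (\<integral>g. exp (- (2 * c) * (\<Sum>i\<in>U. (sin (L i * y / (2 * \<beta>) * g))\<^sup>2)) \<partial>gauss)"
proof (rule ccontr)
  interpret real_distribution \<sigma> by fact
  interpret G: prob_space gauss by (rule prob_space_gauss)
  let ?D = "uniform_measure \<sigma> G"
  have Gm: "G \<in> sets \<sigma>" using G by simp
  have pos: "emeasure \<sigma> G \<noteq> 0" using c by (auto simp: emeasure_eq_measure)
  interpret D: prob_space ?D
    by (intro prob_space_uniform_measure pos) (auto simp: emeasure_eq_measure)
  interpret DG: pair_prob_space ?D gauss ..
  define F where "F y g = exp (- (2 * c) * (\<Sum>i\<in>U. (sin (L i * y / (2 * \<beta>) * g))\<^sup>2))" for y g
  define P where "P = exp (- 1 / 2) * measure (\<Pi>\<^sub>M i\<in>U. \<sigma>) {u \<in> space (\<Pi>\<^sub>M i\<in>U. \<sigma>). \<bar>\<Sum>i\<in>U. L i * u i\<bar> \<le> \<beta>}"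
  have F1: "\<bar>F y g\<bar> \<le> 1" for y g unfolding F_def using c by (auto intro!: mult_nonneg_nonneg sum_nonneg)
  have mF [measurable]: "case_prod F \<in> borel_measurable (?D \<Otimes>\<^sub>M gauss)"
    unfolding F_def case_prod_beta by measurable
  have mF' [measurable]: "case_prod F \<in> borel_measurable (borel \<Otimes>\<^sub>M gauss)"
    unfolding F_def case_prod_beta by measurable
  assume "\<not> ?thesis"
  then have lt: "\<And>y. y \<in> G \<Longrightarrow> (\<integral>g. F y g \<partial>gauss) < P" unfolding F_def P_def by (meson not_le)
  have intF: "integrable (?D \<Otimes>\<^sub>M gauss) (case_prod F)"
    by (rule DG.P.integrable_const_bound[of _ 1]) (use F1 mF in auto)
  have "P \<le> (\<integral>g. (\<Prod>i\<in>U. (\<integral>x. cos (L i / \<beta> * g * x) \<partial>\<sigma>)) \<partial>gauss)"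
    unfolding P_def by (rule small_ball_le_gauss[OF \<sigma> U odd \<beta>])
  also have "\<dots> \<le> (\<integral>g. (\<integral>y. F y g \<partial>?D) \<partial>gauss)"
  proof (rule integral_mono_AE')
    show "integrable gauss (\<lambda>g. \<integral>y. F y g \<partial>?D)" using DG.integrable_snd[OF intF] .
    have "(\<Prod>i\<in>U. (\<integral>x. cos (L i / \<beta> * g * x) \<partial>\<sigma>)) \<le> (\<integral>y. F y g \<partial>?D)" for g
      using prod_char_le_average[OF \<sigma> U nn G c, of "\<lambda>i. L i / \<beta> * g"]
      by (simp add: F_def mult_ac)
    then show "AE g in gauss. (\<Prod>i\<in>U. (\<integral>x. cos (L i / \<beta> * g * x) \<partial>\<sigma>)) \<le> (\<integral>y. F y g \<partial>?D)" by simp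
    show "AE g in gauss. 0 \<le> (\<integral>y. F y g \<partial>?D)" unfolding F_def by (intro AE_I2 integral_nonneg) auto
  qed
  also have "\<dots> = (\<integral>y. (\<integral>g. F y g \<partial>gauss) \<partial>?D)" by (rule DG.Fubini_integral[OF intF])
  also have "\<dots> < P"
  proof (rule D.expectation_less)
    show "integrable ?D (\<lambda>y. \<integral>g. F y g \<partial>gauss)" using DG.integrable_fst[OF intF] .
    show "AE y in ?D. (\<integral>g. F y g \<partial>gauss) < P"
      by (rule AE_uniform_measureI[OF Gm]) (use lt in auto)
  qed
  finally show False by simp
qed

section \<open>Decoupling of quadratic forms\<close>

lemma measure_pair_eq_integral:
  assumes "prob_space N" "prob_space M" and E: "E \<in> sets (N \<Otimes>\<^sub>M M)"
  shows "measure (N \<Otimes>\<^sub>M M) E = (\<integral>y. measure M (Pair y -` E) \<partial>N)"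
    and "(\<lambda>y. measure M (Pair y -` E)) \<in> borel_measurable N"
proof -
  interpret N: prob_space N by fact
  interpret M: prob_space M by fact
  interpret P: pair_prob_space N M ..
  have m: "(\<lambda>y. emeasure M (Pair y -` E)) \<in> borel_measurable N"
    by (rule M.measurable_emeasure_Pair[OF E])
  then show "(\<lambda>y. measure M (Pair y -` E)) \<in> borel_measurable N"
    unfolding measure_def by measurable
  have "measure (N \<Otimes>\<^sub>M M) E = enn2real (\<integral>\<^sup>+y. emeasure M (Pair y -` E) \<partial>N)"
    unfolding measure_def M.emeasure_pair_measure_alt[OF E] ..
  also have "\<dots> = enn2real (\<integral>\<^sup>+y. ennreal (measure M (Pair y -` E)) \<partial>N)"
    by (simp add: M.emeasure_eq_measure)
  also have "\<dots> = (\<integral>y. measure M (Pair y -` E) \<partial>N)"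
    using m by (intro integral_eq_nn_integral[symmetric]) (auto simp: measure_def)
  finally show "measure (N \<Otimes>\<^sub>M M) E = (\<integral>y. measure M (Pair y -` E) \<partial>N)" .
qed

lemma measure_pair_swap:
  assumes "prob_space N" "prob_space M" and E: "E \<in> sets (N \<Otimes>\<^sub>M M)"
  shows "measure (N \<Otimes>\<^sub>M M) E = measure (M \<Otimes>\<^sub>M N) {(x, y) \<in> space (M \<Otimes>\<^sub>M N). (y, x) \<in> E}"
proof -
  interpret N: prob_space N by fact
  interpret M: prob_space M by fact
  interpret P: pair_prob_space N M ..
  have "measure (N \<Otimes>\<^sub>M M) E = measure (distr (M \<Otimes>\<^sub>M N) (N \<Otimes>\<^sub>M M) (\<lambda>(x, y). (y, x))) E"
    using P.distr_pair_swap by simp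
  also have "\<dots> = measure (M \<Otimes>\<^sub>M N) ((\<lambda>(x, y). (y, x)) -` E \<inter> space (M \<Otimes>\<^sub>M N))"
    by (rule measure_distr[OF _ E]) measurable
  also have "(\<lambda>(x, y). (y, x)) -` E \<inter> space (M \<Otimes>\<^sub>M N) = {(x, y) \<in> space (M \<Otimes>\<^sub>M N). (y, x) \<in> E}"
    by auto
  finally show ?thesis .
qed

text \<open>Cauchy-Schwarz, in the form that the variance of the slice measure is nonnegative: over
  each point the slice of \<open>E'\<close> is the square of the slice of \<open>E\<close>.\<close>

lemma measure_pair_square_le:
  assumes "prob_space N" "prob_space M" and E: "E \<in> sets (N \<Otimes>\<^sub>M M)"
    and E'_def: "E' = {p \<in> space (N \<Otimes>\<^sub>M (M \<Otimes>\<^sub>M M)). (fst p, fst (snd p)) \<in> E \<and> (fst p, snd (snd p)) \<in> E}"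
  shows "(measure (N \<Otimes>\<^sub>M M) E)\<^sup>2 \<le> measure (N \<Otimes>\<^sub>M (M \<Otimes>\<^sub>M M)) E'"
    and "E' \<in> sets (N \<Otimes>\<^sub>M (M \<Otimes>\<^sub>M M))"
proof -
  interpret N: prob_space N by fact
  interpret M: prob_space M by fact
  interpret MM: pair_prob_space M M ..
  have [measurable]: "E \<in> sets (N \<Otimes>\<^sub>M M)" by fact
  show E': "E' \<in> sets (N \<Otimes>\<^sub>M (M \<Otimes>\<^sub>M M))" unfolding E'_def by measurable
  define h where "h y = measure M (Pair y -` E)" for y
  have h: "measure (N \<Otimes>\<^sub>M M) E = (\<integral>y. h y \<partial>N)" "h \<in> borel_measurable N"
    using measure_pair_eq_integral[OF assms(1,2) E] unfolding h_def by auto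
  have slice: "measure (M \<Otimes>\<^sub>M M) (Pair y -` E') = (h y)\<^sup>2" if "y \<in> space N" for y
  proof -
    have s: "Pair y -` E \<in> sets M" using E by (rule sets_Pair1)
    have "Pair y -` E' = (Pair y -` E) \<times> (Pair y -` E)"
      using that sets.sets_into_space[OF E] by (auto simp: E'_def space_pair_measure)
    then show ?thesis
      using s by (simp add: h_def measure_def M.emeasure_pair_measure_Times enn2real_mult power2_eq_square)
  qed
  have "measure (N \<Otimes>\<^sub>M (M \<Otimes>\<^sub>M M)) E' = (\<integral>y. measure (M \<Otimes>\<^sub>M M) (Pair y -` E') \<partial>N)"
    by (rule measure_pair_eq_integral[OF assms(1) _ E']) unfold_locales
  also have "\<dots> = (\<integral>y. (h y)\<^sup>2 \<partial>N)"
    by (rule Bochner_Integration.integral_cong) (auto simp: slice)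
  finally have e: "measure (N \<Otimes>\<^sub>M (M \<Otimes>\<^sub>M M)) E' = (\<integral>y. (h y)\<^sup>2 \<partial>N)" .
  have h01: "0 \<le> h y" "h y \<le> 1" for y by (auto simp: h_def)
  have "integrable N h" "integrable N (\<lambda>y. (h y)\<^sup>2)"
    using h(2) h01 by (auto intro!: N.integrable_const_bound[of _ 1] simp: power_le_one)
  then have "N.variance h = (\<integral>y. (h y)\<^sup>2 \<partial>N) - (\<integral>y. h y \<partial>N)\<^sup>2"
    by (rule N.variance_eq)
  then show "(measure (N \<Otimes>\<^sub>M M) E)\<^sup>2 \<le> measure (N \<Otimes>\<^sub>M (M \<Otimes>\<^sub>M M)) E'"
    using N.variance_positive[of h] unfolding e h(1) by linarith
qed

text \<open>Cauchy-Schwarz once in each coordinate: the fourth power of the probability is bounded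
  by the probability that all four corners of a random rectangle lie in \<open>E\<close>.\<close>

lemma decoupling:
  assumes NM: "prob_space N" "prob_space M" and E: "E \<in> sets (N \<Otimes>\<^sub>M M)"
    and E4_def: "E4 = {p \<in> space ((M \<Otimes>\<^sub>M M) \<Otimes>\<^sub>M (N \<Otimes>\<^sub>M N)).
      (fst (snd p), fst (fst p)) \<in> E \<and> (fst (snd p), snd (fst p)) \<in> E \<and>
      (snd (snd p), fst (fst p)) \<in> E \<and> (snd (snd p), snd (fst p)) \<in> E}"
  shows "(measure (N \<Otimes>\<^sub>M M) E) ^ 4 \<le> measure ((M \<Otimes>\<^sub>M M) \<Otimes>\<^sub>M (N \<Otimes>\<^sub>M N)) E4"
    and "E4 \<in> sets ((M \<Otimes>\<^sub>M M) \<Otimes>\<^sub>M (N \<Otimes>\<^sub>M N))"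
proof -
  interpret N: prob_space N by fact
  interpret M: prob_space M by fact
  interpret MM: pair_prob_space M M ..
  interpret NN: pair_prob_space N N ..
  interpret A: pair_prob_space N "M \<Otimes>\<^sub>M M" ..
  have MM: "prob_space (M \<Otimes>\<^sub>M M)" by unfold_locales
  have [measurable]: "E \<in> sets (N \<Otimes>\<^sub>M M)" by fact
  show E4: "E4 \<in> sets ((M \<Otimes>\<^sub>M M) \<Otimes>\<^sub>M (N \<Otimes>\<^sub>M N))" unfolding E4_def by measurable
  let ?E' = "{p \<in> space (N \<Otimes>\<^sub>M (M \<Otimes>\<^sub>M M)). (fst p, fst (snd p)) \<in> E \<and> (fst p, snd (snd p)) \<in> E}"
  let ?F = "{(x, y) \<in> space ((M \<Otimes>\<^sub>M M) \<Otimes>\<^sub>M N). (y, x) \<in> ?E'}"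
  note 1 = measure_pair_square_le[OF NM E refl]
  have "?F = (\<lambda>(x, y). (y, x)) -` ?E' \<inter> space ((M \<Otimes>\<^sub>M M) \<Otimes>\<^sub>M N)"
    by auto
  then have F: "?F \<in> sets ((M \<Otimes>\<^sub>M M) \<Otimes>\<^sub>M N)"
    using measurable_sets[OF measurable_pair_swap' 1(2)] by simp
  note 2 = measure_pair_square_le[OF MM NM(1) F refl]
  have "(measure (N \<Otimes>\<^sub>M M) E) ^ 4 = ((measure (N \<Otimes>\<^sub>M M) E)\<^sup>2)\<^sup>2" by (simp flip: power_mult)
  also have "\<dots> \<le> (measure (N \<Otimes>\<^sub>M (M \<Otimes>\<^sub>M M)) ?E')\<^sup>2"
    by (rule power_mono[OF 1(1)]) simp
  also have "measure (N \<Otimes>\<^sub>M (M \<Otimes>\<^sub>M M)) ?E' = measure ((M \<Otimes>\<^sub>M M) \<Otimes>\<^sub>M N) ?F"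
    by (rule measure_pair_swap[OF NM(1) MM 1(2)])
  also have "(measure ((M \<Otimes>\<^sub>M M) \<Otimes>\<^sub>M N) ?F)\<^sup>2 \<le>
      measure ((M \<Otimes>\<^sub>M M) \<Otimes>\<^sub>M (N \<Otimes>\<^sub>M N)) {p \<in> space ((M \<Otimes>\<^sub>M M) \<Otimes>\<^sub>M (N \<Otimes>\<^sub>M N)). (fst p, fst (snd p)) \<in> ?F \<and> (fst p, snd (snd p)) \<in> ?F}"
    by (rule 2(1))
  also have "{p \<in> space ((M \<Otimes>\<^sub>M M) \<Otimes>\<^sub>M (N \<Otimes>\<^sub>M N)). (fst p, fst (snd p)) \<in> ?F \<and> (fst p, snd (snd p)) \<in> ?F} = E4"
    by (auto simp: E4_def space_pair_measure)
  finally show "(measure (N \<Otimes>\<^sub>M M) E) ^ 4 \<le> measure ((M \<Otimes>\<^sub>M M) \<Otimes>\<^sub>M (N \<Otimes>\<^sub>M N)) E4" .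
qed

section \<open>Product laws of symmetrised and lazy variables\<close>

lemma sets_PiM_borel:
  assumes "sets \<mu> = sets (borel :: real measure)"
  shows "sets (\<Pi>\<^sub>M i\<in>I. \<mu>) = sets (\<Pi>\<^sub>M i\<in>I. borel)"
  using assms by (intro sets_PiM_cong refl)

lemma space_PiM_borel:
  assumes "sets \<mu> = sets (borel :: real measure)"
  shows "space (\<Pi>\<^sub>M i\<in>I. \<mu>) = PiE I (\<lambda>_. UNIV)"
  using sets_eq_imp_space_eq[OF assms] by (simp add: space_PiM)

text \<open>It suffices to compare the two measures on boxes; there the indicator is a product over
  coordinates, and both iterated integrals factor.\<close>

lemma PiM_diff_law:
  assumes \<mu>: "real_distribution \<mu>" and I: "finite I"
  shows "distr ((\<Pi>\<^sub>M i\<in>I. \<mu>) \<Otimes>\<^sub>M (\<Pi>\<^sub>M i\<in>I. \<mu>)) (\<Pi>\<^sub>M i\<in>I. borel) (\<lambda>(x, y). \<lambda>i\<in>I. x i - y i)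
    = (\<Pi>\<^sub>M i\<in>I. diff_law \<mu>)"
proof -
  interpret S: real_distribution \<mu> by fact
  interpret D: real_distribution "diff_law \<mu>" by (rule real_distribution_diff_law[OF \<mu>])
  interpret product_prob_space "\<lambda>_. \<mu>" I ..
  interpret DP: product_prob_space "\<lambda>_. diff_law \<mu>" I ..
  interpret SS: pair_prob_space \<mu> \<mu> ..
  interpret PP: pair_prob_space "\<Pi>\<^sub>M i\<in>I. \<mu>" "\<Pi>\<^sub>M i\<in>I. \<mu>" ..
  have [measurable_cong]: "sets (\<Pi>\<^sub>M i\<in>I. \<mu>) = sets (\<Pi>\<^sub>M i\<in>I. borel)"
    by (rule sets_PiM_borel) simp
  have md: "(\<lambda>(x, y). x - y) \<in> borel_measurable (\<mu> \<Otimes>\<^sub>M \<mu>)" by (rule diff_measurable) simp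
  have mD [measurable]: "(\<lambda>(x, y). \<lambda>i\<in>I. x i - y i) \<in> ((\<Pi>\<^sub>M i\<in>I. \<mu>) \<Otimes>\<^sub>M (\<Pi>\<^sub>M i\<in>I. \<mu>)) \<rightarrow>\<^sub>M (\<Pi>\<^sub>M i\<in>I. borel)"
    unfolding case_prod_beta by measurable
  show ?thesis
  proof (rule DP.PiM_eqI[OF I])
    show "sets (distr ((\<Pi>\<^sub>M i\<in>I. \<mu>) \<Otimes>\<^sub>M (\<Pi>\<^sub>M i\<in>I. \<mu>)) (\<Pi>\<^sub>M i\<in>I. borel) (\<lambda>(x, y). \<lambda>i\<in>I. x i - y i))
      = sets (\<Pi>\<^sub>M i\<in>I. diff_law \<mu>)"
      by (simp add: sets_PiM_borel[of "diff_law \<mu>"])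
  next
    fix A :: "'a \<Rightarrow> real set" assume A: "\<And>i. i \<in> I \<Longrightarrow> A i \<in> sets (diff_law \<mu>)"
    then have Ab [measurable]: "\<And>i. i \<in> I \<Longrightarrow> A i \<in> sets borel" by simp
    have PA: "PiE I A \<in> sets (\<Pi>\<^sub>M i\<in>I. borel)" using I Ab by (intro sets_PiM_I_finite) auto
    have ind: "(indicator {p \<in> space ((\<Pi>\<^sub>M i\<in>I. \<mu>) \<Otimes>\<^sub>M (\<Pi>\<^sub>M i\<in>I. \<mu>)). (\<lambda>i\<in>I. fst p i - snd p i) \<in> PiE I A} (x, y) :: ennreal)
       = (\<Prod>i\<in>I. indicator (A i) (x i - y i))"
      if "x \<in> space (\<Pi>\<^sub>M i\<in>I. \<mu>)" "y \<in> space (\<Pi>\<^sub>M i\<in>I. \<mu>)" for x y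
    proof (cases "\<forall>i\<in>I. x i - y i \<in> A i")
      case True
      then show ?thesis using that by (auto simp: space_pair_measure PiE_iff)
    next
      case False
      then obtain i where i: "i \<in> I" "x i - y i \<notin> A i" by auto
      then have p0: "(\<Prod>i\<in>I. indicator (A i) (x i - y i) :: ennreal) = 0"
        using I by (intro prod_zero bexI[of _ i]) auto
      show ?thesis unfolding p0 using i by (auto simp: PiE_iff indicator_def)
    qed
    have pre: "(\<lambda>(x, y). \<lambda>i\<in>I. x i - y i) -` PiE I A \<inter> space ((\<Pi>\<^sub>M i\<in>I. \<mu>) \<Otimes>\<^sub>M (\<Pi>\<^sub>M i\<in>I. \<mu>))
       = {p \<in> space ((\<Pi>\<^sub>M i\<in>I. \<mu>) \<Otimes>\<^sub>M (\<Pi>\<^sub>M i\<in>I. \<mu>)). (\<lambda>i\<in>I. fst p i - snd p i) \<in> PiE I A}" (is "?L = ?R")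
      by (auto simp: case_prod_beta)
    have R: "?R \<in> sets ((\<Pi>\<^sub>M i\<in>I. \<mu>) \<Otimes>\<^sub>M (\<Pi>\<^sub>M i\<in>I. \<mu>))"
      unfolding pre[symmetric] using mD PA by (rule measurable_sets)
    have m1: "(\<lambda>x. \<integral>\<^sup>+ y. indicator (A i) (x - y) \<partial>\<mu>) \<in> borel_measurable \<mu>" if "i \<in> I" for i
      using that by (intro S.borel_measurable_nn_integral) measurable
    have "emeasure (distr ((\<Pi>\<^sub>M i\<in>I. \<mu>) \<Otimes>\<^sub>M (\<Pi>\<^sub>M i\<in>I. \<mu>)) (\<Pi>\<^sub>M i\<in>I. borel) (\<lambda>(x, y). \<lambda>i\<in>I. x i - y i)) (PiE I A)
      = emeasure ((\<Pi>\<^sub>M i\<in>I. \<mu>) \<Otimes>\<^sub>M (\<Pi>\<^sub>M i\<in>I. \<mu>)) ?R"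
      by (subst emeasure_distr[OF mD PA]) (simp only: pre)
    also have "\<dots> = (\<integral>\<^sup>+x. \<integral>\<^sup>+y. indicator ?R (x, y) \<partial>(\<Pi>\<^sub>M i\<in>I. \<mu>) \<partial>(\<Pi>\<^sub>M i\<in>I. \<mu>))"
      by (rule P.emeasure_pair_measure[OF R])
    also have "\<dots> = (\<integral>\<^sup>+x. \<integral>\<^sup>+y. (\<Prod>i\<in>I. indicator (A i) (x i - y i)) \<partial>(\<Pi>\<^sub>M i\<in>I. \<mu>) \<partial>(\<Pi>\<^sub>M i\<in>I. \<mu>))"
      by (intro nn_integral_cong ind)
    also have "\<dots> = (\<integral>\<^sup>+x. (\<Prod>i\<in>I. \<integral>\<^sup>+y. indicator (A i) (x i - y) \<partial>\<mu>) \<partial>(\<Pi>\<^sub>M i\<in>I. \<mu>))"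
      by (intro nn_integral_cong product_nn_integral_prod I) (use Ab in measurable)
    also have "\<dots> = (\<Prod>i\<in>I. \<integral>\<^sup>+x. \<integral>\<^sup>+y. indicator (A i) (x - y) \<partial>\<mu> \<partial>\<mu>)"
      by (rule product_nn_integral_prod[OF I m1])
    also have "\<dots> = (\<Prod>i\<in>I. emeasure (diff_law \<mu>) (A i))"
    proof (rule prod.cong[OF refl])
      fix i assume i: "i \<in> I"
      have "emeasure (diff_law \<mu>) (A i) = emeasure (\<mu> \<Otimes>\<^sub>M \<mu>) ((\<lambda>(x, y). x - y) -` A i \<inter> space (\<mu> \<Otimes>\<^sub>M \<mu>))"
        unfolding diff_law_def by (rule emeasure_distr[OF md]) (use Ab i in auto)
      also have "\<dots> = (\<integral>\<^sup>+x. \<integral>\<^sup>+y. indicator ((\<lambda>(x, y). x - y) -` A i \<inter> space (\<mu> \<Otimes>\<^sub>M \<mu>)) (x, y) \<partial>\<mu> \<partial>\<mu>)"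
        by (rule S.emeasure_pair_measure) (rule measurable_sets[OF md], use Ab i in auto)
      also have "\<dots> = (\<integral>\<^sup>+x. \<integral>\<^sup>+y. indicator (A i) (x - y) \<partial>\<mu> \<partial>\<mu>)"
        by (intro nn_integral_cong) (auto simp: indicator_def space_pair_measure)
      finally show "(\<integral>\<^sup>+x. \<integral>\<^sup>+y. indicator (A i) (x - y) \<partial>\<mu> \<partial>\<mu>) = emeasure (diff_law \<mu>) (A i)" ..
    qed
    finally show "emeasure (distr ((\<Pi>\<^sub>M i\<in>I. \<mu>) \<Otimes>\<^sub>M (\<Pi>\<^sub>M i\<in>I. \<mu>)) (\<Pi>\<^sub>M i\<in>I. borel) (\<lambda>(x, y). \<lambda>i\<in>I. x i - y i)) (PiE I A)
      = (\<Prod>i\<in>I. emeasure (diff_law \<mu>) (A i))" .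
  qed
qed

text \<open>Condition on the value of \<eta>. The values 1 and -1 contribute equally, because
  exchanging the two copies reverses the sign of the difference.\<close>

lemma lazy_diff_law_measure:
  assumes \<mu>: "real_distribution \<mu>" and A: "A \<in> sets borel"
  shows "measure (lazy_diff_law \<mu>) A = (indicator A 0 + measure (diff_law \<mu>) A) / 2"
proof -
  interpret real_distribution \<mu> by fact
  interpret E: prob_space "measure_pmf eta_half" by (rule prob_space_measure_pmf)
  interpret P: pair_prob_space \<mu> \<mu> ..
  interpret Q: pair_prob_space "measure_pmf eta_half" "\<mu> \<Otimes>\<^sub>M \<mu>" ..
  note [measurable] = A
  have e: "(\<lambda>p. fst p) \<in> borel_measurable (measure_pmf eta_half \<Otimes>\<^sub>M (\<mu> \<Otimes>\<^sub>M \<mu>))"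
    using measurable_compose[OF measurable_fst, of "\<lambda>x::real. x" "measure_pmf eta_half" borel]
    by simp
  have m: "(\<lambda>(e, x, x'). e * (x - x')) \<in> borel_measurable (measure_pmf eta_half \<Otimes>\<^sub>M (\<mu> \<Otimes>\<^sub>M \<mu>))"
    unfolding case_prod_beta using e by measurable
  have d: "(\<lambda>(x, y). x - y) \<in> borel_measurable (\<mu> \<Otimes>\<^sub>M \<mu>)" by (rule diff_measurable) simp
  define B where "B = (\<lambda>(e, x, x'). e * (x - x')) -` A \<inter> space (measure_pmf eta_half \<Otimes>\<^sub>M (\<mu> \<Otimes>\<^sub>M \<mu>))"
  have B: "B \<in> sets (measure_pmf eta_half \<Otimes>\<^sub>M (\<mu> \<Otimes>\<^sub>M \<mu>))"
    unfolding B_def using m A by (rule measurable_sets)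
  define D where "D e = {(x, y). e * (x - y) \<in> A}" for e :: real
  have D: "Pair e -` B = D e" for e by (auto simp: B_def D_def space_pair_measure)
  have sub: "set_pmf eta_half \<subseteq> {-1, 0, 1}" by (auto simp: set_pmf_iff pmf_eta_half split: if_splits)
  have "measure (lazy_diff_law \<mu>) A = measure (measure_pmf eta_half \<Otimes>\<^sub>M (\<mu> \<Otimes>\<^sub>M \<mu>)) B"
    unfolding lazy_diff_law_def B_def by (rule measure_distr[OF m A])
  also have "\<dots> = (\<integral>e. measure (\<mu> \<Otimes>\<^sub>M \<mu>) (D e) \<partial>measure_pmf eta_half)"
    unfolding D[symmetric] by (rule measure_pair_eq_integral(1)[OF _ _ B]) unfold_locales
  also have "\<dots> = (\<Sum>e\<in>{-1, 0, 1}. measure (\<mu> \<Otimes>\<^sub>M \<mu>) (D e) * pmf eta_half e)"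
    by (rule integral_measure_pmf_real) (use sub in auto)
  also have "\<dots> = (measure (\<mu> \<Otimes>\<^sub>M \<mu>) (D (- 1)) + 2 * measure (\<mu> \<Otimes>\<^sub>M \<mu>) (D 0) + measure (\<mu> \<Otimes>\<^sub>M \<mu>) (D 1)) / 4"
    by (simp add: pmf_eta_half)
  also have "measure (\<mu> \<Otimes>\<^sub>M \<mu>) (D 0) = indicator A 0"
  proof (cases "0 \<in> A")
    case True
    then have "D 0 = space (\<mu> \<Otimes>\<^sub>M \<mu>)" by (auto simp: D_def space_pair_measure)
    then show ?thesis using True P.P.prob_space by simp
  next
    case False
    then have "D 0 = {}" by (auto simp: D_def)
    then show ?thesis using False by simp
  qed
  also have 1: "measure (\<mu> \<Otimes>\<^sub>M \<mu>) (D 1) = measure (diff_law \<mu>) A"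
  proof -
    have "(\<lambda>(x, y). x - y) -` A \<inter> space (\<mu> \<Otimes>\<^sub>M \<mu>) = D 1" by (auto simp: D_def space_pair_measure)
    then show ?thesis unfolding diff_law_def by (subst measure_distr[OF d A]) simp
  qed
  also have "measure (\<mu> \<Otimes>\<^sub>M \<mu>) (D (- 1)) = measure (\<mu> \<Otimes>\<^sub>M \<mu>) (D 1)"
  proof -
    have "D (- 1) = Pair (- 1) -` B" by (simp add: D)
    also have "\<dots> \<in> sets (\<mu> \<Otimes>\<^sub>M \<mu>)" using B by (rule sets_Pair1)
    finally have "measure (\<mu> \<Otimes>\<^sub>M \<mu>) (D (- 1)) = measure (\<mu> \<Otimes>\<^sub>M \<mu>) {(x, y) \<in> space (\<mu> \<Otimes>\<^sub>M \<mu>). (y, x) \<in> D (- 1)}"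
      by (intro measure_pair_swap) unfold_locales
    also have "{(x, y) \<in> space (\<mu> \<Otimes>\<^sub>M \<mu>). (y, x) \<in> D (- 1)} = D 1" by (auto simp: D_def space_pair_measure)
    finally show ?thesis .
  qed
  finally show ?thesis unfolding 1 by simp
qed

text \<open>Setting coordinates to 0 instead of dropping them keeps the vectors for all
  \<open>U\<close> in one space, driven by the same \<open>w\<close>, so that they can be averaged
  over \<open>U\<close>.\<close>

definition mask_out :: "nat \<Rightarrow> nat set \<Rightarrow> (nat \<Rightarrow> real) \<Rightarrow> nat \<Rightarrow> real" where
  "mask_out n U w = (\<lambda>i\<in>{..<n}. if i \<in> U then 0 else w i)"

lemma mask_out_measurable [measurable]:
  assumes "sets \<sigma> = sets borel"
  shows "mask_out n U \<in> (\<Pi>\<^sub>M i\<in>{..<n}. \<sigma>) \<rightarrow>\<^sub>M (\<Pi>\<^sub>M i\<in>{..<n}. borel)"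
proof -
  have [measurable_cong]: "sets (\<Pi>\<^sub>M i\<in>{..<n}. \<sigma>) = sets (\<Pi>\<^sub>M i\<in>{..<n}. borel)"
    by (rule sets_PiM_borel) fact
  show ?thesis unfolding mask_out_def by (rule measurable_restrict) measurable
qed

text \<open>Since \<open>\<xi> - \<xi>'\<close> is symmetric, \<open>\<eta>(\<xi> - \<xi>')\<close> amounts to \<open>\<xi> - \<xi>'\<close> kept or replaced by 0 with
  probability 1/2 each.\<close>

lemma lazy_iid_eq_average:
  assumes \<mu>: "real_distribution \<mu>" and S: "S \<in> sets (\<Pi>\<^sub>M i\<in>{..<n}. borel)"
  shows "measure (iid_law n (lazy_diff_law \<mu>)) S =
    (\<Sum>U\<in>Pow {..<n}. measure (\<Pi>\<^sub>M i\<in>{..<n}. diff_law \<mu>) {w \<in> space (\<Pi>\<^sub>M i\<in>{..<n}. diff_law \<mu>). mask_out n U w \<in> S}) / 2 ^ n"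
proof -
  interpret Dl: real_distribution "diff_law \<mu>" by (rule real_distribution_diff_law[OF \<mu>])
  interpret L: real_distribution "lazy_diff_law \<mu>" by (rule real_distribution_lazy_diff_law[OF \<mu>])
  interpret product_prob_space "\<lambda>_::nat. lazy_diff_law \<mu>" "{..<n}" ..
  interpret DP: product_prob_space "\<lambda>_::nat. diff_law \<mu>" "{..<n}" ..
  define W where "W = (\<Pi>\<^sub>M i\<in>{..<n}. diff_law \<mu>)"
  define B where "B = (\<Pi>\<^sub>M i\<in>{..<n}. (borel :: real measure))"
  have sB: "sets (\<Pi>\<^sub>M i\<in>{..<n}. lazy_diff_law \<mu>) = sets B"
    unfolding B_def by (rule sets_PiM_borel) simp
  have spW: "space W = PiE {..<n} (\<lambda>_. UNIV)" unfolding W_def by (rule space_PiM_borel) simp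
  interpret W: prob_space W unfolding W_def by (rule DP.P.prob_space_axioms)
  have mm: "mask_out n U \<in> W \<rightarrow>\<^sub>M B" for U unfolding W_def B_def by (rule mask_out_measurable) simp
  \<comment> \<open>The mixture of the masked laws over a uniformly random subset; it is identified
    with the lazy product law by its values on boxes.\<close>
  define N where "N = measure_pmf (pmf_of_set (Pow {..<n})) \<bind> (\<lambda>U. distr W B (mask_out n U))"
  have ker: "(\<lambda>U. distr W B (mask_out n U)) \<in> measure_pmf (pmf_of_set (Pow {..<n})) \<rightarrow>\<^sub>M subprob_algebra B"
    by (auto simp: space_subprob_algebra intro!: prob_space_imp_subprob_space W.prob_space_distr mm)
  have setsN: "sets N = sets B" unfolding N_def by (rule sets_bind[OF sets_kernel[OF ker]]) auto
  have emN: "emeasure N X = ennreal ((\<Sum>U\<in>Pow {..<n}. measure W {w \<in> space W. mask_out n U w \<in> X}) / 2 ^ n)"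
    if X: "X \<in> sets B" for X
  proof -
    have "emeasure N X = (\<integral>\<^sup>+U. emeasure (distr W B (mask_out n U)) X \<partial>measure_pmf (pmf_of_set (Pow {..<n})))"
      unfolding N_def by (rule emeasure_bind[OF _ ker X]) simp
    also have "\<dots> = (\<Sum>U\<in>Pow {..<n}. emeasure (distr W B (mask_out n U)) X) / card (Pow {..<n})"
      by (rule nn_integral_pmf_of_set) auto
    also have "\<dots> = (\<Sum>U\<in>Pow {..<n}. ennreal (measure W {w \<in> space W. mask_out n U w \<in> X})) / ennreal (2 ^ n)"
    proof -
      have "emeasure (distr W B (mask_out n U)) X = ennreal (measure W {w \<in> space W. mask_out n U w \<in> X})" for U
        by (subst emeasure_distr[OF mm X]) (auto simp: W.emeasure_eq_measure intro!: arg_cong[where f = "measure W"])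
      then show ?thesis by (simp add: card_Pow ennreal_power[symmetric])
    qed
    also have "\<dots> = ennreal ((\<Sum>U\<in>Pow {..<n}. measure W {w \<in> space W. mask_out n U w \<in> X}) / 2 ^ n)"
      by (subst sum_ennreal) (auto intro!: divide_ennreal sum_nonneg)
    finally show ?thesis .
  qed
  have "N = (\<Pi>\<^sub>M i\<in>{..<n}. lazy_diff_law \<mu>)"
  proof (rule PiM_eqI)
    show "sets N = sets (\<Pi>\<^sub>M i\<in>{..<n}. lazy_diff_law \<mu>)" using setsN sB by simp
    fix A :: "nat \<Rightarrow> real set" assume "\<And>i. i \<in> {..<n} \<Longrightarrow> A i \<in> sets (lazy_diff_law \<mu>)"
    then have A: "\<And>i. i < n \<Longrightarrow> A i \<in> sets borel" by simp
    have PA: "PiE {..<n} A \<in> sets B" unfolding B_def using A by (intro sets_PiM_I_finite) auto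
    have box: "measure W {w \<in> space W. mask_out n U w \<in> PiE {..<n} A} =
        (\<Prod>i\<in>U. indicator (A i) 0) * (\<Prod>i\<in>{..<n}-U. measure (diff_law \<mu>) (A i))"
      if U: "U \<subseteq> {..<n}" for U
    proof -
      \<comment> \<open>A masked coordinate takes the value 0, hence imposes either no condition or
        an impossible one.\<close>
      define A' where "A' i = (if i \<in> U then (if 0 \<in> A i then UNIV else {}) else A i)" for i
      have k: "(if i \<in> U then 0 else x) \<in> A i \<longleftrightarrow> x \<in> A' i" for x :: real and i
        by (auto simp: A'_def)
      have "{w \<in> space W. mask_out n U w \<in> PiE {..<n} A} = PiE {..<n} A'"
      proof -
        have m: "mask_out n U w \<in> PiE {..<n} A \<longleftrightarrow> (\<forall>i\<in>{..<n}. w i \<in> A' i)" for w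
          unfolding mask_out_def restrict_PiE_iff by (simp only: k)
        show ?thesis unfolding m spW by (simp add: PiE_def Pi_def Collect_conj_eq Int_commute Ball_def)
      qed
      also have "measure W \<dots> = (\<Prod>i\<in>{..<n}. measure (diff_law \<mu>) (A' i))"
        unfolding W_def by (rule finite_product_prob_space.finite_measure_PiM_emb)
          (unfold_locales, simp, use A in \<open>simp add: A'_def\<close>)
      also have "\<dots> = (\<Prod>i\<in>{..<n}-U. measure (diff_law \<mu>) (A' i)) * (\<Prod>i\<in>U. measure (diff_law \<mu>) (A' i))"
        using U by (intro prod.subset_diff) auto
      also have "(\<Prod>i\<in>{..<n}-U. measure (diff_law \<mu>) (A' i)) = (\<Prod>i\<in>{..<n}-U. measure (diff_law \<mu>) (A i))"
        by (rule prod.cong) (auto simp: A'_def)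
      also have "(\<Prod>i\<in>U. measure (diff_law \<mu>) (A' i)) = (\<Prod>i\<in>U. indicator (A i) 0)"
        using Dl.prob_space by (intro prod.cong) (auto simp: A'_def)
      finally show ?thesis by (simp add: mult.commute)
    qed
    have "(\<Sum>U\<in>Pow {..<n}. measure W {w \<in> space W. mask_out n U w \<in> PiE {..<n} A}) / 2 ^ n
      = (\<Sum>U\<in>Pow {..<n}. (\<Prod>i\<in>U. indicator (A i) 0) * (\<Prod>i\<in>{..<n}-U. measure (diff_law \<mu>) (A i))) / 2 ^ n"
      using box by (auto intro!: arg_cong[where f = "\<lambda>x. x / 2 ^ n"] sum.cong)
    \<comment> \<open>The sum over subsets is the expansion of a product of two-term sums, one for
      each coordinate.\<close>
    also have "\<dots> = (\<Prod>i<n. indicator (A i) 0 + measure (diff_law \<mu>) (A i)) / (\<Prod>i<n. 2)"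
      by (subst prod_add) auto
    also have "\<dots> = (\<Prod>i<n. measure (lazy_diff_law \<mu>) (A i))"
      unfolding prod_dividef[symmetric] using A by (intro prod.cong) (auto simp: lazy_diff_law_measure[OF \<mu>])
    finally show "emeasure N (PiE {..<n} A) = (\<Prod>i<n. emeasure (lazy_diff_law \<mu>) (A i))"
      unfolding emN[OF PA] by (simp add: L.emeasure_eq_measure prod_ennreal)
  qed simp
  then have "emeasure (iid_law n (lazy_diff_law \<mu>)) S = emeasure N S" by (simp add: iid_law_def)
  then have "measure (iid_law n (lazy_diff_law \<mu>)) S = enn2real (emeasure N S)" by (simp add: measure_def)
  also have "\<dots> = (\<Sum>U\<in>Pow {..<n}. measure W {w \<in> space W. mask_out n U w \<in> S}) / 2 ^ n"
  proof -
    have "0 \<le> (\<Sum>U\<in>Pow {..<n}. measure W {w \<in> space W. mask_out n U w \<in> S}) / 2 ^ n"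
      by (intro divide_nonneg_nonneg sum_nonneg) auto
    then show ?thesis using emN[of S] S by (simp only: B_def enn2real_ennreal)
  qed
  finally show ?thesis by (simp add: W_def)
qed

section \<open>From the quadratic form to random linear forms\<close>

text \<open>In a mixed second difference everything that depends on only one of the two blocks
  cancels, and so do the shifts \<open>f\<close>. Only the two mixed blocks survive, equal by
  symmetry, whence the factor 2.\<close>

lemma second_difference_quadratic_form:
  fixes x x' y y' f :: "nat \<Rightarrow> real" and A :: "nat \<Rightarrow> nat \<Rightarrow> real"
  assumes "finite U" "finite V" "U \<inter> V = {}" and sym: "\<And>i j. i \<in> U \<union> V \<Longrightarrow> j \<in> U \<union> V \<Longrightarrow> A i j = A j i"
    and Q_def: "\<And>z. Q z = (\<Sum>i\<in>U \<union> V. \<Sum>j\<in>U \<union> V. A i j * (z i + f i) * (z j + f j))"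
  shows "Q (merge V U (y, x)) - Q (merge V U (y, x')) - Q (merge V U (y', x)) + Q (merge V U (y', x'))
    = 2 * (\<Sum>i\<in>U. \<Sum>j\<in>V. A i j * (x i - x' i) * (y j - y' j))"
proof -
  define XX where "XX x = (\<Sum>i\<in>U. \<Sum>j\<in>U. A i j * (x i + f i) * (x j + f j))" for x
  define YY where "YY y = (\<Sum>i\<in>V. \<Sum>j\<in>V. A i j * (y i + f i) * (y j + f j))" for y
  define XY where "XY x y = (\<Sum>i\<in>U. \<Sum>j\<in>V. A i j * (x i + f i) * (y j + f j))" for x y
  have Q: "Q (merge V U (y, x)) = XX x + 2 * XY x y + YY y" for x y
  proof -
    have mV: "merge V U (y, x) i = y i" if "i \<in> V" for i using that by (simp add: merge_def)
    have mU: "merge V U (y, x) i = x i" if "i \<in> U" for i using that assms(3) by (auto simp: merge_def)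
    have "Q (merge V U (y, x)) = XX x + XY x y + ((\<Sum>i\<in>V. \<Sum>j\<in>U. A i j * (y i + f i) * (x j + f j)) + YY y)"
      unfolding Q_def sum.union_disjoint[OF assms(1-3)] XX_def XY_def YY_def
      by (simp add: mV mU sum.distrib cong: sum.cong)
    also have "(\<Sum>i\<in>V. \<Sum>j\<in>U. A i j * (y i + f i) * (x j + f j)) = XY x y"
      unfolding XY_def by (subst sum.swap) (auto intro!: sum.cong simp: sym mult_ac)
    finally show ?thesis by simp
  qed
  have "XY x y - XY x' y - XY x y' + XY x' y' = (\<Sum>i\<in>U. \<Sum>j\<in>V. A i j * (x i - x' i) * (y j - y' j))"
    unfolding XY_def sum_subtractf[symmetric] sum.distrib[symmetric]
    by (intro sum.cong refl) (simp add: algebra_simps)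
  then show ?thesis unfolding Q by (simp add: algebra_simps)
qed

lemma measurable_component_PiM_borel:
  assumes "sets \<sigma> = sets (borel :: real measure)" "i \<in> I"
  shows "(\<lambda>u. u i) \<in> borel_measurable (\<Pi>\<^sub>M i\<in>I. \<sigma>)"
  using measurable_component_singleton[of i I "\<lambda>_. \<sigma>"] assms by (simp cong: measurable_cong_sets)

text \<open>If all four values at the corners lie within \<open>\<beta>\<close> of \<open>a\<close>,
  their alternating sum is at most 4 \<open>\<beta>\<close>. It equals twice the bilinear form in
  the differences, which leaves 2 \<open>\<beta>\<close> and removes \<open>a\<close>.\<close>

lemma quadratic_decoupling:
  fixes A :: "nat \<Rightarrow> nat \<Rightarrow> real"
  assumes \<mu>: "real_distribution \<mu>" and U: "U \<subseteq> {..<n}"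
    and sym: "\<And>i j. i < n \<Longrightarrow> j < n \<Longrightarrow> A i j = A j i"
    and \<sigma>_def: "\<sigma> = diff_law \<mu>" and V_def: "V = {..<n} - U"
  shows "measure (iid_law n \<mu>) {x \<in> space (iid_law n \<mu>). \<bar>(\<Sum>i<n. \<Sum>j<n. A i j * (x i + f i) * (x j + f j)) - a\<bar> \<le> \<beta>} ^ 4
    \<le> measure ((\<Pi>\<^sub>M i\<in>U. \<sigma>) \<Otimes>\<^sub>M (\<Pi>\<^sub>M i\<in>V. \<sigma>))
        {p \<in> space ((\<Pi>\<^sub>M i\<in>U. \<sigma>) \<Otimes>\<^sub>M (\<Pi>\<^sub>M i\<in>V. \<sigma>)). \<bar>\<Sum>i\<in>U. \<Sum>j\<in>V. A i j * fst p i * snd p j\<bar> \<le> 2 * \<beta>}"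
proof -
  interpret S: real_distribution \<mu> by fact
  interpret D: real_distribution \<sigma> unfolding \<sigma>_def by (rule real_distribution_diff_law[OF \<mu>])
  have UV: "finite U" "finite V" "V \<inter> U = {}" "V \<union> U = {..<n}" using U by (auto simp: V_def intro: finite_subset)
  define M where "M = (\<Pi>\<^sub>M i\<in>U. \<mu>)"
  define N where "N = (\<Pi>\<^sub>M i\<in>V. \<mu>)"
  interpret pM: product_prob_space "\<lambda>_. \<mu>" U ..
  interpret pN: product_prob_space "\<lambda>_. \<mu>" V ..
  interpret dM: product_prob_space "\<lambda>_. \<sigma>" U ..
  interpret dN: product_prob_space "\<lambda>_. \<sigma>" V ..
  have M: "prob_space M" and N: "prob_space N" unfolding M_def N_def
    by (rule pM.P.prob_space_axioms pN.P.prob_space_axioms)+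
  interpret M: prob_space M by (rule M)
  interpret N: prob_space N by (rule N)
  interpret MM: pair_prob_space M M ..
  interpret NN: pair_prob_space N N ..
  define L where "L = (\<Pi>\<^sub>M i\<in>{..<n}. \<mu>)"
  define Q where "Q x = (\<Sum>i<n. \<Sum>j<n. A i j * (x i + f i) * (x j + f j))" for x
  define E where "E = {x \<in> space L. \<bar>Q x - a\<bar> \<le> \<beta>}"
  have comp [measurable]: "(\<lambda>x. x i) \<in> borel_measurable L" if "i < n" for i
    unfolding L_def using that by (intro measurable_component_PiM_borel) auto
  have "Q \<in> borel_measurable L" unfolding Q_def by (intro borel_measurable_sum borel_measurable_times borel_measurable_add comp) auto
  then have E: "E \<in> sets L" unfolding E_def by measurable
  define E2 where "E2 = merge V U -` E \<inter> space (N \<Otimes>\<^sub>M M)"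
  have mg: "merge V U \<in> (N \<Otimes>\<^sub>M M) \<rightarrow>\<^sub>M L"
    unfolding N_def M_def L_def UV(4)[symmetric] by (rule measurable_merge)
  have E2: "E2 \<in> sets (N \<Otimes>\<^sub>M M)" unfolding E2_def using mg E by (rule measurable_sets)
  have "measure L E = measure (distr (N \<Otimes>\<^sub>M M) L (merge V U)) E"
    using pM.distr_merge[OF UV(3) UV(2,1)] unfolding UV(4) N_def M_def L_def by simp
  also have "\<dots> = measure (N \<Otimes>\<^sub>M M) E2" unfolding E2_def by (rule measure_distr[OF mg E])
  finally have LE: "measure L E = measure (N \<Otimes>\<^sub>M M) E2" .
  define E4 where "E4 = {p \<in> space ((M \<Otimes>\<^sub>M M) \<Otimes>\<^sub>M (N \<Otimes>\<^sub>M N)).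
      (fst (snd p), fst (fst p)) \<in> E2 \<and> (fst (snd p), snd (fst p)) \<in> E2 \<and>
      (snd (snd p), fst (fst p)) \<in> E2 \<and> (snd (snd p), snd (fst p)) \<in> E2}"
  note dec = decoupling[OF N M E2 E4_def]
  define dU where "dU = (\<lambda>(x, y). \<lambda>i\<in>U. x i - y i :: real)"
  define dV where "dV = (\<lambda>(x, y). \<lambda>i\<in>V. x i - y i :: real)"
  define BU where "BU = (\<Pi>\<^sub>M i\<in>U. (borel :: real measure))"
  define BV where "BV = (\<Pi>\<^sub>M i\<in>V. (borel :: real measure))"
  have sM [measurable_cong]: "sets M = sets BU" unfolding M_def BU_def by (rule sets_PiM_borel) simp
  have sN [measurable_cong]: "sets N = sets BV" unfolding N_def BV_def by (rule sets_PiM_borel) simp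
  have dUV: "distr (M \<Otimes>\<^sub>M M) BU dU = (\<Pi>\<^sub>M i\<in>U. \<sigma>)" "distr (N \<Otimes>\<^sub>M N) BV dV = (\<Pi>\<^sub>M i\<in>V. \<sigma>)"
    unfolding M_def N_def BU_def BV_def dU_def dV_def \<sigma>_def by (rule PiM_diff_law[OF \<mu>], simp add: UV)+
  have mdU: "dU \<in> (M \<Otimes>\<^sub>M M) \<rightarrow>\<^sub>M BU"
  proof -
    have "(\<lambda>p. fst p i - snd p i) \<in> borel_measurable (M \<Otimes>\<^sub>M M)" if "i \<in> U" for i
    proof -
      have [measurable]: "(\<lambda>u. u i) \<in> borel_measurable M" unfolding M_def using that by (intro measurable_component_PiM_borel) auto
      show ?thesis by measurable
    qed
    then show ?thesis unfolding dU_def BU_def case_prod_beta by (intro measurable_restrict) auto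
  qed
  have mdV: "dV \<in> (N \<Otimes>\<^sub>M N) \<rightarrow>\<^sub>M BV"
  proof -
    have "(\<lambda>p. fst p i - snd p i) \<in> borel_measurable (N \<Otimes>\<^sub>M N)" if "i \<in> V" for i
    proof -
      have [measurable]: "(\<lambda>u. u i) \<in> borel_measurable N" unfolding N_def using that by (intro measurable_component_PiM_borel) auto
      show ?thesis by measurable
    qed
    then show ?thesis unfolding dV_def BV_def case_prod_beta by (intro measurable_restrict) auto
  qed
  define F where "F = {p \<in> space (BU \<Otimes>\<^sub>M BV). \<bar>\<Sum>i\<in>U. \<Sum>j\<in>V. A i j * fst p i * snd p j\<bar> \<le> 2 * \<beta>}"
  have F: "F \<in> sets (BU \<Otimes>\<^sub>M BV)"
  proof -
    have "(\<lambda>p. A i j * fst p i * snd p j) \<in> borel_measurable (BU \<Otimes>\<^sub>M BV)" if "i \<in> U" "j \<in> V" for i j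
    proof -
      have [measurable]: "(\<lambda>u. u i) \<in> borel_measurable BU" "(\<lambda>u. u j) \<in> borel_measurable BV"
        unfolding BU_def BV_def using that by (intro measurable_component_PiM_borel; simp)+
      show ?thesis by measurable
    qed
    then have "(\<lambda>p. \<Sum>i\<in>U. \<Sum>j\<in>V. A i j * fst p i * snd p j) \<in> borel_measurable (BU \<Otimes>\<^sub>M BV)"
      by (intro borel_measurable_sum) auto
    then show ?thesis unfolding F_def by measurable
  qed
  let ?d = "\<lambda>(x, y). (dU x, dV y)"
  have md: "?d \<in> ((M \<Otimes>\<^sub>M M) \<Otimes>\<^sub>M (N \<Otimes>\<^sub>M N)) \<rightarrow>\<^sub>M (BU \<Otimes>\<^sub>M BV)"
    using mdU mdV by measurable
  have "measure ((M \<Otimes>\<^sub>M M) \<Otimes>\<^sub>M (N \<Otimes>\<^sub>M N)) E4 \<le>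
      measure ((M \<Otimes>\<^sub>M M) \<Otimes>\<^sub>M (N \<Otimes>\<^sub>M N)) (?d -` F \<inter> space ((M \<Otimes>\<^sub>M M) \<Otimes>\<^sub>M (N \<Otimes>\<^sub>M N)))"
  proof -
    interpret A: pair_prob_space "M \<Otimes>\<^sub>M M" "N \<Otimes>\<^sub>M N" ..
    show ?thesis
    proof (rule A.P.finite_measure_mono)
      show "?d -` F \<inter> space ((M \<Otimes>\<^sub>M M) \<Otimes>\<^sub>M (N \<Otimes>\<^sub>M N)) \<in> sets ((M \<Otimes>\<^sub>M M) \<Otimes>\<^sub>M (N \<Otimes>\<^sub>M N))"
        using md F by (rule measurable_sets)
      show "E4 \<subseteq> ?d -` F \<inter> space ((M \<Otimes>\<^sub>M M) \<Otimes>\<^sub>M (N \<Otimes>\<^sub>M N))"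
      proof
        fix p assume p: "p \<in> E4"
        then have sp: "p \<in> space ((M \<Otimes>\<^sub>M M) \<Otimes>\<^sub>M (N \<Otimes>\<^sub>M N))" by (simp add: E4_def)
        obtain x x' y y' where pe: "p = ((x, x'), (y, y'))" by (metis prod.exhaust)
        have "\<bar>Q (merge V U (y, x)) - a\<bar> \<le> \<beta>" "\<bar>Q (merge V U (y, x')) - a\<bar> \<le> \<beta>"
          "\<bar>Q (merge V U (y', x)) - a\<bar> \<le> \<beta>" "\<bar>Q (merge V U (y', x')) - a\<bar> \<le> \<beta>"
          using p by (auto simp: pe E4_def E2_def E_def)
        moreover have "Q (merge V U (y, x)) - Q (merge V U (y, x')) - Q (merge V U (y', x)) + Q (merge V U (y', x'))
            = 2 * (\<Sum>i\<in>U. \<Sum>j\<in>V. A i j * (x i - x' i) * (y j - y' j))"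
        proof -
          have UV': "U \<union> V = {..<n}" "U \<inter> V = {}" using UV by auto
          show ?thesis
            by (rule second_difference_quadratic_form[OF UV(1,2) UV'(2)]) (use sym UV' in \<open>auto simp: Q_def\<close>)
        qed
        ultimately have "\<bar>\<Sum>i\<in>U. \<Sum>j\<in>V. A i j * (x i - x' i) * (y j - y' j)\<bar> \<le> 2 * \<beta>" by linarith
        moreover have "(\<Sum>i\<in>U. \<Sum>j\<in>V. A i j * dU (x, x') i * dV (y, y') j) = (\<Sum>i\<in>U. \<Sum>j\<in>V. A i j * (x i - x' i) * (y j - y' j))"
          by (intro sum.cong refl) (simp add: dU_def dV_def)
        ultimately show "p \<in> ?d -` F \<inter> space ((M \<Otimes>\<^sub>M M) \<Otimes>\<^sub>M (N \<Otimes>\<^sub>M N))"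
          using sp measurable_space[OF md sp] by (simp add: pe F_def)
      qed
    qed
  qed
  also have "\<dots> = measure (distr ((M \<Otimes>\<^sub>M M) \<Otimes>\<^sub>M (N \<Otimes>\<^sub>M N)) (BU \<Otimes>\<^sub>M BV) ?d) F"
    by (rule measure_distr[OF md F, symmetric])
  also have "distr ((M \<Otimes>\<^sub>M M) \<Otimes>\<^sub>M (N \<Otimes>\<^sub>M N)) (BU \<Otimes>\<^sub>M BV) ?d = (\<Pi>\<^sub>M i\<in>U. \<sigma>) \<Otimes>\<^sub>M (\<Pi>\<^sub>M i\<in>V. \<sigma>)"
    unfolding dUV[symmetric]
    by (rule pair_measure_distr[OF mdU mdV, symmetric])
      (unfold dUV, rule prob_space_imp_sigma_finite, rule dN.P.prob_space_axioms)
  finally have "measure ((M \<Otimes>\<^sub>M M) \<Otimes>\<^sub>M (N \<Otimes>\<^sub>M N)) E4 \<le> measure ((\<Pi>\<^sub>M i\<in>U. \<sigma>) \<Otimes>\<^sub>M (\<Pi>\<^sub>M i\<in>V. \<sigma>)) F" .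
  moreover have "space (BU \<Otimes>\<^sub>M BV) = space ((\<Pi>\<^sub>M i\<in>U. \<sigma>) \<Otimes>\<^sub>M (\<Pi>\<^sub>M i\<in>V. \<sigma>))"
    by (simp add: space_pair_measure BU_def BV_def space_PiM_borel[of \<sigma>] space_PiM)
  ultimately show ?thesis using dec(1) LE
    unfolding F_def E_def L_def Q_def iid_law_def by simp
qed

text \<open>Freezing the block outside \<open>U\<close> turns the bilinear form into a linear form
  in the block \<open>U\<close>. Only the coordinates of \<open>w\<close> outside \<open>U\<close>
  matter, but integrating over all of \<open>w\<close> puts every \<open>U\<close> on the same space
  \<open>W\<close>.\<close>

lemma prob_bilinear_slice:
  fixes A :: "nat \<Rightarrow> nat \<Rightarrow> real" and \<beta> :: real
  assumes \<sigma>: "real_distribution \<sigma>" and U: "U \<subseteq> {..<n}"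
    and V_def: "V = {..<n} - U" and W_def: "W = (\<Pi>\<^sub>M i\<in>{..<n}. \<sigma>)"
    and h_def: "h = (\<lambda>w. measure (\<Pi>\<^sub>M i\<in>U. \<sigma>) {u \<in> space (\<Pi>\<^sub>M i\<in>U. \<sigma>). \<bar>\<Sum>i\<in>U. (\<Sum>j<n. A i j * mask_out n U w j) * u i\<bar> \<le> \<beta>})"
  shows "measure ((\<Pi>\<^sub>M i\<in>U. \<sigma>) \<Otimes>\<^sub>M (\<Pi>\<^sub>M i\<in>V. \<sigma>))
        {p \<in> space ((\<Pi>\<^sub>M i\<in>U. \<sigma>) \<Otimes>\<^sub>M (\<Pi>\<^sub>M i\<in>V. \<sigma>)). \<bar>\<Sum>i\<in>U. \<Sum>j\<in>V. A i j * fst p i * snd p j\<bar> \<le> \<beta>}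
     = (\<integral>w. h w \<partial>W)" and "h \<in> borel_measurable W"
proof -
  interpret S: real_distribution \<sigma> by fact
  interpret pM: product_prob_space "\<lambda>_. \<sigma>" U ..
  interpret pN: product_prob_space "\<lambda>_. \<sigma>" V ..
  interpret pW: product_prob_space "\<lambda>_. \<sigma>" "{..<n}" ..
  define M where "M = (\<Pi>\<^sub>M i\<in>U. \<sigma>)"
  define N where "N = (\<Pi>\<^sub>M i\<in>V. \<sigma>)"
  have M: "prob_space M" and N: "prob_space N" unfolding M_def N_def
    by (rule pM.P.prob_space_axioms pN.P.prob_space_axioms)+
  have V: "finite U" "finite V" "V \<subseteq> {..<n}" using U by (auto simp: V_def intro: finite_subset)
  define E where "E = {p \<in> space (M \<Otimes>\<^sub>M N). \<bar>\<Sum>i\<in>U. \<Sum>j\<in>V. A i j * fst p i * snd p j\<bar> \<le> \<beta>}"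
  have E: "E \<in> sets (M \<Otimes>\<^sub>M N)"
  proof -
    have "(\<lambda>p. A i j * fst p i * snd p j) \<in> borel_measurable (M \<Otimes>\<^sub>M N)" if "i \<in> U" "j \<in> V" for i j
    proof -
      have [measurable]: "(\<lambda>u. u i) \<in> borel_measurable M" "(\<lambda>u. u j) \<in> borel_measurable N"
        unfolding M_def N_def using that by (intro measurable_component_PiM_borel; simp)+
      show ?thesis by measurable
    qed
    then have "(\<lambda>p. \<Sum>i\<in>U. \<Sum>j\<in>V. A i j * fst p i * snd p j) \<in> borel_measurable (M \<Otimes>\<^sub>M N)"
      by (intro borel_measurable_sum) auto
    then show ?thesis unfolding E_def by measurable
  qed
  define E' where "E' = {(x, y) \<in> space (N \<Otimes>\<^sub>M M). (y, x) \<in> E}"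
  have "E' = (\<lambda>(x, y). (y, x)) -` E \<inter> space (N \<Otimes>\<^sub>M M)" by (auto simp: E'_def)
  then have E': "E' \<in> sets (N \<Otimes>\<^sub>M M)" using measurable_sets[OF measurable_pair_swap' E] by simp
  define k where "k y = measure M (Pair y -` E')" for y
  note k = measure_pair_eq_integral[OF N M E', folded k_def]
  have Wr: "distr W N (\<lambda>w. restrict w V) = N"
    unfolding W_def N_def using V(3) by (intro pW.distr_restrict[symmetric]) auto
  have mr: "(\<lambda>w. restrict w V) \<in> W \<rightarrow>\<^sub>M N"
    unfolding W_def N_def using V(3) by (rule measurable_restrict_subset)
  have hk: "h w = k (restrict w V)" if w: "w \<in> space W" for w
  proof -
    have "(\<Sum>i\<in>U. \<Sum>j\<in>V. A i j * u i * restrict w V j) = (\<Sum>i\<in>U. (\<Sum>j<n. A i j * mask_out n U w j) * u i)" for u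
    proof (rule sum.cong[OF refl])
      fix i
      have "(\<Sum>j<n. A i j * mask_out n U w j) = (\<Sum>j\<in>V. A i j * w j)"
        by (rule sum.mono_neutral_cong_right) (auto simp: V_def mask_out_def)
      moreover have "(\<Sum>j\<in>V. A i j * u i * restrict w V j) = (\<Sum>j\<in>V. A i j * w j * u i)"
        by (rule sum.cong) auto
      ultimately show "(\<Sum>j\<in>V. A i j * u i * restrict w V j) = (\<Sum>j<n. A i j * mask_out n U w j) * u i"
        by (simp only: sum_distrib_right)
    qed
    moreover have "restrict w V \<in> space N" using measurable_space[OF mr w] .
    ultimately have "Pair (restrict w V) -` E' = {u \<in> space M. \<bar>\<Sum>i\<in>U. (\<Sum>j<n. A i j * mask_out n U w j) * u i\<bar> \<le> \<beta>}"
      by (auto simp: E'_def E_def space_pair_measure)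
    then show ?thesis by (simp add: h_def k_def M_def)
  qed
  have mk: "(\<lambda>w. k (restrict w V)) \<in> borel_measurable W" using measurable_compose[OF mr k(2)] .
  then show "h \<in> borel_measurable W" by (subst measurable_cong[OF hk]) auto
  have "measure (M \<Otimes>\<^sub>M N) E = measure (N \<Otimes>\<^sub>M M) E'" unfolding E'_def by (rule measure_pair_swap[OF M N E])
  also have "\<dots> = (\<integral>y. k y \<partial>N)" by (rule k(1))
  also have "\<dots> = (\<integral>y. k y \<partial>distr W N (\<lambda>w. restrict w V))" by (simp only: Wr)
  also have "\<dots> = (\<integral>w. k (restrict w V) \<partial>W)" by (rule integral_distr[OF mr k(2)])
  also have "\<dots> = (\<integral>w. h w \<partial>W)" by (intro Bochner_Integration.integral_cong refl) (simp add: hk)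
  finally show "measure ((\<Pi>\<^sub>M i\<in>U. \<sigma>) \<Otimes>\<^sub>M (\<Pi>\<^sub>M i\<in>V. \<sigma>))
        {p \<in> space ((\<Pi>\<^sub>M i\<in>U. \<sigma>) \<Otimes>\<^sub>M (\<Pi>\<^sub>M i\<in>V. \<sigma>)). \<bar>\<Sum>i\<in>U. \<Sum>j\<in>V. A i j * fst p i * snd p j\<bar> \<le> \<beta>}
     = (\<integral>w. h w \<partial>W)" unfolding E_def M_def N_def .
qed

text \<open>Reverse Markov inequality: the points with h < p / 2 contribute at most p / 2 to the
  mean, and the others at most their measure.\<close>

lemma measure_ge_half_integral:
  assumes "prob_space W" and h: "h \<in> borel_measurable W" "\<And>w. 0 \<le> h w" "\<And>w. h w \<le> (1 :: real)"
    and p: "p \<le> (\<integral>w. h w \<partial>W)" "0 \<le> p"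
  shows "p / 2 \<le> measure W {w \<in> space W. p / 2 \<le> h w}"
proof -
  interpret prob_space W by fact
  let ?G = "{w \<in> space W. p / 2 \<le> h w}"
  have G: "?G \<in> sets W" using h(1) by measurable
  have "p \<le> (\<integral>w. h w \<partial>W)" by fact
  also have "\<dots> \<le> (\<integral>w. indicator ?G w + p / 2 \<partial>W)"
  proof (rule integral_mono)
    show "integrable W h" using h by (auto intro!: integrable_const_bound[of _ 1])
    show "integrable W (\<lambda>w. indicator ?G w + p / 2)" using G by (intro Bochner_Integration.integrable_add) (auto simp: emeasure_eq_measure)
    fix w assume "w \<in> space W"
    then show "h w \<le> indicator ?G w + p / 2" using h(3)[of w] p(2) by (auto simp: indicator_def)
  qed
  also have "\<dots> = measure W ?G + p / 2" using G prob_space by (subst Bochner_Integration.integral_add) (auto simp: emeasure_eq_measure)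
  finally show ?thesis by simp
qed

section \<open>Inverse theorems\<close>

text \<open>Apply the inverse theorem to \<open>L i\<close> rescaled by y / (2
  \<open>\<beta>\<close>), where c1 \<le> |y|; undoing the scaling turns an error k^2 into at most
  k^2 * 2 \<open>\<beta>\<close> / c1. The coefficients change sign so that the relation has the
  shape of a row of the matrix R applied to \<open>L\<close>.\<close>

lemma linear_inverse:
  fixes L :: "'a \<Rightarrow> real"
  assumes adm: "admissible_law c1 c2 c3 \<mu>" and c: "0 < c1" "0 < c3" and U: "finite U" and \<beta>: "\<beta> > 0"
    and P: "0 < P" "P \<le> measure (\<Pi>\<^sub>M i\<in>U. diff_law \<mu>) {u \<in> space (\<Pi>\<^sub>M i\<in>U. diff_law \<mu>). \<bar>\<Sum>i\<in>U. L i * u i\<bar> \<le> \<beta>}"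
    and K: "K \<ge> 2" and M: "M > 0" "8 * real K ^ 3 \<le> c3 * real M"
  shows "\<exists>(k::nat) G bad r. 0 < k \<and> real k \<le> 400 / P\<^sup>2 \<and> 2 ^ r \<le> k \<and> K ^ card G \<le> k \<and>
     G \<subseteq> bad \<and> bad \<subseteq> U \<and> card bad \<le> Suc r * M \<and>
     (\<forall>i\<in>U - bad. \<exists>b::'a \<Rightarrow> int. (\<forall>h\<in>G. \<bar>real_of_int (b h)\<bar> \<le> real k * real k * real K) \<and>
        \<bar>real k * L i + (\<Sum>h\<in>G. real_of_int (b h) * L h)\<bar> \<le> real k * real k * (2 * \<beta> / c1))"
proof -
  have \<mu>: "real_distribution \<mu>" and c3: "c3 \<le> measure (\<mu> \<Otimes>\<^sub>M \<mu>) {(x, x'). c1 \<le> \<bar>x - x'\<bar> \<and> \<bar>x - x'\<bar> \<le> c2}"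
    using adm by (auto simp: admissible_law_def)
  interpret real_distribution \<mu> by fact
  define \<sigma> where "\<sigma> = diff_law \<mu>"
  define Gd where "Gd = {y::real. c1 \<le> \<bar>y\<bar> \<and> \<bar>y\<bar> \<le> c2}"
  have Gd: "Gd \<in> sets borel" unfolding Gd_def by measurable
  have d: "(\<lambda>(x, y). x - y) \<in> borel_measurable (\<mu> \<Otimes>\<^sub>M \<mu>)" by (rule diff_measurable) simp
  have "measure \<sigma> Gd = measure (\<mu> \<Otimes>\<^sub>M \<mu>) ((\<lambda>(x, y). x - y) -` Gd \<inter> space (\<mu> \<Otimes>\<^sub>M \<mu>))"
    unfolding \<sigma>_def diff_law_def by (rule measure_distr[OF d Gd])
  also have "(\<lambda>(x, y). x - y) -` Gd \<inter> space (\<mu> \<Otimes>\<^sub>M \<mu>) = {(x, x'). c1 \<le> \<bar>x - x'\<bar> \<and> \<bar>x - x'\<bar> \<le> c2}"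
    by (auto simp: Gd_def space_pair_measure)
  finally have c3': "c3 \<le> measure \<sigma> Gd" using c3 by simp
  have \<sigma>: "real_distribution \<sigma>" unfolding \<sigma>_def by (rule real_distribution_diff_law[OF \<mu>])
  have odd: "(\<integral>u. sin (t * u) \<partial>\<sigma>) = 0" for t unfolding \<sigma>_def by (rule diff_law_sin[OF \<mu>])
  have nn: "(\<integral>u. cos (t * u) \<partial>\<sigma>) \<ge> 0" for t unfolding \<sigma>_def diff_law_cos[OF \<mu>] by simp
  obtain y where y: "y \<in> Gd" and int: "exp (- 1 / 2) * measure (\<Pi>\<^sub>M i\<in>U. \<sigma>) {u \<in> space (\<Pi>\<^sub>M i\<in>U. \<sigma>). \<bar>\<Sum>i\<in>U. L i * u i\<bar> \<le> \<beta>}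
    \<le> (\<integral>g. exp (- (2 * c3) * (\<Sum>i\<in>U. (sin (L i * y / (2 * \<beta>) * g))\<^sup>2)) \<partial>gauss)"
    using small_ball_le_gauss_sin[OF \<sigma> U odd nn Gd c(2) c3' \<beta>, of L] by blast
  define P' where "P' = exp (- 1 / 2) * P"
  have P': "P' > 0" using P by (simp add: P'_def)
  define v where "v i = L i * y / (2 * \<beta>)" for i
  have "P' \<le> exp (- 1 / 2) * measure (\<Pi>\<^sub>M i\<in>U. \<sigma>) {u \<in> space (\<Pi>\<^sub>M i\<in>U. \<sigma>). \<bar>\<Sum>i\<in>U. L i * u i\<bar> \<le> \<beta>}"
    unfolding P'_def \<sigma>_def using P(2) by (intro mult_left_mono) auto
  also note int
  finally have intP: "P' \<le> (\<integral>g. exp (- (2 * c3) * (\<Sum>i\<in>U. (sin (v i * g))\<^sup>2)) \<partial>gauss)" by (simp add: v_def)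
  have MK: "16 * real K ^ 3 \<le> 2 * c3 * real M" using M by simp
  have q: "2 * c3 > 0" using c by simp
  obtain k G bad r where k: "0 < k" "real k \<le> 144 / P'\<^sup>2" "2 ^ r \<le> k" "K ^ card G \<le> k"
     "G \<subseteq> bad" "bad \<subseteq> U" "card bad \<le> Suc r * M"
    and rel: "\<forall>i\<in>U - bad. \<exists>b::'a \<Rightarrow> int. (\<forall>h\<in>G. \<bar>real_of_int (b h)\<bar> \<le> real k * real k * real K) \<and>
        \<bar>real k * v i - (\<Sum>h\<in>G. real_of_int (b h) * v h)\<bar> \<le> real k * real k"
    using inverse_gauss_sin[OF U M(1) q K MK P' intP] by blast
  \<comment> \<open>The smoothing factor exp (-1/2), once squared, costs a factor e, and 144 e <
    400.\<close>
  have "P'\<^sup>2 = P\<^sup>2 / exp 1"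
    by (simp add: P'_def power_mult_distrib exp_minus field_simps flip: exp_double exp_of_nat_mult)
  then have "144 / P'\<^sup>2 = 144 * exp 1 / P\<^sup>2" by simp
  also have "\<dots> \<le> 400 / P\<^sup>2" using e_less_272 by (intro divide_right_mono) auto
  finally have kP: "real k \<le> 400 / P\<^sup>2" using k by simp
  have y1: "\<bar>y\<bar> \<ge> c1" "y \<noteq> 0" using y c by (auto simp: Gd_def)
  have "\<exists>b::'a \<Rightarrow> int. (\<forall>h\<in>G. \<bar>real_of_int (b h)\<bar> \<le> real k * real k * real K) \<and>
        \<bar>real k * L i + (\<Sum>h\<in>G. real_of_int (b h) * L h)\<bar> \<le> real k * real k * (2 * \<beta> / c1)" if i: "i \<in> U - bad" for i
  proof -
    obtain b :: "'a \<Rightarrow> int" where b: "\<forall>h\<in>G. \<bar>real_of_int (b h)\<bar> \<le> real k * real k * real K"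
        "\<bar>real k * v i - (\<Sum>h\<in>G. real_of_int (b h) * v h)\<bar> \<le> real k * real k" using rel i by blast
    have Lv: "L j = (2 * \<beta> / y) * v j" for j using y1 \<beta> by (simp add: v_def)
    have "real k * L i + (\<Sum>h\<in>G. real_of_int (- b h) * L h) = (2 * \<beta> / y) * (real k * v i - (\<Sum>h\<in>G. real_of_int (b h) * v h))"
      unfolding Lv right_diff_distrib sum_distrib_left by (simp add: sum_negf mult_ac)
    also have "\<bar>\<dots>\<bar> = (2 * \<beta> / \<bar>y\<bar>) * \<bar>real k * v i - (\<Sum>h\<in>G. real_of_int (b h) * v h)\<bar>"
      using \<beta> by (simp add: abs_mult)
    also have "\<dots> \<le> (2 * \<beta> / c1) * (real k * real k)"
      using b(2) \<beta> y1 c by (intro mult_mono divide_left_mono mult_pos_pos) auto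
    finally have "\<bar>real k * L i + (\<Sum>h\<in>G. real_of_int (- b h) * L h)\<bar> \<le> real k * real k * (2 * \<beta> / c1)"
      by (simp only: mult.commute)
    moreover have "\<forall>h\<in>G. \<bar>real_of_int (- b h)\<bar> \<le> real k * real k * real K" using b(1) by simp
    ultimately show ?thesis by (intro exI[of _ "\<lambda>h. - b h"] conjI)
  qed
  then show ?thesis using k kP by blast
qed

section \<open>Averaging over index subsets and pigeonholing\<close>

text \<open>Exponential moment bound with weight 3 to the power -|U \<inter> J|. Its sum over all
  \<open>U\<close> is 2^n (2/3)^|J|, while a set with a small trace weighs at least (20/27)^|J|,
  since (20/27)^4 \<le> 1/3. The quotient of 2/3 by 20/27 is 9/10.\<close>

lemma card_small_trace_le:
  assumes J: "J \<subseteq> {..<n}"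
  shows "real (card {U \<in> Pow {..<n}. 4 * card (U \<inter> J) \<le> card J}) \<le> 2 ^ n * (9 / 10) ^ card J"
proof -
  define B where "B = {U \<in> Pow {..<n}. 4 * card (U \<inter> J) \<le> card J}"
  have fJ: "finite J" using J by (auto intro: finite_subset)
  have "real (card B) * (20 / 27) ^ card J = (\<Sum>U\<in>B. (20 / 27) ^ card J)" by simp
  also have "\<dots> \<le> (\<Sum>U\<in>B. (1 / 3) ^ card (U \<inter> J))"
  proof (rule sum_mono)
    fix U assume "U \<in> B"
    then have "4 * card (U \<inter> J) \<le> card J" by (simp add: B_def)
    then have "(20 / 27 :: real) ^ card J \<le> (20 / 27) ^ (4 * card (U \<inter> J))" by (rule power_decreasing) auto
    also have "\<dots> = ((20 / 27) ^ 4) ^ card (U \<inter> J)" by (rule power_mult)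
    also have "\<dots> \<le> (1 / 3) ^ card (U \<inter> J)" by (rule power_mono) (auto simp: eval_nat_numeral)
    finally show "(20 / 27 :: real) ^ card J \<le> (1 / 3) ^ card (U \<inter> J)" .
  qed
  also have "\<dots> \<le> (\<Sum>U\<in>Pow {..<n}. (1 / 3) ^ card (U \<inter> J))"
    by (rule sum_mono2) (auto simp: B_def)
  also have "\<dots> = (\<Sum>U\<in>Pow {..<n}. (\<Prod>i\<in>U. if i \<in> J then 1 / 3 else 1) * (\<Prod>i\<in>{..<n}-U. 1))"
    by (intro sum.cong refl) (auto simp: prod.If_cases finite_subset Int_def)
  also have "\<dots> = (\<Prod>i<n. (if i \<in> J then 1 / 3 else 1) + 1)" by (subst prod_add) auto
  also have "\<dots> = (\<Prod>i<n. 2 * (if i \<in> J then 2 / 3 else 1 :: real))" by (rule prod.cong) auto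
  also have "\<dots> = 2 ^ n * (2 / 3) ^ card J"
    using J by (simp add: prod.distrib prod.If_cases Int_absorb1)
  finally have le: "real (card B) * (20 / 27) ^ card J \<le> 2 ^ n * (2 / 3) ^ card J" .
  have "(2 / 3 :: real) ^ card J = (9 / 10) ^ card J * (20 / 27) ^ card J"
    by (simp flip: power_mult_distrib)
  with le have "real (card B) * (20 / 27) ^ card J \<le> (2 ^ n * (9 / 10) ^ card J) * (20 / 27) ^ card J" by simp
  then show ?thesis unfolding B_def by (simp add: mult_le_cancel_right)
qed

text \<open>The datum \<open>x\<close> (later the pair of \<open>I\<^sub>0\<close> and k) is chosen
  first, as the most frequent one over all pairs (\<open>U\<close>, \<open>w\<close>). Structure for
  \<open>x\<close> concerns only i in \<open>U\<close>, up to \<open>e0\<close> exceptions. If the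
  set \<open>J\<close> of rows that rarely take part were large, a typical \<open>U\<close> would
  contain a quarter of it and lose only few of these rows, contradicting rarity. For each remaining
  row a second pigeonhole, over \<open>Ks x\<close>, fixes the coefficients.\<close>

lemma pigeonhole_subsets:
  fixes T :: "nat set \<Rightarrow> 'w \<Rightarrow> nat \<Rightarrow> 'x \<Rightarrow> 'k \<Rightarrow> bool"
  assumes W: "prob_space W" and Idx: "finite Idx" and Ks: "\<And>x. x \<in> Idx \<Longrightarrow> finite (Ks x)"
      "\<And>x. x \<in> Idx \<Longrightarrow> real (card (Ks x)) \<le> \<kappa>"
    and meas: "\<And>U i x K. U \<subseteq> {..<n} \<Longrightarrow> i < n \<Longrightarrow> x \<in> Idx \<Longrightarrow> K \<in> Ks x \<Longrightarrow> {w \<in> space W. T U w i x K} \<in> sets W"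
    and good: "\<And>U. U \<subseteq> {..<n} \<Longrightarrow> Gd U \<in> sets W" "\<And>U. U \<subseteq> {..<n} \<Longrightarrow> \<theta> \<le> measure W (Gd U)"
    and struct: "\<And>U w. U \<subseteq> {..<n} \<Longrightarrow> w \<in> Gd U \<Longrightarrow>
        \<exists>x\<in>Idx. real (card {i \<in> U. \<not> (\<exists>K\<in>Ks x. T U w i x K)}) \<le> e0"
    and \<theta>: "\<theta> > 0" and e0: "16 * e0 \<le> j0"
    and j0: "\<And>m. real m \<ge> j0 \<Longrightarrow> 4 * (9 / 10) ^ m * real (card Idx) \<le> \<theta>" "j0 > 0"
  shows "\<exists>x\<in>Idx. \<exists>J\<subseteq>{..<n}. real (card J) \<le> j0 \<and>
      (\<forall>i\<in>{..<n} - J. \<exists>K\<in>Ks x. \<theta> / (8 * real (card Idx) * \<kappa>) * 2 ^ n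
         \<le> (\<Sum>U\<in>Pow {..<n}. measure W {w \<in> space W. T U w i x K}))"
proof -
  interpret prob_space W by fact
  define I where "I U x i = {w \<in> space W. \<exists>K\<in>Ks x. T U w i x K}" for U x i
  have I: "I U x i \<in> sets W" if "U \<subseteq> {..<n}" "i < n" "x \<in> Idx" for U x i
  proof -
    have "I U x i = (\<Union>K\<in>Ks x. {w \<in> space W. T U w i x K})" by (auto simp: I_def)
    also have "\<dots> \<in> sets W" using Ks(1)[OF that(3)] meas that by (intro sets.finite_UN) auto
    finally show ?thesis .
  qed
  \<comment> \<open>The sum counts the elements of \<open>U\<close> for which no admissible
    coefficients exist; indicators make the measurability of this count evident.\<close>
  define E where "E x U = {w \<in> space W. (\<Sum>i\<in>U. 1 - indicator (I U x i) w) \<le> e0}" for x U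
  have E: "E x U \<in> sets W" if "U \<subseteq> {..<n}" "x \<in> Idx" for x U
  proof -
    have "(\<lambda>w. \<Sum>i\<in>U. 1 - indicator (I U x i) w :: real) \<in> borel_measurable W"
      using I that by (intro borel_measurable_sum borel_measurable_diff borel_measurable_const borel_measurable_indicator) auto
    then show ?thesis unfolding E_def by measurable
  qed
  have cardE: "(\<Sum>i\<in>U. 1 - indicator (I U x i) w :: real) = real (card {i \<in> U. \<not> (\<exists>K\<in>Ks x. T U w i x K)})"
    if "finite U" "w \<in> space W" for U x w
  proof -
    have "(\<Sum>i\<in>U. 1 - indicator (I U x i) w :: real) = (\<Sum>i\<in>U. if \<not> (\<exists>K\<in>Ks x. T U w i x K) then 1 else 0)"
      using that by (intro sum.cong) (auto simp: I_def indicator_def)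
    also have "\<dots> = real (card {i \<in> U. \<not> (\<exists>K\<in>Ks x. T U w i x K)})"
      using that by (simp add: sum.If_cases Int_def)
    finally show ?thesis .
  qed
  have PowN: "card (Pow {..<n}) = 2 ^ n" by (simp add: card_Pow)
  have cov: "\<theta> \<le> (\<Sum>x\<in>Idx. measure W (E x U))" if U: "U \<subseteq> {..<n}" for U
  proof -
    have fU: "finite U" using U by (auto intro: finite_subset)
    have "Gd U \<subseteq> (\<Union>x\<in>Idx. E x U)"
    proof
      fix w assume w: "w \<in> Gd U"
      then have sw: "w \<in> space W" using good(1)[OF U] sets.sets_into_space by blast
      obtain x where "x \<in> Idx" "real (card {i \<in> U. \<not> (\<exists>K\<in>Ks x. T U w i x K)}) \<le> e0"
        using struct[OF U w] by blast
      then show "w \<in> (\<Union>x\<in>Idx. E x U)" using sw fU by (auto simp: E_def cardE)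
    qed
    then have "measure W (Gd U) \<le> measure W (\<Union>x\<in>Idx. E x U)"
      using E U Idx by (intro finite_measure_mono sets.finite_UN) auto
    also have "\<dots> \<le> (\<Sum>x\<in>Idx. measure W (E x U))"
      using E U Idx by (intro finite_measure_subadditive_finite) auto
    finally show ?thesis using good(2)[OF U] by simp
  qed
  have ne: "Idx \<noteq> {}" using cov[of "{}"] \<theta> by auto
  have cI: "real (card Idx) > 0" using ne Idx by (simp add: card_gt_0_iff)
  have "\<exists>x\<in>Idx. \<theta> / real (card Idx) * 2 ^ n \<le> (\<Sum>U\<in>Pow {..<n}. measure W (E x U))"
  proof (rule ccontr)
    assume "\<not> ?thesis"
    then have "(\<Sum>x\<in>Idx. \<Sum>U\<in>Pow {..<n}. measure W (E x U)) < (\<Sum>x\<in>Idx. \<theta> / real (card Idx) * 2 ^ n)"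
      using ne Idx by (intro sum_strict_mono) (auto simp: not_le)
    also have "\<dots> = \<theta> * 2 ^ n" using cI by simp
    also have "\<dots> = (\<Sum>U\<in>Pow {..<n}. \<theta>)" by (simp add: PowN)
    also have "\<dots> \<le> (\<Sum>U\<in>Pow {..<n}. \<Sum>x\<in>Idx. measure W (E x U))" by (intro sum_mono cov) auto
    also have "\<dots> = (\<Sum>x\<in>Idx. \<Sum>U\<in>Pow {..<n}. measure W (E x U))" by (rule sum.swap)
    finally show False by simp
  qed
  then obtain x where x: "x \<in> Idx" and \<Gamma>ge: "\<theta> / real (card Idx) * 2 ^ n \<le> (\<Sum>U\<in>Pow {..<n}. measure W (E x U))" by blast
  let ?F = "\<lambda>U i. E x U \<inter> I U x i \<inter> (if i \<in> U then space W else {})"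
  define \<Gamma> where "\<Gamma> = (\<Sum>U\<in>Pow {..<n}. measure W (E x U))"
  have \<Gamma>: "\<theta> / real (card Idx) * 2 ^ n \<le> \<Gamma>" using \<Gamma>ge by (simp add: \<Gamma>_def)
  have \<Gamma>0: "\<Gamma> > 0" by (rule less_le_trans[OF _ \<Gamma>]) (use \<theta> cI in simp)
  \<comment> \<open>\<open>\<Gamma>\<close> is the total mass of the structured pairs; the rows in
    \<open>J\<close> are those that take part, as elements of \<open>U\<close>, in less than an
    eighth of it.\<close>
  define J where "J = {i \<in> {..<n}. (\<Sum>U\<in>Pow {..<n}. measure W (?F U i)) < \<Gamma> / 8}"
  have J: "J \<subseteq> {..<n}" "finite J" by (auto simp: J_def)
  have cJ: "real (card J) \<le> j0"
  proof (rule ccontr)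
    assume "\<not> real (card J) \<le> j0"
    then have big: "real (card J) > j0" by simp
    define B where "B = {U \<in> Pow {..<n}. 4 * card (U \<inter> J) \<le> card J}"
    \<comment> \<open>The sets \<open>U\<close> containing at most a quarter of \<open>J\<close>
      carry at most a quarter of \<open>\<Gamma>\<close>, as there are too few of them.\<close>
    have Bn: "real (card B) \<le> \<Gamma> / 4"
    proof -
      have "real (card B) \<le> 2 ^ n * (9 / 10) ^ card J" unfolding B_def by (rule card_small_trace_le[OF J(1)])
      also have "(9 / 10) ^ card J \<le> \<theta> / real (card Idx) / 4"
        using j0(1)[of "card J"] big cI by (simp add: field_simps)
      also have "2 ^ n * (\<theta> / real (card Idx) / 4) \<le> \<Gamma> / 4" using \<Gamma> by (simp add: mult.commute)
      finally show ?thesis by simp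
    qed
    have slice: "(real (card J) / 4 - e0) * measure W (E x U) \<le> (\<Sum>i\<in>J. measure W (?F U i))"
      if U: "U \<in> Pow {..<n} - B" for U
    proof -
      have UU: "U \<subseteq> {..<n}" "finite U" "real (card J) / 4 \<le> real (card (U \<inter> J))" using U by (auto simp: B_def intro: finite_subset)
      have sets: "?F U i \<in> sets W" if "i \<in> J" for i
        using E[OF UU(1) x] I[OF UU(1) _ x] that J by auto
      have "(real (card J) / 4 - e0) * measure W (E x U) = (\<integral>w. (real (card J) / 4 - e0) * indicator (E x U) w \<partial>W)"
        using E[OF UU(1) x] by simp
      also have "\<dots> \<le> (\<integral>w. (\<Sum>i\<in>J. indicator (?F U i) w) \<partial>W)"
      proof (rule integral_mono)
        show "integrable W (\<lambda>w. (real (card J) / 4 - e0) * indicator (E x U) w)"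
          using E[OF UU(1) x] by (auto simp: emeasure_eq_measure)
        show "integrable W (\<lambda>w. \<Sum>i\<in>J. indicator (?F U i) w :: real)"
          using sets by (intro Bochner_Integration.integrable_sum integrable_real_indicator) (auto simp: emeasure_eq_measure)
        fix w assume w: "w \<in> space W"
        show "(real (card J) / 4 - e0) * indicator (E x U) w \<le> (\<Sum>i\<in>J. indicator (?F U i) w)"
        proof (cases "w \<in> E x U")
          case True
          have "(\<Sum>i\<in>J. indicator (?F U i) w :: real) = (\<Sum>i\<in>U \<inter> J. indicator (I U x i) w)"
            using J(2) True w by (intro sum.mono_neutral_cong_right) (auto simp: indicator_def)
          moreover have "(\<Sum>i\<in>U \<inter> J. 1 - indicator (I U x i) w :: real) \<le> (\<Sum>i\<in>U. 1 - indicator (I U x i) w)"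
            using UU(2) by (intro sum_mono2) (auto simp: indicator_def)
          moreover have "(\<Sum>i\<in>U. 1 - indicator (I U x i) w :: real) \<le> e0" using True by (simp add: E_def)
          ultimately show ?thesis using True UU(3) by (simp add: sum_subtractf)
        next
          case False
          then show ?thesis by (simp add: sum_nonneg)
        qed
      qed
      also have "\<dots> = (\<Sum>i\<in>J. measure W (?F U i))"
        using sets by (subst Bochner_Integration.integral_sum) (auto simp: emeasure_eq_measure)
      finally show ?thesis .
    qed
    \<comment> \<open>A quarter of \<open>J\<close> less the exceptions leaves 1/4 - 1/16 = 3/16 of
      it. With 3/4 of the mass this gives the fraction 9/64, which exceeds the 1/8 allowed by the
      definition of \<open>J\<close>.\<close>
    have fact1: "real (card J) * (3 / 16) \<le> real (card J) / 4 - e0" using big e0 by simp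
    have "\<Gamma> - \<Gamma> / 4 \<le> \<Gamma> - real (card B)" using Bn by simp
    also have "\<dots> \<le> (\<Sum>U\<in>Pow {..<n} - B. measure W (E x U))"
    proof -
      have "\<Gamma> = (\<Sum>U\<in>Pow {..<n} - B. measure W (E x U)) + (\<Sum>U\<in>B. measure W (E x U))"
        unfolding \<Gamma>_def by (rule sum.subset_diff) (auto simp: B_def)
      moreover have "(\<Sum>U\<in>B. measure W (E x U)) \<le> (\<Sum>U\<in>B. 1)" by (intro sum_mono) simp
      ultimately show ?thesis by simp
    qed
    finally have "real (card J) * (3 / 16) * (\<Gamma> * (3 / 4)) \<le> real (card J) * (3 / 16) * (\<Sum>U\<in>Pow {..<n} - B. measure W (E x U))"
      by (intro mult_left_mono) auto
    also have "\<dots> \<le> (real (card J) / 4 - e0) * (\<Sum>U\<in>Pow {..<n} - B. measure W (E x U))"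
      using fact1 by (intro mult_right_mono sum_nonneg) auto
    also have "\<dots> \<le> (\<Sum>U\<in>Pow {..<n} - B. \<Sum>i\<in>J. measure W (?F U i))"
      unfolding sum_distrib_left by (intro sum_mono slice)
    also have "\<dots> \<le> (\<Sum>U\<in>Pow {..<n}. \<Sum>i\<in>J. measure W (?F U i))"
      by (intro sum_mono2 sum_nonneg) auto
    also have "\<dots> = (\<Sum>i\<in>J. \<Sum>U\<in>Pow {..<n}. measure W (?F U i))"
      by (rule sum.swap)
    also have "\<dots> \<le> (\<Sum>i\<in>J. \<Gamma> / 8)" by (intro sum_mono) (auto simp: J_def)
    also have "\<dots> = real (card J) * (\<Gamma> / 8)" by simp
    finally have "real (card J) * \<Gamma> * (9 / 64) \<le> real (card J) * \<Gamma> * (8 / 64)" by simp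
    moreover have "real (card J) * \<Gamma> > 0" using \<Gamma>0 big j0(2) by simp
    ultimately show False by linarith
  qed
  have "\<exists>K\<in>Ks x. \<theta> / (8 * real (card Idx) * \<kappa>) * 2 ^ n \<le> (\<Sum>U\<in>Pow {..<n}. measure W {w \<in> space W. T U w i x K})"
    if i: "i \<in> {..<n} - J" for i
  proof (rule ccontr)
    assume neg: "\<not> ?thesis"
    have "\<Gamma> / 8 \<le> (\<Sum>U\<in>Pow {..<n}. measure W (?F U i))"
      using i by (auto simp: J_def)
    also have "\<dots> \<le> (\<Sum>U\<in>Pow {..<n}. \<Sum>K\<in>Ks x. measure W {w \<in> space W. T U w i x K})"
    proof (rule sum_mono)
      fix U assume U: "U \<in> Pow {..<n}"
      have UN: "(\<Union>K\<in>Ks x. {w \<in> space W. T U w i x K}) \<in> sets W"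
        using meas U i x Ks(1)[OF x] by (intro sets.finite_UN) auto
      have "measure W (?F U i) \<le> measure W (\<Union>K\<in>Ks x. {w \<in> space W. T U w i x K})"
        by (rule finite_measure_mono[OF _ UN]) (auto simp: I_def split: if_splits)
      also have "\<dots> \<le> (\<Sum>K\<in>Ks x. measure W {w \<in> space W. T U w i x K})"
        using meas U i x Ks(1)[OF x] by (intro finite_measure_subadditive_finite) auto
      finally show "measure W (?F U i) \<le> (\<Sum>K\<in>Ks x. measure W {w \<in> space W. T U w i x K})" .
    qed
    also have "\<dots> = (\<Sum>K\<in>Ks x. \<Sum>U\<in>Pow {..<n}. measure W {w \<in> space W. T U w i x K})" by (rule sum.swap)
    finally have s: "\<Gamma> / 8 \<le> (\<Sum>K\<in>Ks x. \<Sum>U\<in>Pow {..<n}. measure W {w \<in> space W. T U w i x K})" .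
    then have neK: "Ks x \<noteq> {}" using \<Gamma>0 by auto
    then have ck: "0 < real (card (Ks x))" using Ks(1)[OF x] by (simp add: card_gt_0_iff)
    have \<kappa>: "\<kappa> > 0" using ck Ks(2)[OF x] by linarith
    have "(\<Sum>K\<in>Ks x. \<Sum>U\<in>Pow {..<n}. measure W {w \<in> space W. T U w i x K}) < (\<Sum>K\<in>Ks x. \<theta> / (8 * real (card Idx) * \<kappa>) * 2 ^ n)"
      using neg neK Ks(1)[OF x] by (intro sum_strict_mono) (auto simp: not_le)
    also have "\<dots> = real (card (Ks x)) * (\<theta> / (8 * real (card Idx) * \<kappa>) * 2 ^ n)" by simp
    also have "\<dots> \<le> \<kappa> * (\<theta> / (8 * real (card Idx) * \<kappa>) * 2 ^ n)"
      using Ks(2)[OF x] \<theta> cI \<kappa> by (intro mult_right_mono) auto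
    also have "\<dots> = (\<theta> / real (card Idx) * 2 ^ n) / 8" using \<kappa> cI by (simp add: field_simps)
    also have "\<dots> \<le> \<Gamma> / 8" using \<Gamma> by simp
    finally show False using s by simp
  qed
  then show ?thesis using x J cJ by blast
qed

section \<open>Assembly for large n\<close>

text \<open>Identifies the form in the theorem with the relation from the linear inverse theorem.
  With \<open>i\<close> outside \<open>I\<^sub>0\<close> the diagonal entry and the coefficients on
  \<open>I\<^sub>0\<close> occupy different columns.\<close>

lemma combination_mat_row_prod:
  fixes A :: "real mat" and z :: "nat \<Rightarrow> real"
  assumes A: "A \<in> carrier_mat n n" and i: "i \<in> I" "i < n" "i \<notin> I\<^sub>0" and I\<^sub>0: "I\<^sub>0 \<subseteq> {..<n}"
  shows "scalar_prod (vec n z) (row (combination_mat n I I\<^sub>0 k K * A) i) =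
    of_int k * (\<Sum>l<n. A $$ (i, l) * z l) + (\<Sum>h\<in>I\<^sub>0. of_int (K i h) * (\<Sum>l<n. A $$ (h, l) * z l))"
proof -
  define R where "R = combination_mat n I I\<^sub>0 k K"
  define L where "L j = (\<Sum>l<n. A $$ (j, l) * z l)" for j
  have fin: "finite I\<^sub>0" using I\<^sub>0 by (auto intro: finite_subset)
  have R: "R \<in> carrier_mat n n" by (simp add: R_def combination_mat_def)
  have Rij: "R $$ (i, j) = (if j = i then of_int k else if j \<in> I\<^sub>0 then of_int (K i j) else 0)" if "j < n" for j
    using that i by (simp add: R_def combination_mat_def)
  have "scalar_prod (vec n z) (row (R * A) i) = (\<Sum>l<n. z l * (\<Sum>j<n. R $$ (i, j) * A $$ (j, l)))"
    using A R i by (auto simp: scalar_prod_def atLeast0LessThan intro!: sum.cong)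
  also have "\<dots> = (\<Sum>j<n. R $$ (i, j) * L j)"
    unfolding L_def sum_distrib_left by (subst sum.swap) (simp add: mult_ac)
  also have "\<dots> = (\<Sum>j\<in>insert i I\<^sub>0. R $$ (i, j) * L j)"
    using i I\<^sub>0 by (intro sum.mono_neutral_right) (auto simp: Rij)
  also have "\<dots> = of_int k * L i + (\<Sum>h\<in>I\<^sub>0. R $$ (i, h) * L h)"
    using fin i by (simp add: Rij)
  also have "(\<Sum>h\<in>I\<^sub>0. R $$ (i, h) * L h) = (\<Sum>h\<in>I\<^sub>0. of_int (K i h) * L h)"
    using i I\<^sub>0 by (intro sum.cong refl) (auto simp: Rij subset_iff)
  finally show ?thesis by (simp add: R_def L_def)
qed

lemma borel_measurable_linear_comp:
  "(\<lambda>z. \<Sum>l<n. c l * z l) \<in> borel_measurable (\<Pi>\<^sub>M i\<in>{..<n}. (borel :: real measure))"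
  by (intro borel_measurable_sum borel_measurable_times borel_measurable_const measurable_component_PiM_borel) auto

lemma powr_pow_eq: "0 < (x::real) \<Longrightarrow> (x powr a) ^ m = x powr (a * real m)"
  by (simp add: powr_powr flip: powr_realpow)

lemma sum_powers_le: "(\<Sum>i\<le>d. n ^ i) \<le> (n + 1 :: nat) ^ d"
proof (induction d)
  case (Suc d)
  have "n ^ Suc d \<le> n * (n + 1) ^ d" by (simp add: power_mono)
  with Suc have "(\<Sum>i\<le>d. n ^ i) + n ^ Suc d \<le> (n + 1) ^ d + n * (n + 1) ^ d" by (rule add_mono)
  then show ?case by simp
qed simp

lemma card_bounded_subsets_le:
  "card {X. X \<subseteq> {..<n} \<and> card X \<le> d} \<le> (n + 1) ^ d"
proof -
  let ?L = "{xs. set xs \<subseteq> {..<n} \<and> length xs \<le> d}"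
  have fin: "finite ?L" by (rule finite_lists_length_le) simp
  have "{X. X \<subseteq> {..<n} \<and> card X \<le> d} \<subseteq> set ` ?L"
  proof
    fix X assume X: "X \<in> {X. X \<subseteq> {..<n} \<and> card X \<le> d}"
    then have "finite X" by (auto intro: finite_subset)
    then obtain xs where "set xs = X" "length xs = card X" using finite_distinct_list distinct_card by metis
    then show "X \<in> set ` ?L" using X by (intro image_eqI[of _ _ xs]) auto
  qed
  then have "card {X. X \<subseteq> {..<n} \<and> card X \<le> d} \<le> card ?L" by (rule surj_card_le[OF fin])
  also have "\<dots> = (\<Sum>i\<le>d. n ^ i)" using card_lists_length_le[of "{..<n}" d] by simp
  also have "\<dots> \<le> (n + 1) ^ d" by (rule sum_powers_le)
  finally show ?thesis .
qed

text \<open>The supremum over \<open>a\<close> need not be a maximum; halving the bound ensures a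
  centre that reaches it.\<close>

lemma quad_concentration_attained:
  assumes \<mu>: "real_distribution \<mu>" and q: "q \<le> quad_concentration n \<mu> A f \<beta>" and q0: "q > 0"
  shows "\<exists>a. q / 2 \<le> measure (iid_law n \<mu>)
        {x \<in> space (iid_law n \<mu>). \<bar>(\<Sum>i<n. \<Sum>j<n. A $$ (i, j) * (x i + f i) * (x j + f j)) - a\<bar> \<le> \<beta>}"
proof (rule ccontr)
  assume "\<not> ?thesis"
  then have "quad_concentration n \<mu> A f \<beta> \<le> q / 2"
    unfolding quad_concentration_def by (intro cSUP_least) (auto simp: not_le less_imp_le)
  with q q0 show False by simp
qed

text \<open>With N = n, halving for the supremum, the fourth power from decoupling and the
  restriction to good \<open>w\<close> give \<theta> = N^(-4B) / 32. Then k \<le> 400 / \<theta>^2 =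
  409600 N^(8B) \<le> N^D. The numerical conditions on n say in turn that this constant and 4 /
  \<open>c1\<close> are absorbed by one factor N, that K \<le> N, that the bad sets are small
  compared with N^\<epsilon>, and that the tail (9/10)^(N^\<epsilon>) beats the number of candidates
  for (\<open>I\<^sub>0\<close>, k).\<close>

lemma quadratic_inverse_large:
  fixes \<epsilon> B c1 c2 c3 \<beta> D :: real and A :: "real mat" and n d :: nat
  assumes \<epsilon>: "0 < \<epsilon>" and B: "0 < B" and c: "0 < c1" "0 < c3" and \<beta>: "\<beta> > 0"
    and adm: "admissible_law c1 c2 c3 \<mu>" and A: "A \<in> carrier_mat n n"
    and sym: "\<forall>i<n. \<forall>j<n. A $$ (i, j) = A $$ (j, i)"
    and conc: "quad_concentration n \<mu> A f \<beta> \<ge> real n powr (- B)"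
    and D: "D = 8 * B + 1" and d: "8 * D / \<epsilon> \<le> real d"
    and n1: "409600 \<le> real n" and n2: "4 / c1 \<le> real n" and n3: "real n powr (\<epsilon> / 8) + 1 \<le> real n"
    and n4: "16 * ((D * log 2 (real n) + 1) * (8 * (real n powr (\<epsilon> / 8) + 1) ^ 3 / c3 + 1)) \<le> real n powr \<epsilon>"
    and n5: "4 * (9 / 10) powr (real n powr \<epsilon>) * real n powr (2 * real d + D) \<le> real n powr (- 4 * B) / 32"
  shows "\<exists>(I\<^sub>0::nat set) (I::nat set) (k::int) (K::nat \<Rightarrow> nat \<Rightarrow> int).
       I\<^sub>0 \<subseteq> {..<n} \<and> card I\<^sub>0 \<le> d \<and>
       I \<subseteq> {..<n} \<and> real (card I) \<ge> real n - real n powr \<epsilon> \<and>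
       k \<noteq> 0 \<and> real_of_int \<bar>k\<bar> \<le> real n powr D \<and>
       (\<forall>i\<in>I. \<forall>i\<^sub>0\<in>I\<^sub>0. real_of_int \<bar>K i i\<^sub>0\<bar> \<le> real n powr (2 * D + 1)) \<and>
       (let A' = combination_mat n I I\<^sub>0 k K * A; \<nu> = iid_law n (lazy_diff_law \<mu>) in
         \<forall>i\<in>I. measure \<nu> {z \<in> space \<nu>. \<bar>scalar_prod (vec n z) (row A' i)\<bar> \<le> \<beta> * real n powr (2 * D + 1)}
                 \<ge> real n powr (- (4 * B + (2 * real d + D) + (2 * D + 3) * real d + 1)))"
proof -
  define N where "N = real n"
  have N: "N \<ge> 409600" "N > 1" "N > 0" using n1 by (auto simp: N_def)
  have \<mu>: "real_distribution \<mu>" using adm by (simp add: admissible_law_def)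
  define \<sigma> where "\<sigma> = diff_law \<mu>"
  have \<sigma>: "real_distribution \<sigma>" unfolding \<sigma>_def by (rule real_distribution_diff_law[OF \<mu>])
  interpret \<sigma>: real_distribution \<sigma> by (rule \<sigma>)
  interpret pW: product_prob_space "\<lambda>_. \<sigma>" "{..<n}" ..
  define W where "W = (\<Pi>\<^sub>M i\<in>{..<n}. \<sigma>)"
  have W: "prob_space W" unfolding W_def by (rule pW.P.prob_space_axioms)
  have D1: "D > 1" using B D by simp
  define L where "L z i = (\<Sum>l<n. A $$ (i, l) * z l)" for z :: "nat \<Rightarrow> real" and i
  define p where "p = N powr (- B) / 2"
  have p0: "p > 0" using N by (simp add: p_def)
  obtain a where a: "p \<le> measure (iid_law n \<mu>)
        {x \<in> space (iid_law n \<mu>). \<bar>(\<Sum>i<n. \<Sum>j<n. A $$ (i, j) * (x i + f i) * (x j + f j)) - a\<bar> \<le> \<beta>}"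
    using quad_concentration_attained[OF \<mu> conc] N by (auto simp: p_def N_def)
  define \<theta> where "\<theta> = p ^ 4 / 2"
  have \<theta>0: "\<theta> > 0" using p0 by (simp add: \<theta>_def)
  have "(N powr (- B)) ^ 4 = N powr (- 4 * B)" using N by (simp add: powr_pow_eq mult.commute)
  then have \<theta>: "\<theta> = N powr (- 4 * B) / 32" by (simp add: \<theta>_def p_def power_divide)
  define h where "h U w = measure (\<Pi>\<^sub>M i\<in>U. \<sigma>) {u \<in> space (\<Pi>\<^sub>M i\<in>U. \<sigma>). \<bar>\<Sum>i\<in>U. L (mask_out n U w) i * u i\<bar> \<le> 2 * \<beta>}" for U w
  define Gd where "Gd U = {w \<in> space W. \<theta> \<le> h U w}" for U
  have Gd: "Gd U \<in> sets W" "\<theta> \<le> measure W (Gd U)" if U: "U \<subseteq> {..<n}" for U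
  proof -
    interpret pU: product_prob_space "\<lambda>_. \<sigma>" U ..
    note sl = prob_bilinear_slice[OF \<sigma> U refl W_def refl, where A = "\<lambda>i j. A $$ (i, j)" and \<beta> = "2 * \<beta>", folded L_def, folded h_def]
    have mh: "h U \<in> borel_measurable W" using sl(2) unfolding h_def[abs_def] .
    then show "Gd U \<in> sets W" unfolding Gd_def by measurable
    have "p ^ 4 \<le> measure (iid_law n \<mu>)
        {x \<in> space (iid_law n \<mu>). \<bar>(\<Sum>i<n. \<Sum>j<n. A $$ (i, j) * (x i + f i) * (x j + f j)) - a\<bar> \<le> \<beta>} ^ 4"
      using a p0 by (intro power_mono) auto
    also have "\<dots> \<le> (\<integral>w. h U w \<partial>W)"
      unfolding sl(1)[symmetric]
      by (rule quadratic_decoupling[OF \<mu> U _ \<sigma>_def refl]) (use sym in auto)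
    finally have "p ^ 4 \<le> (\<integral>w. h U w \<partial>W)" .
    then show "\<theta> \<le> measure W (Gd U)"
      unfolding Gd_def \<theta>_def using p0
      by (intro measure_ge_half_integral[OF W mh]) (auto simp: h_def)
  qed
  define K where "K = nat \<lceil>N powr (\<epsilon> / 8)\<rceil>"
  have Npos: "N powr (\<epsilon> / 8) > 1" using N \<epsilon> by simp
  have K: "N powr (\<epsilon> / 8) \<le> real K" "real K \<le> N powr (\<epsilon> / 8) + 1" "real K \<le> N" "K \<ge> 2"
    using Npos n3 unfolding K_def N_def by linarith+
  define M where "M = nat \<lceil>8 * real K ^ 3 / c3\<rceil>"
  have K3: "8 * real K ^ 3 / c3 > 0" using K c by simp
  have M: "M > 0" "8 * real K ^ 3 / c3 \<le> real M" "real M \<le> 8 * real K ^ 3 / c3 + 1"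
    using K3 unfolding M_def by linarith+
  have M': "8 * real K ^ 3 \<le> c3 * real M" using M(2) c by (simp add: field_simps)
  \<comment> \<open>At most log2 k \<le> D log2 N greedy steps occur, each using up \<open>M\<close>
    indices, and one further block of \<open>M\<close> bounds the leftover far elements.\<close>
  define e0 where "e0 = (D * log 2 N + 1) * real M"
  have logN: "log 2 N \<ge> 0" using N by simp
  have e0: "16 * e0 \<le> N powr \<epsilon>"
  proof -
    have "real M \<le> 8 * (N powr (\<epsilon> / 8) + 1) ^ 3 / c3 + 1"
      using K c by (intro order_trans[OF M(3)] add_mono divide_right_mono mult_left_mono power_mono) auto
    then have "e0 \<le> (D * log 2 N + 1) * (8 * (N powr (\<epsilon> / 8) + 1) ^ 3 / c3 + 1)"
      unfolding e0_def using logN D1 by (intro mult_left_mono) auto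
    then show ?thesis using n4 by (simp add: N_def)
  qed
  \<comment> \<open>Only the generating set and k must agree for all rows, and there are
    polynomially many such pairs; the coefficients are not part of the index.\<close>
  define Ik where "Ik = {1..nat \<lfloor>N powr D\<rfloor>}"
  define Idx where "Idx = {X. X \<subseteq> {..<n} \<and> card X \<le> d} \<times> Ik"
  have fX: "finite {X. X \<subseteq> {..<n} \<and> card X \<le> d}" by (rule finite_subset[of _ "Pow {..<n}"]) auto
  have finI: "finite Idx" unfolding Idx_def Ik_def using fX by simp
  have "2 * N \<le> N * N" using N by (intro mult_right_mono) auto
  moreover have "N powr 2 = N * N" using N by (simp add: power2_eq_square)
  ultimately have N2: "N + 1 \<le> N powr 2" using N(1) by linarith
  have cardI: "real (card Idx) \<le> N powr (2 * real d + D)"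
  proof -
    have "real (card {X. X \<subseteq> {..<n} \<and> card X \<le> d}) \<le> real ((n + 1) ^ d)"
      using card_bounded_subsets_le[of n d] by (simp only: of_nat_le_iff)
    also have "\<dots> = (N + 1) ^ d" by (simp add: N_def add.commute)
    also have "\<dots> \<le> (N powr 2) ^ d" using N2 N by (intro power_mono) auto
    also have "\<dots> = N powr (2 * real d)" by (rule powr_pow_eq[OF N(3)])
    finally have "real (card {X. X \<subseteq> {..<n} \<and> card X \<le> d}) * real (card Ik) \<le> N powr (2 * real d) * N powr D"
      unfolding Ik_def by (intro mult_mono) auto
    then show ?thesis by (simp add: Idx_def card_cartesian_product powr_add)
  qed
  define Y where "Y = \<lfloor>N powr (2 * D + 1)\<rfloor>"
  define Ks where "Ks x = PiE (fst x) (\<lambda>_. {- Y..Y})" for x :: "nat set \<times> nat"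
  define \<kappa> where "\<kappa> = N powr ((2 * D + 3) * real d)"
  have Y: "real_of_int Y \<le> N powr (2 * D + 1)" "Y \<ge> 1"
    using D1 N unfolding Y_def by (auto simp: le_floor_iff intro!: ge_one_powr_ge_zero)
  have Ks: "finite (Ks x)" "real (card (Ks x)) \<le> \<kappa>" if x: "x \<in> Idx" for x
  proof -
    have fx: "finite (fst x)" "card (fst x) \<le> d"
      using x by (auto simp: Idx_def intro: finite_subset[of _ "{..<n}"])
    show "finite (Ks x)" unfolding Ks_def using fx by (intro finite_PiE) auto
    have y3: "real (card {- Y..Y}) \<le> N powr (2 * D + 3)"
    proof -
      have "real (card {- Y..Y}) = 2 * real_of_int Y + 1" using Y by simp
      also have "\<dots> \<le> 3 * N powr (2 * D + 1)" using Y by simp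
      also have "\<dots> \<le> N powr 2 * N powr (2 * D + 1)" using N2 N by (intro mult_right_mono) auto
      also have "\<dots> = N powr (2 * D + 3)" by (simp add: add.commute flip: powr_add)
      finally show ?thesis .
    qed
    have "real (card (Ks x)) = real (card {- Y..Y}) ^ card (fst x)"
      unfolding Ks_def using fx by (simp add: card_PiE)
    also have "\<dots> \<le> (N powr (2 * D + 3)) ^ card (fst x)" by (intro power_mono y3) auto
    also have "\<dots> \<le> (N powr (2 * D + 3)) ^ d"
      using fx N D1 by (intro power_increasing ge_one_powr_ge_zero) auto
    also have "\<dots> = \<kappa>" unfolding \<kappa>_def by (rule powr_pow_eq[OF N(3)])
    finally show "real (card (Ks x)) \<le> \<kappa>" .
  qed
  define S where "S i x b = {z \<in> space (\<Pi>\<^sub>M i\<in>{..<n}. (borel :: real measure)).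
      \<bar>real (snd x) * L z i + (\<Sum>h\<in>fst x. real_of_int (b h) * L z h)\<bar> \<le> \<beta> * N powr (2 * D + 1)}"
    for i :: nat and x :: "nat set \<times> nat" and b :: "nat \<Rightarrow> int"
  \<comment> \<open>Requiring \<open>i\<close> to lie outside the generating set costs nothing,
    since generators belong to the bad set, and it later forces \<open>I\<close> and
    \<open>I\<^sub>0\<close> to be disjoint.\<close>
  define T where "T U w i x b \<longleftrightarrow> i \<notin> fst x \<and> mask_out n U w \<in> S i x b"
    for U w i and x :: "nat set \<times> nat" and b :: "nat \<Rightarrow> int"
  have S: "S i x b \<in> sets (\<Pi>\<^sub>M i\<in>{..<n}. borel)" for i x b
  proof -
    have "(\<lambda>z. real (snd x) * L z i + (\<Sum>h\<in>fst x. real_of_int (b h) * L z h)) \<in> borel_measurable (\<Pi>\<^sub>M i\<in>{..<n}. borel)"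
      unfolding L_def
      by (intro borel_measurable_add borel_measurable_sum[of "fst x"] borel_measurable_times borel_measurable_const borel_measurable_linear_comp)
    then show ?thesis unfolding S_def by measurable
  qed
  have mm: "mask_out n U \<in> W \<rightarrow>\<^sub>M (\<Pi>\<^sub>M i\<in>{..<n}. borel)" for U unfolding W_def by (rule mask_out_measurable) simp
  have Tset: "{w \<in> space W. T U w i x b} = (if i \<in> fst x then {} else {w \<in> space W. mask_out n U w \<in> S i x b})" for U i x b
    by (auto simp: T_def)
  have Tm: "{w \<in> space W. T U w i x b} \<in> sets W" for U i x b
  proof -
    have "{w \<in> space W. mask_out n U w \<in> S i x b} = mask_out n U -` S i x b \<inter> space W" by auto
    then show ?thesis unfolding Tset using measurable_sets[OF mm S] by auto
  qed
  have struct: "\<exists>x\<in>Idx. real (card {i \<in> U. \<not> (\<exists>b\<in>Ks x. T U w i x b)}) \<le> e0"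
    if U: "U \<subseteq> {..<n}" and w: "w \<in> Gd U" for U w
  proof -
    have fU: "finite U" using U by (auto intro: finite_subset)
    define z where "z = mask_out n U w"
    have wW: "w \<in> space W" using w by (simp add: Gd_def)
    have zs: "z \<in> space (\<Pi>\<^sub>M i\<in>{..<n}. (borel :: real measure))" unfolding z_def using measurable_space[OF mm wW] .
    have hP: "\<theta> \<le> measure (\<Pi>\<^sub>M i\<in>U. diff_law \<mu>) {u \<in> space (\<Pi>\<^sub>M i\<in>U. diff_law \<mu>). \<bar>\<Sum>i\<in>U. L z i * u i\<bar> \<le> 2 * \<beta>}"
      using w by (simp add: Gd_def h_def \<sigma>_def z_def)
    have b2: "2 * \<beta> > 0" using \<beta> by simp
    obtain k G bad r where k: "0 < k" "real k \<le> 400 / \<theta>\<^sup>2" "2 ^ r \<le> k" "K ^ card G \<le> k"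
      and G: "G \<subseteq> bad" "bad \<subseteq> U" "card bad \<le> Suc r * M"
      and rel: "\<forall>i\<in>U - bad. \<exists>b::nat \<Rightarrow> int. (\<forall>h\<in>G. \<bar>real_of_int (b h)\<bar> \<le> real k * real k * real K) \<and>
        \<bar>real k * L z i + (\<Sum>h\<in>G. real_of_int (b h) * L z h)\<bar> \<le> real k * real k * (2 * (2 * \<beta>) / c1)"
      using linear_inverse[OF adm c fU b2 \<theta>0 hP K(4) M(1) M'] by blast
    have kD: "real k \<le> N powr D"
    proof -
      have "\<theta>\<^sup>2 = N powr (- 8 * B) / 1024" unfolding \<theta> using N by (simp add: power_divide powr_pow_eq)
      then have "400 / \<theta>\<^sup>2 = 409600 * N powr (8 * B)" by (simp add: powr_minus field_simps)
      also have "\<dots> \<le> N * N powr (8 * B)" using N by (intro mult_right_mono) auto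
      also have "\<dots> = N powr D" using N by (simp add: D powr_add)
      finally show ?thesis using k(2) by linarith
    qed
    have kk: "real k * real k \<le> N powr (2 * D)"
    proof -
      have "real k * real k \<le> N powr D * N powr D" using kD by (intro mult_mono) auto
      then show ?thesis by (simp flip: powr_add)
    qed
    have cG: "card G \<le> d"
    proof -
      \<comment> \<open>Each generator contributes a factor of at least N^(\<epsilon>/8) to k, and k
        is at most N^D.\<close>
      have "N powr (\<epsilon> / 8 * real (card G)) = (N powr (\<epsilon> / 8)) ^ card G" using N by (simp add: powr_pow_eq mult.commute)
      also have "\<dots> \<le> real K ^ card G" using K by (intro power_mono) auto
      also have "\<dots> \<le> real k" using k(4) by (simp flip: of_nat_power)
      also have "\<dots> \<le> N powr D" by (rule kD)
      finally have "\<epsilon> / 8 * real (card G) \<le> D" using N by (simp add: powr_le_cancel_iff)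
      then have "real (card G) \<le> 8 * D / \<epsilon>" using \<epsilon> by (simp add: field_simps)
      then show ?thesis using d by linarith
    qed
    have x: "(G, k) \<in> Idx"
      using cG G U k(1) kD by (auto simp: Idx_def Ik_def le_nat_iff le_floor_iff)
    have "{i \<in> U. \<not> (\<exists>b\<in>Ks (G, k). T U w i (G, k) b)} \<subseteq> bad"
    proof
      fix i assume i: "i \<in> {i \<in> U. \<not> (\<exists>b\<in>Ks (G, k). T U w i (G, k) b)}"
      show "i \<in> bad"
      proof (rule ccontr)
        assume ib: "i \<notin> bad"
        then obtain b :: "nat \<Rightarrow> int" where b: "\<forall>h\<in>G. \<bar>real_of_int (b h)\<bar> \<le> real k * real k * real K"
          "\<bar>real k * L z i + (\<Sum>h\<in>G. real_of_int (b h) * L z h)\<bar> \<le> real k * real k * (2 * (2 * \<beta>) / c1)"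
          using rel i by blast
        have "real k * real k * real K \<le> N powr (2 * D) * N" using kk K by (intro mult_mono) auto
        also have "\<dots> = N powr (2 * D + 1)" using N by (simp add: powr_add)
        finally have kY: "real k * real k * real K \<le> N powr (2 * D + 1)" .
        have bY: "b h \<in> {- Y..Y}" if "h \<in> G" for h
        proof -
          have "real_of_int \<bar>b h\<bar> \<le> N powr (2 * D + 1)" using b(1) kY that by force
          then have "\<bar>b h\<bar> \<le> Y" unfolding Y_def by (simp only: le_floor_iff)
          then show ?thesis by auto
        qed
        \<comment> \<open>Decoupling has doubled the radius to 2 \<open>\<beta>\<close>, and undoing
          the scaling by y contributes 2 / \<open>c1\<close>.\<close>
        have "2 * (2 * \<beta>) / c1 = \<beta> * (4 / c1)" by simp
        also have "\<dots> \<le> \<beta> * N" using n2 \<beta> by (intro mult_left_mono) (auto simp: N_def)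
        finally have "real k * real k * (2 * (2 * \<beta>) / c1) \<le> N powr (2 * D) * (\<beta> * N)"
          using kk \<beta> c by (intro mult_mono) auto
        also have "\<dots> = \<beta> * N powr (2 * D + 1)" using N by (simp add: powr_add)
        finally have e: "\<bar>real k * L z i + (\<Sum>h\<in>G. real_of_int (b h) * L z h)\<bar> \<le> \<beta> * N powr (2 * D + 1)"
          using b(2) by linarith
        \<comment> \<open>Values of \<open>b\<close> outside \<open>G\<close> are irrelevant;
          restricting makes it a member of the finite set over which the pigeonhole runs.\<close>
        have "restrict b G \<in> Ks (G, k)" unfolding Ks_def using bY by auto
        moreover have "T U w i (G, k) (restrict b G)"
          unfolding T_def S_def using e zs ib G by (auto simp: z_def)
        ultimately show False using i by blast
      qed
    qed
    then have "real (card {i \<in> U. \<not> (\<exists>b\<in>Ks (G, k). T U w i (G, k) b)}) \<le> real (card bad)"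
      using G(2) fU by (simp add: card_mono finite_subset)
    also have "\<dots> \<le> real (Suc r * M)" using G(3) by (simp only: of_nat_le_iff)
    also have "\<dots> \<le> e0"
    proof -
      have "2 powr real r \<le> N powr D"
        using k(3) kD by (simp add: powr_realpow) (metis of_nat_le_iff of_nat_numeral of_nat_power order_trans)
      then have "real r \<le> log 2 (N powr D)" using N by (simp add: le_log_iff)
      then have "real r \<le> D * log 2 N" using N by (simp add: log_powr)
      then have "(real r + 1) * real M \<le> e0" unfolding e0_def by (intro mult_right_mono) auto
      then show ?thesis by (simp add: algebra_simps)
    qed
    finally show ?thesis using x by blast
  qed
  have tail: "4 * (9 / 10) ^ m * real (card Idx) \<le> \<theta>" if m: "real m \<ge> N powr \<epsilon>" for m
  proof -
    have "(9 / 10 :: real) ^ m = (9 / 10) powr real m" by (simp add: powr_realpow)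
    also have "\<dots> \<le> (9 / 10) powr (N powr \<epsilon>)" using m by (intro powr_mono') auto
    finally have "4 * (9 / 10) ^ m * real (card Idx) \<le> 4 * (9 / 10) powr (N powr \<epsilon>) * N powr (2 * real d + D)"
      using cardI by (intro mult_mono) auto
    also have "\<dots> \<le> \<theta>" using n5 by (simp add: \<theta> N_def)
    finally show ?thesis .
  qed
  have Neps: "N powr \<epsilon> > 0" using N by simp
  have "\<exists>x\<in>Idx. \<exists>J\<subseteq>{..<n}. real (card J) \<le> N powr \<epsilon> \<and>
      (\<forall>i\<in>{..<n} - J. \<exists>b\<in>Ks x. \<theta> / (8 * real (card Idx) * \<kappa>) * 2 ^ n
         \<le> (\<Sum>U\<in>Pow {..<n}. measure W {w \<in> space W. T U w i x b}))"
  proof (rule pigeonhole_subsets[OF W finI, where Gd = Gd and ?e0.0 = e0])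
    show "finite (Ks x)" "real (card (Ks x)) \<le> \<kappa>" if "x \<in> Idx" for x using Ks[OF that] by auto
    show "{w \<in> space W. T U w i x b} \<in> sets W" for U i x b by (rule Tm)
    show "Gd U \<in> sets W" "\<theta> \<le> measure W (Gd U)" if "U \<subseteq> {..<n}" for U using Gd[OF that] by auto
    show "\<exists>x\<in>Idx. real (card {i \<in> U. \<not> (\<exists>b\<in>Ks x. T U w i x b)}) \<le> e0"
      if "U \<subseteq> {..<n}" "w \<in> Gd U" for U w using struct[OF that] .
    show "4 * (9 / 10) ^ m * real (card Idx) \<le> \<theta>" if "N powr \<epsilon> \<le> real m" for m using tail[OF that] .
  qed (fact \<theta>0 e0 Neps)+
  then obtain x J where x: "x \<in> Idx" and J: "J \<subseteq> {..<n}" "real (card J) \<le> N powr \<epsilon>"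
    and T: "\<forall>i\<in>{..<n} - J. \<exists>b\<in>Ks x. \<theta> / (8 * real (card Idx) * \<kappa>) * 2 ^ n
         \<le> (\<Sum>U\<in>Pow {..<n}. measure W {w \<in> space W. T U w i x b})"
    by blast
  obtain I\<^sub>0 k where xk: "x = (I\<^sub>0, k)" by (cases x)
  have I\<^sub>0: "I\<^sub>0 \<subseteq> {..<n}" "card I\<^sub>0 \<le> d" and k: "1 \<le> k" "real k \<le> N powr D"
    using x by (auto simp: xk Idx_def Ik_def le_nat_iff le_floor_iff)
  define I where "I = {..<n} - J"
  obtain b where b: "\<forall>i\<in>I. b i \<in> Ks x \<and> \<theta> / (8 * real (card Idx) * \<kappa>) * 2 ^ n
         \<le> (\<Sum>U\<in>Pow {..<n}. measure W {w \<in> space W. T U w i x (b i)})"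
  proof -
    have "\<exists>b. \<forall>i\<in>I. b i \<in> Ks x \<and> \<theta> / (8 * real (card Idx) * \<kappa>) * 2 ^ n
         \<le> (\<Sum>U\<in>Pow {..<n}. measure W {w \<in> space W. T U w i x (b i)})"
      by (rule bchoice) (use T in \<open>auto simp: I_def\<close>)
    then show thesis using that by blast
  qed
  have cI: "real (card Idx) > 0" using x finI by (auto simp: card_gt_0_iff)
  have \<kappa>0: "\<kappa> > 0" using N by (simp add: \<kappa>_def)
  have lb: "N powr (- (4 * B + (2 * real d + D) + (2 * D + 3) * real d + 1)) \<le> \<theta> / (8 * real (card Idx) * \<kappa>)"
  proof -
    have "N powr (- (4 * B + (2 * real d + D) + (2 * D + 3) * real d + 1)) = N powr (- 4 * B) / (N powr (2 * real d + D) * \<kappa> * N)"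
    proof -
      have "N powr (- (a + b + c + 1)) = N powr (- a) / (N powr b * N powr c * N)" for a b c
        using N by (simp add: powr_minus powr_add powr_diff field_simps)
      from this[of "4 * B" "2 * real d + D" "(2 * D + 3) * real d"] show ?thesis
        unfolding \<kappa>_def mult_minus_left .
    qed
    \<comment> \<open>The constant 256 = 8 * 32 collects the 8 of the pigeonhole and the 32 of
      \<open>\<theta>\<close>; the last summand 1 in the exponent pays for it.\<close>
    also have "\<dots> \<le> N powr (- 4 * B) / (256 * (real (card Idx) * \<kappa>))"
    proof (rule divide_left_mono)
      have "256 * (real (card Idx) * \<kappa>) \<le> N * (N powr (2 * real d + D) * \<kappa>)"
        using N cardI \<kappa>0 by (intro mult_mono mult_right_mono) auto
      then show "256 * (real (card Idx) * \<kappa>) \<le> N powr (2 * real d + D) * \<kappa> * N" by (simp add: mult_ac)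
    qed (use N cI \<kappa>0 in auto)
    also have "\<dots> = \<theta> / (8 * real (card Idx) * \<kappa>)" by (simp add: \<theta>)
    finally show ?thesis .
  qed
  have pos: "\<theta> / (8 * real (card Idx) * \<kappa>) * 2 ^ n > 0" using \<theta>0 cI \<kappa>0 by simp
  define \<nu> where "\<nu> = iid_law n (lazy_diff_law \<mu>)"
  interpret lz: real_distribution "lazy_diff_law \<mu>" by (rule real_distribution_lazy_diff_law[OF \<mu>])
  have sp\<nu>: "space \<nu> = space (\<Pi>\<^sub>M i\<in>{..<n}. (borel :: real measure))"
    unfolding \<nu>_def iid_law_def by (rule sets_eq_imp_space_eq, rule sets_PiM_borel) simp
  have prob: "N powr (- (4 * B + (2 * real d + D) + (2 * D + 3) * real d + 1)) \<le>
      measure \<nu> {z \<in> space \<nu>. \<bar>scalar_prod (vec n z) (row (combination_mat n I I\<^sub>0 (int k) b * A) i)\<bar> \<le> \<beta> * N powr (2 * D + 1)}"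
    if i: "i \<in> I" for i
  proof -
    have bi: "\<theta> / (8 * real (card Idx) * \<kappa>) * 2 ^ n \<le> (\<Sum>U\<in>Pow {..<n}. measure W {w \<in> space W. T U w i x (b i)})"
      using b i by blast
    \<comment> \<open>For \<open>i\<close> in \<open>I\<^sub>0\<close> all events \<open>T\<close>
      would be empty, contrary to the positive lower bound for their sum.\<close>
    have iI: "i \<notin> I\<^sub>0"
    proof
      assume "i \<in> I\<^sub>0"
      then have "(\<Sum>U\<in>Pow {..<n}. measure W {w \<in> space W. T U w i x (b i)}) = 0" by (simp add: T_def xk)
      then show False using bi pos by simp
    qed
    have iN: "i < n" using i by (simp add: I_def)
    have Seq: "{z \<in> space \<nu>. \<bar>scalar_prod (vec n z) (row (combination_mat n I I\<^sub>0 (int k) b * A) i)\<bar> \<le> \<beta> * N powr (2 * D + 1)} = S i x (b i)"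
      unfolding S_def sp\<nu> L_def xk using combination_mat_row_prod[OF A i iN iI I\<^sub>0(1)] by simp
    have "(\<Sum>U\<in>Pow {..<n}. measure W {w \<in> space W. T U w i x (b i)}) =
        (\<Sum>U\<in>Pow {..<n}. measure W {w \<in> space W. mask_out n U w \<in> S i x (b i)})"
      using iI by (simp add: T_def xk)
    then have "measure \<nu> (S i x (b i)) = (\<Sum>U\<in>Pow {..<n}. measure W {w \<in> space W. T U w i x (b i)}) / 2 ^ n"
      unfolding \<nu>_def lazy_iid_eq_average[OF \<mu> S] W_def \<sigma>_def by simp
    also have "\<dots> \<ge> \<theta> / (8 * real (card Idx) * \<kappa>)" using bi by (simp add: field_simps)
    finally show ?thesis unfolding Seq using lb by linarith
  qed
  have bK: "real_of_int \<bar>b i h\<bar> \<le> N powr (2 * D + 1)" if "i \<in> I" "h \<in> I\<^sub>0" for i h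
  proof -
    have "b i h \<in> {- Y..Y}" using b that unfolding Ks_def xk by (auto simp: PiE_iff)
    then have "\<bar>b i h\<bar> \<le> Y" by auto
    then have "real_of_int \<bar>b i h\<bar> \<le> real_of_int Y" by (simp only: of_int_le_iff)
    then show ?thesis using Y by linarith
  qed
  have cardI': "real (card I) \<ge> N - N powr \<epsilon>"
  proof -
    have "card I = n - card J" unfolding I_def using J by (simp add: card_Diff_subset finite_subset)
    then show ?thesis using J(2) by (simp add: N_def)
  qed
  show ?thesis
    unfolding Let_def N_def[symmetric] \<nu>_def[symmetric]
    by (rule exI[of _ I\<^sub>0], rule exI[of _ I], rule exI[of _ "int k"], rule exI[of _ b])
      (use I\<^sub>0 cardI' k prob bK in \<open>auto simp: I_def\<close>)
qed

section \<open>Small n and a uniform constant\<close>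

lemma scalar_prod_vec_row:
  fixes z :: "nat \<Rightarrow> real"
  assumes "R \<in> carrier_mat n n" "i < n"
  shows "scalar_prod (vec n z) (row R i) = (\<Sum>l<n. R $$ (i, l) * z l)"
  using assms by (auto simp: scalar_prod_def atLeast0LessThan intro!: sum.cong)

text \<open>All coordinates are masked with probability 2^(-n), and then the vector is zero.\<close>

lemma lazy_iid_zero_prob:
  assumes \<mu>: "real_distribution \<mu>" and S: "S \<in> sets (\<Pi>\<^sub>M i\<in>{..<n}. (borel :: real measure))"
    and zero: "(\<lambda>i\<in>{..<n}. 0) \<in> S"
  shows "1 / 2 ^ n \<le> measure (iid_law n (lazy_diff_law \<mu>)) S"
proof -
  define \<sigma> where "\<sigma> = diff_law \<mu>"
  interpret \<sigma>: real_distribution \<sigma> unfolding \<sigma>_def by (rule real_distribution_diff_law[OF \<mu>])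
  interpret pW: product_prob_space "\<lambda>_. \<sigma>" "{..<n}" ..
  define W where "W = (\<Pi>\<^sub>M i\<in>{..<n}. \<sigma>)"
  have mo: "mask_out n {..<n} w = (\<lambda>i\<in>{..<n}. 0)" for w by (auto simp: mask_out_def)
  have "1 = measure W {w \<in> space W. mask_out n {..<n} w \<in> S}"
    using zero pW.P.prob_space by (simp add: mo W_def)
  also have "\<dots> \<le> (\<Sum>U\<in>Pow {..<n}. measure W {w \<in> space W. mask_out n U w \<in> S})"
    by (rule member_le_sum) auto
  finally show ?thesis
    unfolding lazy_iid_eq_average[OF \<mu> S] W_def \<sigma>_def by (simp add: divide_right_mono)
qed

lemma row_event_measurable:
  fixes A :: "real mat"
  assumes \<mu>: "real_distribution \<mu>" and A: "A \<in> carrier_mat n n" and i: "i < n"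
    and \<nu>_def: "\<nu> = iid_law n (lazy_diff_law \<mu>)"
  shows "{z \<in> space \<nu>. \<bar>scalar_prod (vec n z) (row (combination_mat n I I\<^sub>0 k K * A) i)\<bar> \<le> t} \<in> sets \<nu>"
    and "sets \<nu> = sets (\<Pi>\<^sub>M i\<in>{..<n}. borel)"
    and "prob_space \<nu>"
proof -
  interpret lz: real_distribution "lazy_diff_law \<mu>" by (rule real_distribution_lazy_diff_law[OF \<mu>])
  interpret pL: product_prob_space "\<lambda>_. lazy_diff_law \<mu>" "{..<n}" ..
  show "prob_space \<nu>" unfolding \<nu>_def iid_law_def by (rule pL.P.prob_space_axioms)
  show sets: "sets \<nu> = sets (\<Pi>\<^sub>M i\<in>{..<n}. borel)"
    unfolding \<nu>_def iid_law_def by (rule sets_PiM_borel) simp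
  have sp: "space \<nu> = space (\<Pi>\<^sub>M i\<in>{..<n}. (borel :: real measure))" by (rule sets_eq_imp_space_eq[OF sets])
  have RA: "combination_mat n I I\<^sub>0 k K * A \<in> carrier_mat n n"
    by (rule mult_carrier_mat[OF _ A]) (simp add: combination_mat_def)
  show "{z \<in> space \<nu>. \<bar>scalar_prod (vec n z) (row (combination_mat n I I\<^sub>0 k K * A) i)\<bar> \<le> t} \<in> sets \<nu>"
    unfolding sets sp scalar_prod_vec_row[OF RA i] using borel_measurable_linear_comp by simp
qed

text \<open>For bounded n the zero vector alone suffices, as it satisfies every small ball
  condition: 2^n \<le> n^n \<le> n^C when 2 \<le> n \<le> C.\<close>

lemma row_event_prob_ge:
  fixes A :: "real mat"
  assumes \<mu>: "real_distribution \<mu>" and A: "A \<in> carrier_mat n n" and i: "i < n"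
    and n: "2 \<le> n" "real n \<le> C" and t: "t \<ge> 0"
    and \<nu>_def: "\<nu> = iid_law n (lazy_diff_law \<mu>)"
  shows "real n powr (- C) \<le> measure \<nu> {z \<in> space \<nu>. \<bar>scalar_prod (vec n z) (row (combination_mat n I I\<^sub>0 k K * A) i)\<bar> \<le> t}"
proof -
  note meas = row_event_measurable[OF \<mu> A i \<nu>_def]
  let ?S = "{z \<in> space \<nu>. \<bar>scalar_prod (vec n z) (row (combination_mat n I I\<^sub>0 k K * A) i)\<bar> \<le> t}"
  have "(2::real) ^ n = 2 powr real n" by (simp add: powr_realpow)
  also have "\<dots> \<le> real n powr real n" using n by (intro powr_mono2) auto
  also have "\<dots> \<le> real n powr C" using n by (intro powr_mono) auto
  finally have "real n powr (- C) \<le> 1 / 2 ^ n" using n by (simp add: powr_minus field_simps)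
  also have "\<dots> \<le> measure \<nu> ?S"
    unfolding \<nu>_def
  proof (rule lazy_iid_zero_prob[OF \<mu>], fold \<nu>_def)
    show "?S \<in> sets (\<Pi>\<^sub>M i\<in>{..<n}. borel)" using meas by simp
    have RA: "combination_mat n I I\<^sub>0 k K * A \<in> carrier_mat n n"
      by (rule mult_carrier_mat[OF _ A]) (simp add: combination_mat_def)
    have "(\<lambda>i\<in>{..<n}. 0) \<in> space \<nu>"
      unfolding sets_eq_imp_space_eq[OF meas(2)] by (simp add: space_PiM)
    moreover have "scalar_prod (vec n (\<lambda>i\<in>{..<n}. 0)) (row (combination_mat n I I\<^sub>0 k K * A) i) = 0"
      unfolding scalar_prod_vec_row[OF RA i] by simp
    ultimately show "(\<lambda>i\<in>{..<n}. 0) \<in> ?S" using t by simp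
  qed
  finally show ?thesis .
qed

text \<open>In the fourth condition the left side is of order x^(3\<epsilon>/8) log x; in the fifth,
  exponential decay in x^\<epsilon> beats every power of x.\<close>

lemma asymptotic_conditions:
  fixes \<epsilon> B c1 c3 D d :: real
  assumes "0 < \<epsilon>" "\<epsilon> < 1" "0 < c1" "0 < c3"
  shows "eventually (\<lambda>x::real. 409600 \<le> x \<and> 4 / c1 \<le> x \<and> x powr (\<epsilon> / 8) + 1 \<le> x \<and>
    16 * ((D * log 2 x + 1) * (8 * (x powr (\<epsilon> / 8) + 1) ^ 3 / c3 + 1)) \<le> x powr \<epsilon> \<and>
    4 * (9 / 10) powr (x powr \<epsilon>) * x powr (2 * d + D) \<le> x powr (- 4 * B) / 32) at_top"
proof -
  have "eventually (\<lambda>x::real. 409600 \<le> x) at_top" "eventually (\<lambda>x::real. 4 / c1 \<le> x) at_top"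
    by (rule eventually_ge_at_top)+
  moreover have "eventually (\<lambda>x::real. x powr (\<epsilon> / 8) + 1 \<le> x) at_top"
    using assms by real_asymp
  moreover have "eventually (\<lambda>x::real. 16 * ((D * log 2 x + 1) * (8 * (x powr (\<epsilon> / 8) + 1) ^ 3 / c3 + 1)) \<le> x powr \<epsilon>) at_top"
    unfolding log_def using assms by real_asymp
  moreover have "eventually (\<lambda>x::real. 4 * (9 / 10) powr (x powr \<epsilon>) * x powr (2 * d + D) \<le> x powr (- 4 * B) / 32) at_top"
    using assms by real_asymp
  ultimately show ?thesis by eventually_elim blast
qed

theorem theorem3p3:
  fixes \<epsilon> B c1 c2 c3 :: real
  assumes "0 < \<epsilon>" and "\<epsilon> < 1" and "0 < B" and "0 < c1" and "c1 < c2" and "0 < c3"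
  shows "\<exists>C::real. \<forall>(n::nat) (\<beta>::real) (\<mu>::real measure) (A::real mat) (f::nat \<Rightarrow> real).
    \<beta> > 0 \<longrightarrow>
    admissible_law c1 c2 c3 \<mu> \<longrightarrow>
    A \<in> carrier_mat n n \<longrightarrow>
    (\<forall>i<n. \<forall>j<n. A $$ (i, j) = A $$ (j, i)) \<longrightarrow>
    (\<Sum>i<n. \<Sum>j<n. (A $$ (i, j))\<^sup>2) = 1 \<longrightarrow>
    quad_concentration n \<mu> A f \<beta> \<ge> real n powr (- B) \<longrightarrow>
    (\<exists>(I\<^sub>0::nat set) (I::nat set) (k::int) (K::nat \<Rightarrow> nat \<Rightarrow> int).
       I\<^sub>0 \<subseteq> {..<n} \<and> real (card I\<^sub>0) \<le> C \<and>
       I \<subseteq> {..<n} \<and> real (card I) \<ge> real n - 2 * real n powr \<epsilon> \<and>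
       k \<noteq> 0 \<and> real_of_int \<bar>k\<bar> \<le> real n powr C \<and>
       (\<forall>i\<in>I. \<forall>i\<^sub>0\<in>I\<^sub>0. real_of_int \<bar>K i i\<^sub>0\<bar> \<le> real n powr C) \<and>
       (let A' = combination_mat n I I\<^sub>0 k K * A; \<nu> = iid_law n (lazy_diff_law \<mu>) in
         \<forall>i\<in>I. measure \<nu> {z \<in> space \<nu>. \<bar>scalar_prod (vec n z) (row A' i)\<bar> \<le> \<beta> * real n powr C}
                 \<ge> real n powr (- C)))"
proof -
  define D where "D = 8 * B + 1"
  define d where "d = nat \<lceil>8 * D / \<epsilon>\<rceil>"
  have D: "D > 1" using assms by (simp add: D_def)
  have d: "8 * D / \<epsilon> \<le> real d" unfolding d_def by linarith
  obtain x0 where x0: "\<And>x::real. x \<ge> x0 \<Longrightarrow> 409600 \<le> x \<and> 4 / c1 \<le> x \<and> x powr (\<epsilon> / 8) + 1 \<le> x \<and>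
    16 * ((D * log 2 x + 1) * (8 * (x powr (\<epsilon> / 8) + 1) ^ 3 / c3 + 1)) \<le> x powr \<epsilon> \<and>
    4 * (9 / 10) powr (x powr \<epsilon>) * x powr (2 * real d + D) \<le> x powr (- 4 * B) / 32"
    using asymptotic_conditions[of \<epsilon> c1 c3 D "real d" B] assms unfolding eventually_at_top_linorder by blast
  define c where "c = 4 * B + (2 * real d + D) + (2 * D + 3) * real d + 1"
  \<comment> \<open>The summand |x0| covers all n below the asymptotic threshold by the zero-vector
    bound, which needs n \<le> C.\<close>
  define C where "C = c + (2 * D + 1) + \<bar>x0\<bar>"
  have c: "real d \<le> c" "c \<ge> 0" using D assms by (auto simp: c_def intro!: add_nonneg_nonneg mult_nonneg_nonneg add_increasing add_increasing2)
  have C: "c \<le> C" "D \<le> C" "2 * D + 1 \<le> C" "x0 \<le> C" "0 \<le> C" "real d \<le> C"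
    using c D by (auto simp: C_def)
  show ?thesis
  proof (intro exI[of _ C] allI impI)
    fix n :: nat and \<beta> :: real and \<mu> :: "real measure" and A :: "real mat" and f :: "nat \<Rightarrow> real"
    assume \<beta>: "\<beta> > 0" and adm: "admissible_law c1 c2 c3 \<mu>" and A: "A \<in> carrier_mat n n"
      and sym: "\<forall>i<n. \<forall>j<n. A $$ (i, j) = A $$ (j, i)"
      and norm1: "(\<Sum>i<n. \<Sum>j<n. (A $$ (i, j))\<^sup>2) = 1"
      and conc: "quad_concentration n \<mu> A f \<beta> \<ge> real n powr (- B)"
    have \<mu>: "real_distribution \<mu>" using adm by (simp add: admissible_law_def)
    \<comment> \<open>The normalisation of \<open>A\<close> excludes n = 0.\<close>
    have n1: "n \<ge> 1" using norm1 by (cases n) auto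
    let ?goal = "\<lambda>I\<^sub>0 I k K. I\<^sub>0 \<subseteq> {..<n} \<and> real (card I\<^sub>0) \<le> C \<and>
       I \<subseteq> {..<n} \<and> real (card I) \<ge> real n - 2 * real n powr \<epsilon> \<and>
       k \<noteq> 0 \<and> real_of_int \<bar>k\<bar> \<le> real n powr C \<and>
       (\<forall>i\<in>I. \<forall>i\<^sub>0\<in>I\<^sub>0. real_of_int \<bar>K i i\<^sub>0\<bar> \<le> real n powr C) \<and>
       (let A' = combination_mat n I I\<^sub>0 k K * A; \<nu> = iid_law n (lazy_diff_law \<mu>) in
         \<forall>i\<in>I. measure \<nu> {z \<in> space \<nu>. \<bar>scalar_prod (vec n z) (row A' i)\<bar> \<le> \<beta> * real n powr C}
                 \<ge> real n powr (- C))"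
    define \<nu> where "\<nu> = iid_law n (lazy_diff_law \<mu>)"
    consider "n = 1" | "n \<ge> 2" "real n < x0" | "real n \<ge> x0" using n1 by linarith
    then show "\<exists>I\<^sub>0 I k K. ?goal I\<^sub>0 I k K"
    proof cases
      case 1
      \<comment> \<open>All powers of 1 equal 1, so \<open>C\<close> offers no room here; but n - 2
        n^\<epsilon> is negative and \<open>I\<close> may be empty.\<close>
      show ?thesis
        by (rule exI[of _ "{}"], rule exI[of _ "{}"], rule exI[of _ 1], rule exI[of _ "\<lambda>_ _. 0"])
          (use 1 C in \<open>simp add: Let_def\<close>)
    next
      case 2
      have "real n powr (- C) \<le> measure \<nu> {z \<in> space \<nu>. \<bar>scalar_prod (vec n z) (row (combination_mat n {..<n} {} 1 (\<lambda>_ _. 0) * A) i)\<bar> \<le> \<beta> * real n powr C}"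
        if i: "i < n" for i
        by (rule row_event_prob_ge[OF \<mu> A i 2(1) _ _ \<nu>_def]) (use 2 C \<beta> in auto)
      moreover have "1 \<le> real n powr C" using 2 C by (intro ge_one_powr_ge_zero) auto
      ultimately show ?thesis
        using C unfolding Let_def \<nu>_def[symmetric]
        by (intro exI[of _ "{}"] exI[of _ "{..<n}"] exI[of _ 1] exI[of _ "\<lambda>_ _. 0"]) auto
    next
      case 3
      note x = x0[OF 3]
      have n: "real n \<ge> 1" using n1 by simp
      have mono: "real n powr a \<le> real n powr C" if "a \<le> C" for a using that n by (intro powr_mono) auto
      obtain I\<^sub>0 I k K where I: "I\<^sub>0 \<subseteq> {..<n}" "card I\<^sub>0 \<le> d" "I \<subseteq> {..<n}" "real (card I) \<ge> real n - real n powr \<epsilon>"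
        and k: "k \<noteq> 0" "real_of_int \<bar>k\<bar> \<le> real n powr D"
        and K: "\<forall>i\<in>I. \<forall>i\<^sub>0\<in>I\<^sub>0. real_of_int \<bar>K i i\<^sub>0\<bar> \<le> real n powr (2 * D + 1)"
        and P: "\<forall>i\<in>I. measure \<nu> {z \<in> space \<nu>. \<bar>scalar_prod (vec n z) (row (combination_mat n I I\<^sub>0 k K * A) i)\<bar> \<le> \<beta> * real n powr (2 * D + 1)}
                 \<ge> real n powr (- c)"
        using quadratic_inverse_large[OF assms(1,3,4,6) \<beta> adm A sym conc D_def d] x
        unfolding Let_def c_def \<nu>_def by blast
      let ?Z = "\<lambda>i a. {z \<in> space \<nu>. \<bar>scalar_prod (vec n z) (row (combination_mat n I I\<^sub>0 k K * A) i)\<bar> \<le> \<beta> * real n powr a}"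
      have "real (card I\<^sub>0) \<le> C" using I(2) C by linarith
      moreover have "real (card I) \<ge> real n - 2 * real n powr \<epsilon>" using I(4) powr_ge_zero[of "real n" \<epsilon>] by linarith
      moreover have "real_of_int \<bar>k\<bar> \<le> real n powr C" using k(2) mono[OF C(2)] by linarith
      moreover have "\<forall>i\<in>I. \<forall>i\<^sub>0\<in>I\<^sub>0. real_of_int \<bar>K i i\<^sub>0\<bar> \<le> real n powr C" using K mono[OF C(3)] by fastforce
      moreover have "real n powr (- C) \<le> measure \<nu> (?Z i C)"
        if i: "i \<in> I" for i
      proof -
        have iN: "i < n" using i I by auto
        have "real n powr (- C) \<le> real n powr (- c)" using n C by (intro powr_mono) auto
        also have "\<dots> \<le> measure \<nu> (?Z i (2 * D + 1))"
          using P i by blast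
        also have "\<dots> \<le> measure \<nu> (?Z i C)"
        proof (rule finite_measure.finite_measure_mono[OF prob_space.finite_measure])
          show "prob_space \<nu>" by (rule row_event_measurable(3)[OF \<mu> A iN \<nu>_def])
          show "?Z i C \<in> sets \<nu>"
            by (rule row_event_measurable(1)[OF \<mu> A iN \<nu>_def])
          have "\<beta> * real n powr (2 * D + 1) \<le> \<beta> * real n powr C" using \<beta> mono[OF C(3)] by (intro mult_left_mono) auto
          then show "?Z i (2 * D + 1)
            \<subseteq> ?Z i C" by auto
        qed
        finally show ?thesis .
      qed
      ultimately have "?goal I\<^sub>0 I k K" using I(1,3) k(1) unfolding Let_def \<nu>_def by blast
      then show ?thesis by blast
    qed
  qed
qed

end
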